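(* Let $(N_0,\mathfrak n)$ be a Heisenberg-Clifford super Lie group, let $\mathrm B:\mathfrak n_1\times\mathfrak n_1\to\mathbb R$ be the symmetric bilinear form $\mathrm B(P,Q)=[P,Q]$ (the bracket lies in the one-dimensional summand $\mathbb R$ of $\mathfrak n_0$ and is thought of as a real number), and suppose that $\chi:\mathcal Z(N_0)\to\mathbb C^\times$ is a nontrivial unitary character of the centre of $N_0$. (a) If $\mathrm B$ is an indefinite form, then there are no irreducible unitary representations of $(N_0,\mathfrak n)$ with central character $\chi$. (b) Suppose that $\mathrm B$ is a definite form. If $\chi$ agrees with $\mathrm B$, then up to unitary equivalence and parity change there exists a unique irreducible unitary representation of $(N_0,\mathfrak n)$ with central character $\chi$. If $\chi$ does not agree with $\mathrm B$, then such a unitary representation does not exist.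
   Context: All Lie algebras and Lie superalgebras are finite-dimensional over $\mathbb R$. Heisenberg-Clifford super Lie groups. Let $\mathfrak w=\mathfrak w_0\oplus\mathfrak w_1$ be a $\mathbb Z_2$-graded real vector space with a nondegenerate bilinear form $\omega:\mathfrak w\times\mathfrak w\to\mathbb R$ such that $\omega(\mathfrak w_0,\mathfrak w_1)=\omega(\mathfrak w_1,\mathfrak w_0)=\{0\}$, $\omega|_{\mathfrak w_0}$ is symplectic, and $\omega|_{\mathfrak w_1}$ is symmetric. The Heisenberg-Clifford Lie superalgebra is $\mathfrak n=\mathfrak w\oplus\mathbb R$ with $\mathfrak n_0=\mathfrak w_0\oplus\mathbb R$, $\mathfrak n_1=\mathfrak w_1$ and $[(P,a),(Q,b)]=(0,\omega(P,Q))$. With $N_0$ the simply connected nilpotent Lie group with Lie algebra $\mathfrak n_0$, $(N_0,\mathfrak n)$ is called a Heisenberg-Clifford super Lie group. The centre $\mathcal Z(N_0)$ is the image under $\exp$ of the summand $\mathbb R$ of $\mathfrak n_0$. "Agrees". When $\mathrm B$ is a definite form, $\chi$ is said to agree with $\mathrm B$ if there exists a positive real number $c$ such that for every $P\in\mathfrak n_1$, $\chi(\exp([P,P]))=e^{c\,\mathrm B(P,P)\sqrt{-1}}$. A super Lie group is a pair $(G_0,\mathfrak g)$ where $\mathfrak g=\mathfrak g_0\oplus\mathfrak g_1$ is a Lie superalgebra, $G_0$ is a connected Lie group with Lie algebra $\mathfrak g_0$ acting smoothly on $\mathfrak g$ by $\mathbb R$-linear automorphisms ($g\cdot X$ denotes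 the action), the action on $\mathfrak g_0$ is the adjoint action, and the differential of the action of $G_0$ on $\mathfrak g$ is the adjoint action of $\mathfrak g_0$ on $\mathfrak g$. For a unitary representation $(\pi,\mathcal H)$ of a Lie group, $\mathcal H^\infty$ is its space of smooth vectors and $\pi^\infty$ the infinitesimal action on $\mathcal H^\infty$. A unitary representation of $(G_0,\mathfrak g)$ is a triple $(\pi,\rho^\pi,\mathcal H)$ where $\mathcal H=\mathcal H_0\oplus\mathcal H_1$ is a $\mathbb Z_2$-graded Hilbert space (orthogonal sum), $\pi$ is a unitary representation of $G_0$ on $\mathcal H$ by even operators, and $\rho^\pi:\mathfrak g_1\to\mathrm{End}_{\mathbb C}(\mathcal H^\infty)$ is $\mathbb R$-linear such that for all $X,Y\in\mathfrak g_1$, $g\in G_0$: $\rho^\pi(X)$ is odd and symmetric ($\langle\rho^\pi(X)v,w\rangle=\langle v,\rho^\pi(X)w\rangle$ for $v,w\in\mathcal H^\infty$); $\rho^\pi(X)\rho^\pi(Y)+\rho^\pi(Y)\rho^\pi(X)=-\sqrt{-1}\,\pi^\infty([X,Y])$ on $\mathcal H^\infty$; $\rho^\pi(g\cdot X)=\pi(g)\rho^\pi(X)\pi(g^{-1})$. It is irreducible if $\mathcal H\neq 0$ has no nonzero proper closed $\mathbb Z_2$-graded invariant subspace. A representation of $(N_0,\mathfrak n)$ has central character $\chi$ if $\pi(z)=\chi(z)\,\mathrm{id}$ for all $z\in\mathcal Z(N_0)$. Unitary equivalence means existence of an even surjective linear isometry intertwining both $\pi$ and $\rho^\pi$. Parity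 change replaces $\mathcal H$ by the same space with $\mathcal H_0,\mathcal H_1$ interchanged.
   Formalization: "Agrees" is taken with |B(P,P)| in place of B(P,P): this changes nothing for positive definite B, while for negative definite B on a nonzero odd part the literal condition (c > 0) makes part (b) false, since 2ρ(P)² = cB(P,P) < 0 contradicts the symmetry of ρ(P). *)

theory Defs
  imports "HOL-Analysis.Analysis"
begin

section \<open>Complex Hilbert spaces\<close>

text \<open>
  A complex Hilbert space is a real Hilbert space (the library class, so norm and topology are the
  library's) together with a compatible complex scalar multiplication and a sesquilinear form,
  linear in the first argument, whose real part is the real inner product.
\<close>

class complex_hilbert = real_inner + complete_space +
  fixes scaleC :: "complex \<Rightarrow> 'a \<Rightarrow> 'a" (infixr "*\<^sub>C" 75)
    and cinner :: "'a \<Rightarrow> 'a \<Rightarrow> complex"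
  assumes scaleC_add_right: "c *\<^sub>C (x + y) = c *\<^sub>C x + c *\<^sub>C y"
    and scaleC_add_left: "(c + d) *\<^sub>C x = c *\<^sub>C x + d *\<^sub>C x"
    and scaleC_scaleC: "c *\<^sub>C (d *\<^sub>C x) = (c * d) *\<^sub>C x"
    and scaleC_of_real: "complex_of_real r *\<^sub>C x = r *\<^sub>R x"
    and cinner_add_left: "cinner (x + y) z = cinner x z + cinner y z"
    and cinner_scaleC_left: "cinner (c *\<^sub>C x) y = c * cinner x y"
    and cinner_commute: "cinner x y = cnj (cinner y x)"
    and inner_eq_Re_cinner: "inner x y = Re (cinner x y)"

definition csubspace :: "'h::complex_hilbert set \<Rightarrow> bool"
  where "csubspace S \<longleftrightarrow> subspace S \<and> (\<forall>c. \<forall>x\<in>S. c *\<^sub>C x \<in> S)"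

definition clinear_on :: "'h::complex_hilbert set \<Rightarrow> ('h \<Rightarrow> 'k::complex_hilbert) \<Rightarrow> bool"
  where "clinear_on S f \<longleftrightarrow>
    (\<forall>x\<in>S. \<forall>y\<in>S. f (x + y) = f x + f y) \<and> (\<forall>c. \<forall>x\<in>S. f (c *\<^sub>C x) = c *\<^sub>C f x)"

subsection \<open>The Hilbert space of square-summable complex sequences\<close>

text \<open>
  Existence of a representation has to be asserted on a concrete type. All Hilbert spaces below are
  closed subspaces of types of class \<open>complex_hilbert\<close>; up to isometry, the separable ones are the
  closed subspaces of \<open>ell2\<close>.
\<close>

typedef ell2 = "{f :: nat \<Rightarrow> complex. summable (\<lambda>n. (cmod (f n))\<^sup>2)}"
  morphisms ell2_coord Abs_ell2
  by (rule exI[of _ "\<lambda>_. 0"]) simp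

setup_lifting type_definition_ell2

lemma ell2_summable_sq: "summable (\<lambda>n. (cmod (ell2_coord x n))\<^sup>2)"
  using ell2_coord[of x] by simp

lemma summable_sq_prod:
  fixes f g :: "nat \<Rightarrow> complex"
  assumes "summable (\<lambda>n. (cmod (f n))\<^sup>2)" "summable (\<lambda>n. (cmod (g n))\<^sup>2)"
  shows "summable (\<lambda>n. f n * cnj (g n))"
proof (rule summable_comparison_test')
  show "summable (\<lambda>n. (cmod (f n))\<^sup>2 + (cmod (g n))\<^sup>2)"
    by (intro summable_add assms)
  fix n
  have "2 * (cmod (f n) * cmod (g n)) \<le> (cmod (f n))\<^sup>2 + (cmod (g n))\<^sup>2"
    using sum_squares_bound[of "cmod (f n)" "cmod (g n)"] by (simp add: mult.assoc)
  moreover have "0 \<le> cmod (f n) * cmod (g n)" by simp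
  ultimately show "norm (f n * cnj (g n)) \<le> (cmod (f n))\<^sup>2 + (cmod (g n))\<^sup>2"
    unfolding norm_mult complex_mod_cnj by linarith
qed

lemma summable_sq_scale:
  fixes f :: "nat \<Rightarrow> complex"
  assumes "summable (\<lambda>n. (cmod (f n))\<^sup>2)"
  shows "summable (\<lambda>n. (cmod (c * f n))\<^sup>2)"
  using assms by (simp add: norm_mult power_mult_distrib summable_mult)

lemma summable_sq_add:
  fixes f g :: "nat \<Rightarrow> complex"
  assumes "summable (\<lambda>n. (cmod (f n))\<^sup>2)" "summable (\<lambda>n. (cmod (g n))\<^sup>2)"
  shows "summable (\<lambda>n. (cmod (f n + g n))\<^sup>2)"
proof (rule summable_comparison_test')
  show "summable (\<lambda>n. 2 * (cmod (f n))\<^sup>2 + 2 * (cmod (g n))\<^sup>2)"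
    by (intro summable_add summable_mult assms)
  fix n
  have "(cmod (f n + g n))\<^sup>2 \<le> (cmod (f n) + cmod (g n))\<^sup>2"
    by (intro power_mono norm_triangle_ineq) simp
  moreover have "2 * cmod (f n) * cmod (g n) \<le> (cmod (f n))\<^sup>2 + (cmod (g n))\<^sup>2"
    by (rule sum_squares_bound)
  ultimately show "norm ((cmod (f n + g n))\<^sup>2) \<le> 2 * (cmod (f n))\<^sup>2 + 2 * (cmod (g n))\<^sup>2"
    by (simp add: power2_sum)
qed

instantiation ell2 :: real_vector
begin

lift_definition zero_ell2 :: ell2 is "\<lambda>_. 0" by simp

lift_definition plus_ell2 :: "ell2 \<Rightarrow> ell2 \<Rightarrow> ell2" is "\<lambda>f g n. f n + g n"
  by (rule summable_sq_add)

lift_definition uminus_ell2 :: "ell2 \<Rightarrow> ell2" is "\<lambda>f n. - f n"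
  by simp

lift_definition minus_ell2 :: "ell2 \<Rightarrow> ell2 \<Rightarrow> ell2" is "\<lambda>f g n. f n - g n"
  using summable_sq_add[OF _ summable_sq_scale[where c = "- 1"]] by simp

lift_definition scaleR_ell2 :: "real \<Rightarrow> ell2 \<Rightarrow> ell2" is "\<lambda>r f n. complex_of_real r * f n"
  by (rule summable_sq_scale)

instance
  by standard (transfer, simp add: algebra_simps)+

end

lemma ell2_coord_simps [simp]:
  "ell2_coord 0 n = 0"
  "ell2_coord (x + y) n = ell2_coord x n + ell2_coord y n"
  "ell2_coord (- x) n = - ell2_coord x n"
  "ell2_coord (x - y) n = ell2_coord x n - ell2_coord y n"
  "ell2_coord (r *\<^sub>R x) n = complex_of_real r * ell2_coord x n"
  by (transfer, simp)+

lemma ell2_eqI: "(\<And>n. ell2_coord x n = ell2_coord y n) \<Longrightarrow> x = y"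
  by transfer auto

definition ell2_cinner :: "ell2 \<Rightarrow> ell2 \<Rightarrow> complex"
  where "ell2_cinner x y = (\<Sum>n. ell2_coord x n * cnj (ell2_coord y n))"

lemma ell2_summable_cinner: "summable (\<lambda>n. ell2_coord x n * cnj (ell2_coord y n))"
  by (intro summable_sq_prod ell2_summable_sq)

lemma ell2_cinner_self:
  "ell2_cinner x x = complex_of_real (\<Sum>n. (cmod (ell2_coord x n))\<^sup>2)"
proof -
  have "ell2_cinner x x = (\<Sum>n. complex_of_real ((cmod (ell2_coord x n))\<^sup>2))"
    unfolding ell2_cinner_def complex_norm_square ..
  also have "\<dots> = complex_of_real (\<Sum>n. (cmod (ell2_coord x n))\<^sup>2)"
    by (rule suminf_of_real[symmetric, OF ell2_summable_sq])
  finally show ?thesis .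
qed

lemma ell2_cinner_add: "ell2_cinner (x + y) z = ell2_cinner x z + ell2_cinner y z"
  unfolding ell2_cinner_def
  by (simp add: distrib_right suminf_add[OF ell2_summable_cinner ell2_summable_cinner])

lemma ell2_cinner_scaleR: "ell2_cinner (r *\<^sub>R x) y = complex_of_real r * ell2_cinner x y"
  unfolding ell2_cinner_def
  by (simp add: mult.assoc suminf_mult[OF ell2_summable_cinner])

lemma ell2_cinner_commute: "ell2_cinner x y = cnj (ell2_cinner y x)"
proof -
  have "(\<lambda>n. ell2_coord y n * cnj (ell2_coord x n)) sums ell2_cinner y x"
    unfolding ell2_cinner_def by (rule summable_sums[OF ell2_summable_cinner])
  hence "(\<lambda>n. cnj (ell2_coord y n * cnj (ell2_coord x n))) sums cnj (ell2_cinner y x)"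
    by (subst sums_cnj)
  hence "(\<lambda>n. ell2_coord x n * cnj (ell2_coord y n)) sums cnj (ell2_cinner y x)"
    by (simp add: mult.commute)
  thus ?thesis unfolding ell2_cinner_def by (rule sums_unique[symmetric])
qed

instantiation ell2 :: real_inner
begin

definition "inner (x :: ell2) y = Re (ell2_cinner x y)"

definition "norm (x :: ell2) = sqrt (inner x x)"

definition "dist (x :: ell2) y = norm (x - y)"

definition "sgn (x :: ell2) = x /\<^sub>R norm x"

definition "(uniformity :: (ell2 \<times> ell2) filter) = (INF e\<in>{0 <..}. principal {(x, y). dist x y < e})"

definition "open (U :: ell2 set) =
  (\<forall>x\<in>U. eventually (\<lambda>(x', y). x' = x \<longrightarrow> y \<in> U) uniformity)"

instance
proof
  fix x y z :: ell2 and a :: real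
  have inner_self: "inner x x = (\<Sum>n. (cmod (ell2_coord x n))\<^sup>2)" for x :: ell2
    by (simp add: inner_ell2_def ell2_cinner_self)
  show "dist x y = norm (x - y)" by (rule dist_ell2_def)
  show "sgn x = x /\<^sub>R norm x" by (rule sgn_ell2_def)
  show "(uniformity :: (ell2 \<times> ell2) filter) = (INF e\<in>{0 <..}. principal {(x, y). dist x y < e})"
    by (rule uniformity_ell2_def)
  show "open U \<longleftrightarrow> (\<forall>x\<in>U. \<forall>\<^sub>F (x', y) in uniformity. x' = x \<longrightarrow> y \<in> U)" for U :: "ell2 set"
    by (rule open_ell2_def)
  show "inner x y = inner y x"
    unfolding inner_ell2_def by (subst ell2_cinner_commute) simp
  show "inner (x + y) z = inner x z + inner y z"
    by (simp add: inner_ell2_def ell2_cinner_add)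
  show "inner (a *\<^sub>R x) y = a * inner x y"
    by (simp add: inner_ell2_def ell2_cinner_scaleR)
  show "0 \<le> inner x x"
    unfolding inner_self by (intro suminf_nonneg ell2_summable_sq) simp
  show "inner x x = 0 \<longleftrightarrow> x = 0"
  proof
    assume "inner x x = 0"
    hence "\<forall>n. (cmod (ell2_coord x n))\<^sup>2 = 0"
      unfolding inner_self by (subst (asm) suminf_eq_zero_iff) (simp_all add: ell2_summable_sq)
    thus "x = 0" by (intro ell2_eqI) simp
  qed (simp add: inner_self)
  show "norm x = sqrt (inner x x)" by (rule norm_ell2_def)
qed

end

lemma ell2_norm_sq: "(norm x)\<^sup>2 = (\<Sum>n. (cmod (ell2_coord x n))\<^sup>2)"
  by (simp add: power2_norm_eq_inner inner_ell2_def ell2_cinner_self)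

lemma ell2_partial_le: "(\<Sum>n<M. (cmod (ell2_coord x n))\<^sup>2) \<le> (norm x)\<^sup>2"
  unfolding ell2_norm_sq by (rule sum_le_suminf) (simp_all add: ell2_summable_sq)

lemma ell2_coord_le: "cmod (ell2_coord x n) \<le> norm x"
proof -
  have "(cmod (ell2_coord x n))\<^sup>2 \<le> (\<Sum>k<Suc n. (cmod (ell2_coord x k))\<^sup>2)"
    by (simp add: sum_nonneg)
  also have "\<dots> \<le> (norm x)\<^sup>2" by (rule ell2_partial_le)
  finally show ?thesis by (rule power2_le_imp_le) simp
qed

instance ell2 :: complete_space
proof
  fix X :: "nat \<Rightarrow> ell2"
  assume "Cauchy X"
  hence C: "\<exists>N. \<forall>m\<ge>N. \<forall>n\<ge>N. norm (X m - X n) < e" if "e > 0" for e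
    using that metric_CauchyD[OF \<open>Cauchy X\<close>] by (simp add: dist_norm)
  have "Cauchy (\<lambda>k. ell2_coord (X k) n)" for n
  proof (rule CauchyI)
    fix e :: real assume "e > 0"
    then obtain N where N: "\<forall>m\<ge>N. \<forall>k\<ge>N. norm (X m - X k) < e" using C by blast
    have "norm (ell2_coord (X m) n - ell2_coord (X k) n) < e" if "m \<ge> N" "k \<ge> N" for m k
      using ell2_coord_le[of "X m - X k" n] N that by (auto intro: le_less_trans)
    thus "\<exists>N. \<forall>m\<ge>N. \<forall>k\<ge>N. norm (ell2_coord (X m) n - ell2_coord (X k) n) < e" by blast
  qed
  hence "\<forall>n. \<exists>l. (\<lambda>k. ell2_coord (X k) n) \<longlonglongrightarrow> l"
    by (auto simp: Cauchy_convergent_iff convergent_def)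
  then obtain l where l: "\<And>n. (\<lambda>k. ell2_coord (X k) n) \<longlonglongrightarrow> l n" by metis
  have bound: "(\<Sum>n<M. (cmod (ell2_coord (X m) n - l n))\<^sup>2) \<le> e\<^sup>2"
    if e: "e > 0" and N: "\<forall>m\<ge>N. \<forall>k\<ge>N. norm (X m - X k) < e" and m: "m \<ge> N" for e N M m
  proof (rule LIMSEQ_le_const2)
    show "(\<lambda>k. \<Sum>n<M. (cmod (ell2_coord (X m) n - ell2_coord (X k) n))\<^sup>2)
        \<longlonglongrightarrow> (\<Sum>n<M. (cmod (ell2_coord (X m) n - l n))\<^sup>2)"
      by (intro tendsto_intros l)
    show "\<exists>N. \<forall>k\<ge>N. (\<Sum>n<M. (cmod (ell2_coord (X m) n - ell2_coord (X k) n))\<^sup>2) \<le> e\<^sup>2"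
    proof (intro exI[of _ N] allI impI)
      fix k assume "k \<ge> N"
      hence "norm (X m - X k) \<le> e" using N m by (simp add: less_imp_le)
      hence "(norm (X m - X k))\<^sup>2 \<le> e\<^sup>2"
        by (intro power_mono) simp_all
      thus "(\<Sum>n<M. (cmod (ell2_coord (X m) n - ell2_coord (X k) n))\<^sup>2) \<le> e\<^sup>2"
        using ell2_partial_le[where x = "X m - X k" and M = M] by simp
    qed
  qed
  have diff: "summable (\<lambda>n. (cmod (ell2_coord (X m) n - l n))\<^sup>2) \<and>
      (\<Sum>n. (cmod (ell2_coord (X m) n - l n))\<^sup>2) \<le> e\<^sup>2"
    if "e > 0" "\<forall>m\<ge>N. \<forall>k\<ge>N. norm (X m - X k) < e" "m \<ge> N" for e N m
  proof
    have sums: "(\<Sum>n<M. (cmod (ell2_coord (X m) n - l n))\<^sup>2) \<le> e\<^sup>2" for M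
      by (rule bound[OF that])
    show *: "summable (\<lambda>n. (cmod (ell2_coord (X m) n - l n))\<^sup>2)"
      by (rule bounded_imp_summable[where B = "e\<^sup>2"])
        (simp, simp only: sums lessThan_Suc_atMost[symmetric])
    show "(\<Sum>n. (cmod (ell2_coord (X m) n - l n))\<^sup>2) \<le> e\<^sup>2"
      by (rule suminf_le_const[OF * sums])
  qed
  obtain N1 where N1: "\<forall>m\<ge>N1. \<forall>k\<ge>N1. norm (X m - X k) < 1" using C[of 1] by auto
  have "summable (\<lambda>n. (cmod (ell2_coord (X N1) n - l n))\<^sup>2)"
    using diff[OF _ N1] by simp
  from summable_sq_add[OF ell2_summable_sq[of "X N1"] summable_sq_scale[OF this, of "- 1"]]
  have sl: "summable (\<lambda>n. (cmod (l n))\<^sup>2)" by simp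
  define L where "L = Abs_ell2 l"
  have L: "ell2_coord L n = l n" for n
    unfolding L_def using sl by (subst Abs_ell2_inverse) simp_all
  have conv: "\<exists>N. \<forall>m\<ge>N. dist (X m) L < e" if e: "e > 0" for e
  proof -
    have e2: "e / 2 > 0" using e by simp
    obtain N where N: "\<forall>m\<ge>N. \<forall>k\<ge>N. norm (X m - X k) < e / 2" using C[OF e2] by blast
    have "dist (X m) L < e" if "m \<ge> N" for m
    proof -
      have "(norm (X m - L))\<^sup>2 \<le> (e / 2)\<^sup>2"
        unfolding ell2_norm_sq using diff[OF e2 N that] by (simp add: L)
      hence "norm (X m - L) \<le> e / 2" by (rule power2_le_imp_le) (use e in simp)
      thus ?thesis using e by (simp add: dist_norm)
    qed
    thus ?thesis by blast
  qed
  show "convergent X" using metric_LIMSEQ_I[OF conv] by (auto simp: convergent_def)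
qed

instantiation ell2 :: complex_hilbert
begin

lift_definition scaleC_ell2 :: "complex \<Rightarrow> ell2 \<Rightarrow> ell2" is "\<lambda>c f n. c * f n"
  by (rule summable_sq_scale)

definition "cinner (x :: ell2) y = ell2_cinner x y"

instance
proof
  fix x y z :: ell2 and r :: real and c d :: complex
  show "c *\<^sub>C (x + y) = c *\<^sub>C x + c *\<^sub>C y" "(c + d) *\<^sub>C x = c *\<^sub>C x + d *\<^sub>C x"
       "c *\<^sub>C (d *\<^sub>C x) = (c * d) *\<^sub>C x" "complex_of_real r *\<^sub>C x = r *\<^sub>R x"
    by (transfer, simp add: algebra_simps)+
  have "ell2_coord (c *\<^sub>C x) n = c * ell2_coord x n" for n by transfer simp
  thus "cinner (c *\<^sub>C x) y = c * cinner x y"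
    by (simp add: cinner_ell2_def ell2_cinner_def mult.assoc suminf_mult[OF ell2_summable_cinner])
  show "cinner (x + y) z = cinner x z + cinner y z"
    by (simp add: cinner_ell2_def ell2_cinner_add)
  show "cinner x y = cnj (cinner y x)"
    unfolding cinner_ell2_def by (rule ell2_cinner_commute)
  show "inner x y = Re (cinner x y)"
    by (simp add: cinner_ell2_def inner_ell2_def)
qed

end

section \<open>Heisenberg-Clifford super Lie groups\<close>

text \<open>
  The graded space is the sum of two arbitrary (possibly zero) subspaces with trivial intersection
  of a Euclidean space, which provides the usual topology; its inner product plays no role. Only the
  values of the form on this sum matter. Antisymmetry on the even part together with nondegeneracy
  of the whole form says that the even part is symplectic.
\<close>

record 'v hc_data =
  hc_even :: "'v set"
  hc_odd :: "'v set"
  hc_form :: "'v \<Rightarrow> 'v \<Rightarrow> real"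

definition hc_space :: "('v::euclidean_space) hc_data \<Rightarrow> 'v set"
  where "hc_space D = {P + Q | P Q. P \<in> hc_even D \<and> Q \<in> hc_odd D}"

definition heisenberg_clifford :: "('v::euclidean_space) hc_data \<Rightarrow> bool"
  where "heisenberg_clifford D \<longleftrightarrow>
    subspace (hc_even D) \<and> subspace (hc_odd D) \<and> hc_even D \<inter> hc_odd D = {0} \<and>
    bilinear (hc_form D) \<and>
    (\<forall>P\<in>hc_space D. (\<forall>Q\<in>hc_space D. hc_form D P Q = 0) \<longrightarrow> P = 0) \<and>
    (\<forall>P\<in>hc_even D. \<forall>Q\<in>hc_odd D. hc_form D P Q = 0 \<and> hc_form D Q P = 0) \<and>
    (\<forall>P\<in>hc_even D. \<forall>Q\<in>hc_even D. hc_form D P Q = - hc_form D Q P) \<and>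
    (\<forall>P\<in>hc_odd D. \<forall>Q\<in>hc_odd D. hc_form D P Q = hc_form D Q P)"

definition hc_n0 :: "('v::euclidean_space) hc_data \<Rightarrow> ('v \<times> real) set"
  where "hc_n0 D = hc_even D \<times> UNIV"

definition hc_n1 :: "('v::euclidean_space) hc_data \<Rightarrow> ('v \<times> real) set"
  where "hc_n1 D = hc_odd D \<times> {0}"

definition hc_bracket ::
    "('v::euclidean_space) hc_data \<Rightarrow> 'v \<times> real \<Rightarrow> 'v \<times> real \<Rightarrow> 'v \<times> real"
  where "hc_bracket D X Y = (0, hc_form D (fst X) (fst Y))"

text \<open>
  The simply connected nilpotent Lie group of the even part, in exponential coordinates: its
  underlying manifold is the vector space \<open>hc_n0 D\<close>, the exponential map is the identity, and
  the product is given by the Baker-Campbell-Hausdorff formula, which stops after the first bracket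
  because the algebra is two-step nilpotent. For the same reason the adjoint action
  \<open>Ad (exp X) = exp (ad X)\<close> is \<open>Y \<mapsto> Y + [X, Y]\<close>.
\<close>

definition hc_N0 :: "('v::euclidean_space) hc_data \<Rightarrow> ('v \<times> real) set"
  where "hc_N0 D = hc_n0 D"

definition hc_exp :: "'v::euclidean_space \<times> real \<Rightarrow> 'v \<times> real"
  where "hc_exp X = X"

definition hc_mult ::
    "('v::euclidean_space) hc_data \<Rightarrow> 'v \<times> real \<Rightarrow> 'v \<times> real \<Rightarrow> 'v \<times> real"
  where "hc_mult D g h = g + h + (1 / 2) *\<^sub>R hc_bracket D g h"

definition hc_one :: "'v::euclidean_space \<times> real"
  where "hc_one = 0"

definition hc_inv :: "'v::euclidean_space \<times> real \<Rightarrow> 'v \<times> real"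
  where "hc_inv g = - g"

definition hc_act ::
    "('v::euclidean_space) hc_data \<Rightarrow> 'v \<times> real \<Rightarrow> 'v \<times> real \<Rightarrow> 'v \<times> real"
  where "hc_act D g Y = Y + hc_bracket D g Y"

definition hc_centre :: "('v::euclidean_space \<times> real) set"
  where "hc_centre = hc_exp ` ({0} \<times> UNIV)"

lemma hc_group_laws:
  assumes "heisenberg_clifford D" "g \<in> hc_N0 D" "h \<in> hc_N0 D" "k \<in> hc_N0 D"
  shows "hc_mult D g h \<in> hc_N0 D" "hc_one \<in> hc_N0 D" "hc_inv g \<in> hc_N0 D"
    and "hc_mult D (hc_mult D g h) k = hc_mult D g (hc_mult D h k)"
    and "hc_mult D hc_one g = g" "hc_mult D (hc_inv g) g = hc_one"
    and "hc_act D (hc_mult D g h) Y = hc_act D g (hc_act D h Y)"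
    and "hc_mult D (hc_mult D g (hc_exp h)) (hc_inv g) = hc_exp (hc_act D g h)"
proof -
  have sub: "subspace (hc_even D)" and bil: "bilinear (hc_form D)"
    and alt: "\<And>P Q. P \<in> hc_even D \<Longrightarrow> Q \<in> hc_even D \<Longrightarrow> hc_form D P Q = - hc_form D Q P"
    using assms(1) unfolding heisenberg_clifford_def by blast+
  have even: "fst g \<in> hc_even D" "fst h \<in> hc_even D"
    using assms by (auto simp: hc_N0_def hc_n0_def)
  note form = bilinear_ladd[OF bil] bilinear_radd[OF bil] bilinear_lneg[OF bil]
    bilinear_rneg[OF bil] bilinear_lzero[OF bil] bilinear_rzero[OF bil]
  have gg: "hc_form D (fst g) (fst g) = 0" using alt[OF even(1,1)] by simp
  note defs = hc_mult_def hc_bracket_def hc_one_def hc_inv_def hc_act_def hc_exp_def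
    hc_N0_def hc_n0_def
  show "hc_mult D g h \<in> hc_N0 D" "hc_one \<in> hc_N0 D" "hc_inv g \<in> hc_N0 D"
    using even sub by (auto simp: defs mem_Times_iff subspace_add subspace_0 subspace_neg)
  show "hc_mult D (hc_mult D g h) k = hc_mult D g (hc_mult D h k)"
    by (simp add: defs form prod_eq_iff algebra_simps)
  show "hc_mult D hc_one g = g" by (simp add: defs form prod_eq_iff)
  show "hc_mult D (hc_inv g) g = hc_one" by (simp add: defs form gg prod_eq_iff)
  show "hc_act D (hc_mult D g h) Y = hc_act D g (hc_act D h Y)"
    by (simp add: defs form prod_eq_iff)
  show "hc_mult D (hc_mult D g (hc_exp h)) (hc_inv g) = hc_exp (hc_act D g h)"
    by (simp add: defs form gg prod_eq_iff alt[OF even(2,1)])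
qed

definition hc_B ::
    "('v::euclidean_space) hc_data \<Rightarrow> 'v \<times> real \<Rightarrow> 'v \<times> real \<Rightarrow> real"
  where "hc_B D P Q = snd (hc_bracket D P Q)"

definition positive_definite_on :: "'a::zero set \<Rightarrow> ('a \<Rightarrow> 'a \<Rightarrow> real) \<Rightarrow> bool"
  where "positive_definite_on S b \<longleftrightarrow> (\<forall>P\<in>S. P \<noteq> 0 \<longrightarrow> b P P > 0)"

definition definite_on :: "'a::zero set \<Rightarrow> ('a \<Rightarrow> 'a \<Rightarrow> real) \<Rightarrow> bool"
  where "definite_on S b \<longleftrightarrow> positive_definite_on S b \<or> positive_definite_on S (\<lambda>P Q. - b P Q)"

definition indefinite_on :: "'a set \<Rightarrow> ('a \<Rightarrow> 'a \<Rightarrow> real) \<Rightarrow> bool"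
  where "indefinite_on S b \<longleftrightarrow> (\<exists>P\<in>S. b P P > 0) \<and> (\<exists>P\<in>S. b P P < 0)"

definition unitary_character ::
    "('v::euclidean_space) hc_data \<Rightarrow> ('v \<times> real \<Rightarrow> complex) \<Rightarrow> bool"
  where "unitary_character D chi \<longleftrightarrow>
    continuous_on hc_centre chi \<and> (\<forall>z\<in>hc_centre. cmod (chi z) = 1) \<and>
    (\<forall>z\<in>hc_centre. \<forall>z'\<in>hc_centre. chi (hc_mult D z z') = chi z * chi z')"

text \<open>
  The absolute value fixes the orientation of the line in which the definite form takes its values
  so that the form is positive. For a positive definite form this is the condition
  \<open>chi (exp [P, P]) = e^(c B(P, P) i)\<close> itself (\<open>agrees_positive\<close>). For a negative definite form on a nonzero odd part
  that condition, with \<open>c\<close> positive, is incompatible with the relation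
  \<open>2 \<rho>(P)\<^sup>2 = - i \<pi>\<^sup>\<infinity>([P, P]) = c B(P, P)\<close> and the symmetry of \<open>\<rho>(P)\<close>; there the same
  condition is imposed on \<open>- B\<close>.
\<close>

definition agrees ::
    "('v::euclidean_space) hc_data \<Rightarrow> ('v \<times> real \<Rightarrow> complex) \<Rightarrow> bool"
  where "agrees D chi \<longleftrightarrow>
    (\<exists>c>0. \<forall>P\<in>hc_n1 D.
      chi (hc_exp (hc_bracket D P P)) = exp (complex_of_real (c * \<bar>hc_B D P P\<bar>) * \<i>))"

lemma agrees_positive:
  assumes "positive_definite_on (hc_n1 D) (hc_B D)" "bilinear (hc_form D)"
  shows "agrees D chi \<longleftrightarrow>
    (\<exists>c>0. \<forall>P\<in>hc_n1 D. chi (hc_exp (hc_bracket D P P)) = exp (complex_of_real (c * hc_B D P P) * \<i>))"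
proof -
  have "hc_B D P P \<ge> 0" if "P \<in> hc_n1 D" for P
    using assms(1) that bilinear_lzero[OF assms(2)]
    by (cases "P = 0") (auto simp: positive_definite_on_def hc_B_def hc_bracket_def intro: less_imp_le)
  hence abs: "\<bar>hc_B D P P\<bar> = hc_B D P P" if "P \<in> hc_n1 D" for P using that by simp
  show ?thesis unfolding agrees_def by (simp add: abs cong: ball_cong)
qed

section \<open>Unitary representations\<close>

text \<open>
  \<open>Ck_on k S f\<close>: \<open>f\<close> is \<open>k\<close> times continuously differentiable on the linear subspace \<open>S\<close>;
  derivatives are taken within \<open>S\<close> and in the directions of \<open>S\<close>.
\<close>

primrec Ck_on ::
    "nat \<Rightarrow> 'a::euclidean_space set \<Rightarrow> ('a \<Rightarrow> 'b::real_normed_vector) \<Rightarrow> bool"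
  where
    "Ck_on 0 S f \<longleftrightarrow> continuous_on S f"
  | "Ck_on (Suc k) S f \<longleftrightarrow>
      (\<exists>f'. (\<forall>x\<in>S. (f has_derivative f' x) (at x within S)) \<and> (\<forall>v\<in>S. Ck_on k S (\<lambda>x. f' x v)))"

definition smooth_on :: "'a::euclidean_space set \<Rightarrow> ('a \<Rightarrow> 'b::real_normed_vector) \<Rightarrow> bool"
  where "smooth_on S f \<longleftrightarrow> (\<forall>k. Ck_on k S f)"

text \<open>
  The Hilbert space of a representation is the orthogonal sum of two closed subspaces of a type of
  class \<open>complex_hilbert\<close>. The values of \<open>grp_op\<close> outside this space, and those of \<open>odd_op\<close>
  outside the smooth vectors, are irrelevant.
\<close>

record ('v, 'h) hc_rep =
  even_part :: "'h set"
  odd_part :: "'h set"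
  grp_op :: "'v \<times> real \<Rightarrow> 'h \<Rightarrow> 'h"
  odd_op :: "'v \<times> real \<Rightarrow> 'h \<Rightarrow> 'h"

definition rep_space :: "('v::euclidean_space, 'h::complex_hilbert) hc_rep \<Rightarrow> 'h set"
  where "rep_space R = {x + y | x y. x \<in> even_part R \<and> y \<in> odd_part R}"

definition smooth_vectors ::
    "('v::euclidean_space) hc_data \<Rightarrow> ('v, 'h::complex_hilbert) hc_rep \<Rightarrow> 'h set"
  where "smooth_vectors D R = {v \<in> rep_space R. smooth_on (hc_N0 D) (\<lambda>g. grp_op R g v)}"

definition inf_action ::
    "('v::euclidean_space, 'h::complex_hilbert) hc_rep \<Rightarrow> 'v \<times> real \<Rightarrow> 'h \<Rightarrow> 'h"
  where "inf_action R X v = vector_derivative (\<lambda>t. grp_op R (hc_exp (t *\<^sub>R X)) v) (at 0)"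

definition graded_hilbert :: "('v::euclidean_space, 'h::complex_hilbert) hc_rep \<Rightarrow> bool"
  where "graded_hilbert R \<longleftrightarrow>
    csubspace (even_part R) \<and> closed (even_part R) \<and>
    csubspace (odd_part R) \<and> closed (odd_part R) \<and>
    (\<forall>x\<in>even_part R. \<forall>y\<in>odd_part R. cinner x y = 0)"

definition even_unitary_group_rep ::
    "('v::euclidean_space) hc_data \<Rightarrow> ('v, 'h::complex_hilbert) hc_rep \<Rightarrow> bool"
  where "even_unitary_group_rep D R \<longleftrightarrow>
    (\<forall>g\<in>hc_N0 D.
      clinear_on (rep_space R) (grp_op R g) \<and>
      grp_op R g ` even_part R \<subseteq> even_part R \<and> grp_op R g ` odd_part R \<subseteq> odd_part R \<and>
      (\<forall>v\<in>rep_space R. \<forall>w\<in>rep_space R. cinner (grp_op R g v) (grp_op R g w) = cinner v w)) \<and>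
    (\<forall>v\<in>rep_space R. grp_op R hc_one v = v) \<and>
    (\<forall>g\<in>hc_N0 D. \<forall>h\<in>hc_N0 D. \<forall>v\<in>rep_space R.
      grp_op R (hc_mult D g h) v = grp_op R g (grp_op R h v)) \<and>
    (\<forall>v\<in>rep_space R. continuous_on (hc_N0 D) (\<lambda>g. grp_op R g v))"

definition unitary_rep ::
    "('v::euclidean_space) hc_data \<Rightarrow> ('v, 'h::complex_hilbert) hc_rep \<Rightarrow> bool"
  where "unitary_rep D R \<longleftrightarrow>
    graded_hilbert R \<and> even_unitary_group_rep D R \<and>
    (\<forall>X\<in>hc_n1 D.
      odd_op R X ` smooth_vectors D R \<subseteq> smooth_vectors D R \<and>
      clinear_on (smooth_vectors D R) (odd_op R X)) \<and>
    (\<forall>X\<in>hc_n1 D. \<forall>Y\<in>hc_n1 D. \<forall>v\<in>smooth_vectors D R.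
      odd_op R (X + Y) v = odd_op R X v + odd_op R Y v) \<and>
    (\<forall>X\<in>hc_n1 D. \<forall>r. \<forall>v\<in>smooth_vectors D R. odd_op R (r *\<^sub>R X) v = r *\<^sub>R odd_op R X v) \<and>
    (\<forall>X\<in>hc_n1 D.
      odd_op R X ` (smooth_vectors D R \<inter> even_part R) \<subseteq> odd_part R \<and>
      odd_op R X ` (smooth_vectors D R \<inter> odd_part R) \<subseteq> even_part R) \<and>
    (\<forall>X\<in>hc_n1 D. \<forall>v\<in>smooth_vectors D R. \<forall>w\<in>smooth_vectors D R.
      cinner (odd_op R X v) w = cinner v (odd_op R X w)) \<and>
    (\<forall>X\<in>hc_n1 D. \<forall>Y\<in>hc_n1 D. \<forall>v\<in>smooth_vectors D R.
      odd_op R X (odd_op R Y v) + odd_op R Y (odd_op R X v)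
        = (- \<i>) *\<^sub>C inf_action R (hc_bracket D X Y) v) \<and>
    (\<forall>g\<in>hc_N0 D. \<forall>X\<in>hc_n1 D. \<forall>v\<in>smooth_vectors D R.
      odd_op R (hc_act D g X) v = grp_op R g (odd_op R X (grp_op R (hc_inv g) v)))"

definition graded_invariant_subspace ::
    "('v::euclidean_space) hc_data \<Rightarrow> ('v, 'h::complex_hilbert) hc_rep \<Rightarrow> 'h set \<Rightarrow> bool"
  where "graded_invariant_subspace D R K \<longleftrightarrow>
    csubspace K \<and> K = {x + y | x y. x \<in> K \<inter> even_part R \<and> y \<in> K \<inter> odd_part R} \<and>
    (\<forall>g\<in>hc_N0 D. grp_op R g ` K \<subseteq> K) \<and>
    (\<forall>X\<in>hc_n1 D. odd_op R X ` (K \<inter> smooth_vectors D R) \<subseteq> K)"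

definition irreducible_unitary_rep ::
    "('v::euclidean_space) hc_data \<Rightarrow> ('v, 'h::complex_hilbert) hc_rep \<Rightarrow> bool"
  where "irreducible_unitary_rep D R \<longleftrightarrow>
    unitary_rep D R \<and> rep_space R \<noteq> {0} \<and>
    (\<forall>K. graded_invariant_subspace D R K \<and> closed K \<longrightarrow> K = {0} \<or> K = rep_space R)"

definition has_central_character ::
    "('v::euclidean_space, 'h::complex_hilbert) hc_rep \<Rightarrow> ('v \<times> real \<Rightarrow> complex) \<Rightarrow> bool"
  where "has_central_character R chi \<longleftrightarrow>
    (\<forall>z\<in>hc_centre. \<forall>v\<in>rep_space R. grp_op R z v = chi z *\<^sub>C v)"

definition unitarily_equivalent ::
    "('v::euclidean_space) hc_data \<Rightarrow> ('v, 'h::complex_hilbert) hc_rep \<Rightarrow>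
      ('v, 'k::complex_hilbert) hc_rep \<Rightarrow> bool"
  where "unitarily_equivalent D R R' \<longleftrightarrow>
    (\<exists>T. clinear_on (rep_space R) T \<and> T ` rep_space R = rep_space R' \<and>
      (\<forall>v\<in>rep_space R. norm (T v) = norm v) \<and>
      T ` even_part R \<subseteq> even_part R' \<and> T ` odd_part R \<subseteq> odd_part R' \<and>
      (\<forall>g\<in>hc_N0 D. \<forall>v\<in>rep_space R. T (grp_op R g v) = grp_op R' g (T v)) \<and>
      (\<forall>X\<in>hc_n1 D. \<forall>v\<in>smooth_vectors D R. T (odd_op R X v) = odd_op R' X (T v)))"

definition parity_change ::
    "('v::euclidean_space, 'h::complex_hilbert) hc_rep \<Rightarrow> ('v, 'h) hc_rep"
  where "parity_change R = R\<lparr>even_part := odd_part R, odd_part := even_part R\<rparr>"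

end

theory Submission
  imports Defs "HOL-Real_Asymp.Real_Asymp"
begin

text \<open>
  The central character is \<open>cis (lam * t)\<close> with \<open>lam \<noteq> 0\<close>. In symplectic coordinates the Weyl operators
  of one mode form a projective representation \<open>V\<close> of the complex plane, and, as in von Neumann's
  proof of the uniqueness of the canonical commutation relations, the Gaussian average of \<open>V z v\<close>
  is a vacuum: \<open>exp (|c|\<^sup>2 / 2) V c x\<close> is entire in \<open>c\<close>, so that the coefficient of \<open>V c\<close> at two vacua is
  \<open>exp (- |c|\<^sup>2 / 2)\<close> times their inner product. Some average is nonzero by Fourier inversion, and
  averages over different modes commute, so every nonzero closed invariant subspace contains a
  common vacuum. Its orbit has the Gram matrix of the coherent states, hence is smooth.

  On a smooth vector \<open>2 \<rho>(P)\<^sup>2\<close> is multiplication by \<open>lam * B(P, P)\<close>, which must therefore be nonnegative: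
  this excludes indefinite forms and characters that do not agree with \<open>B\<close>. Otherwise an orthonormal
  basis of the odd part acts by Clifford generators. They commute with the Weyl operators, so the
  vacuum may be chosen homogeneous and fixed by the products \<open>i \<rho>(u(2 l)) \<rho>(u(2 l + 1))\<close>. Applying Weyl
  operators and generators to it gives a family whose Gram matrix does not depend on the
  representation, and vectors with equal Gram matrices differ by an isometry of their closed spans.
  This yields uniqueness, and it also defines the operators of a model on the tensor products of coherent
  states with an orthonormal basis indexed by sets of generators.
\<close>

section \<open>Closed subspaces and Gram matrices\<close>

text \<open>The odd operators live only on smooth vectors, a space that is not closed. Unboundedness
  is nevertheless no obstacle: odd brackets are central, so \<open>rho\<close> has a scalar square,
  and symmetry then makes it bounded on smooth vectors. Operator identities can therefore be checked
  on a total family of smooth vectors. The vacuum orbit supplies such a family, and also the nonzero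
  smooth vector on which positivity is tested. Vacua are handled through inner products alone.
  Averages are weak integrals obtained from Riesz representation, and annihilation operators, which
  would be unbounded, are replaced by holomorphy of matrix coefficients. Holomorphy can be treated
  one mode at a time and, being linear in the vector, also yields the off-diagonal coefficients that
  a quadratic vacuum condition leaves open. An odd number of Clifford generators leaves the last one
  without a partner, hence without a chirality. Letter sets differing only there are separated by
  the grading, and that generator carries an odd pure vacuum to an even one. With an even number no
  such move exists, which is why uniqueness holds only up to parity change.\<close>

instance complex_hilbert \<subseteq> banach ..

lemma scaleC_zero_left [simp]: "0 *\<^sub>C (x::'a::complex_hilbert) = 0"
  using scaleC_of_real[of 0 x] by simp

lemma scaleC_one [simp]: "1 *\<^sub>C (x::'a::complex_hilbert) = x"
  using scaleC_of_real[of 1 x] by simp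

lemma scaleC_zero_right [simp]: "c *\<^sub>C (0::'a::complex_hilbert) = 0"
  using scaleC_add_right[of c 0 "0::'a"] by simp

lemma scaleC_minus_right [simp]: "c *\<^sub>C (- x::'a::complex_hilbert) = - (c *\<^sub>C x)"
  using scaleC_add_right[of c x "-x"] by (simp add: add_eq_0_iff)

lemma scaleC_minus_left [simp]: "(- c) *\<^sub>C (x::'a::complex_hilbert) = - (c *\<^sub>C x)"
  using scaleC_add_left[of c "-c" x] by (simp add: add_eq_0_iff)

lemma scaleC_diff_right: "c *\<^sub>C (x - y::'a::complex_hilbert) = c *\<^sub>C x - c *\<^sub>C y"
  using scaleC_add_right[of c x "-y"] by simp

lemma scaleR_eq_scaleC: "r *\<^sub>R (x::'a::complex_hilbert) = complex_of_real r *\<^sub>C x"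
  by (simp add: scaleC_of_real)

lemma cinner_add_right: "cinner (x::'a::complex_hilbert) (y + z) = cinner x y + cinner x z"
  by (metis cinner_add_left cinner_commute complex_cnj_add)

lemma cinner_scaleC_right: "cinner (x::'a::complex_hilbert) (c *\<^sub>C y) = cnj c * cinner x y"
  by (metis cinner_commute cinner_scaleC_left complex_cnj_mult)

lemma cinner_zero_left [simp]: "cinner 0 (x::'a::complex_hilbert) = 0"
  using cinner_scaleC_left[of 0 x x] by simp

lemma cinner_zero_right [simp]: "cinner (x::'a::complex_hilbert) 0 = 0"
  using cinner_scaleC_right[of x 0 x] by simp

lemma cinner_minus_left [simp]: "cinner (- x) (y::'a::complex_hilbert) = - cinner x y"
  using cinner_scaleC_left[of "-1" x y] by simp

lemma cinner_minus_right [simp]: "cinner x (- y::'a::complex_hilbert) = - cinner x y"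
  using cinner_scaleC_right[of x "-1" y] by simp

lemma cinner_diff_left: "cinner (x - y) (z::'a::complex_hilbert) = cinner x z - cinner y z"
  using cinner_add_left[of x "-y" z] by simp

lemma cinner_diff_right: "cinner x (y - z::'a::complex_hilbert) = cinner x y - cinner x z"
  using cinner_add_right[of x y "-z"] by simp

lemma cinner_self: "cinner x (x::'a::complex_hilbert) = complex_of_real ((norm x)\<^sup>2)"
proof -
  have "Im (cinner x x) = 0" using cinner_commute[of x x] by (metis cnj.sel(2) neg_equal_zero)
  thus ?thesis by (simp add: complex_eq_iff power2_norm_eq_inner inner_eq_Re_cinner)
qed

text \<open>Complex statements reduce to real ones: the imaginary part is a real inner product with
  the second argument turned by a right angle.\<close>

lemma Im_cinner: "Im (cinner x (y::'a::complex_hilbert)) = inner x (\<i> *\<^sub>C y)"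
  by (simp add: inner_eq_Re_cinner cinner_scaleC_right)

lemma norm_scaleC: "norm (c *\<^sub>C (x::'a::complex_hilbert)) = cmod c * norm x"
proof -
  have "cinner (c *\<^sub>C x) (c *\<^sub>C x) = (c * cnj c) * cinner x x"
    by (simp add: cinner_scaleC_left cinner_scaleC_right)
  hence "complex_of_real ((norm (c *\<^sub>C x))\<^sup>2) = complex_of_real ((cmod c * norm x)\<^sup>2)"
    by (simp only: cinner_self complex_norm_square[symmetric] power_mult_distrib of_real_mult)
  hence "(norm (c *\<^sub>C x))\<^sup>2 = (cmod c * norm x)\<^sup>2" using of_real_eq_iff by blast
  thus ?thesis by (simp add: power2_eq_iff_nonneg)
qed

text \<open>Multiplying \<open>x\<close> by the conjugate of the inner product makes it real and
  nonnegative, and the real Cauchy-Schwarz inequality applies.\<close>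

lemma cmod_cinner_le: "cmod (cinner x (y::'a::complex_hilbert)) \<le> norm x * norm y"
proof -
  define z where "z = cinner x y"
  have "(cmod z)\<^sup>2 = Re (cinner (cnj z *\<^sub>C x) y)"
    by (simp add: cinner_scaleC_left z_def[symmetric] complex_norm_square[symmetric] mult.commute[of _ z])
  also have "\<dots> \<le> norm (cnj z *\<^sub>C x) * norm y"
    unfolding inner_eq_Re_cinner[symmetric] by (rule norm_cauchy_schwarz)
  finally have "cmod z * cmod z \<le> cmod z * (norm x * norm y)"
    by (simp add: norm_scaleC power2_eq_square mult.assoc)
  thus ?thesis unfolding z_def[symmetric]
    by (cases "z = 0") (auto simp: mult_le_cancel_left)
qed

lemma bounded_bilinear_scaleC: "bounded_bilinear (scaleC :: complex \<Rightarrow> 'a::complex_hilbert \<Rightarrow> 'a)"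
  by standard (auto simp: scaleC_add_left scaleC_add_right scaleR_eq_scaleC scaleC_scaleC norm_scaleC
      scaleR_conv_of_real mult.commute intro!: exI[of _ 1])

lemma bounded_bilinear_cinner: "bounded_bilinear (cinner :: 'a::complex_hilbert \<Rightarrow> 'a \<Rightarrow> complex)"
  by standard (auto simp: cinner_add_left cinner_add_right scaleR_eq_scaleC scaleC_scaleC cinner_scaleC_left
      cinner_scaleC_right scaleR_conv_of_real cmod_cinner_le intro!: exI[of _ 1])

lemmas bounded_linear_scaleC = bounded_bilinear.bounded_linear_right[OF bounded_bilinear_scaleC]
lemmas bounded_linear_cinner_left = bounded_bilinear.bounded_linear_left[OF bounded_bilinear_cinner]
lemmas tendsto_cinner = bounded_bilinear.tendsto[OF bounded_bilinear_cinner]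
lemmas tendsto_scaleC = bounded_bilinear.tendsto[OF bounded_bilinear_scaleC]
lemmas continuous_on_cinner = bounded_bilinear.continuous_on[OF bounded_bilinear_cinner]
lemmas continuous_on_scaleC = bounded_bilinear.continuous_on[OF bounded_bilinear_scaleC]

lemma cinner_sum_left: "cinner (\<Sum>i\<in>A. f i) (y::'a::complex_hilbert) = (\<Sum>i\<in>A. cinner (f i) y)"
  by (induction A rule: infinite_finite_induct) (auto simp: cinner_add_left)

section \<open>Closed complex subspaces, Riesz representation and orthogonal projections\<close>

lemma csubspaceD:
  assumes "csubspace S"
  shows "subspace S" "0 \<in> S" "x \<in> S \<Longrightarrow> y \<in> S \<Longrightarrow> x + y \<in> S" "x \<in> S \<Longrightarrow> y \<in> S \<Longrightarrow> x - y \<in> S"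
    "x \<in> S \<Longrightarrow> c *\<^sub>C x \<in> S" "x \<in> S \<Longrightarrow> - x \<in> S" "x \<in> S \<Longrightarrow> r *\<^sub>R x \<in> S"
  using assms by (auto simp: csubspace_def subspace_0 subspace_add subspace_diff subspace_neg subspace_mul)

lemma csubspaceI:
  assumes "0 \<in> S" "\<And>x y. x \<in> S \<Longrightarrow> y \<in> S \<Longrightarrow> x + y \<in> S" "\<And>c x. x \<in> S \<Longrightarrow> c *\<^sub>C x \<in> S"
  shows "csubspace S"
  using assms by (auto simp: csubspace_def subspace_def scaleR_eq_scaleC)

lemma csubspace_Int: "csubspace A \<Longrightarrow> csubspace B \<Longrightarrow> csubspace (A \<inter> B)"
  by (auto simp: csubspace_def subspace_inter)

text \<open>The representing vector is the minimiser of \<open>J x = |x|^2 - 2 \<psi> x\<close> on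
  \<open>K\<close>. Boundedness of \<psi> keeps \<open>J\<close> bounded below, the parallelogram
  law makes a minimising sequence Cauchy, and the vanishing first variation at the minimum is the
  claim.\<close>

lemma riesz_real:
  fixes K :: "'a::{real_inner,complete_space} set"
  assumes K: "closed K" "subspace K"
    and add: "\<And>x y. x \<in> K \<Longrightarrow> y \<in> K \<Longrightarrow> \<psi> (x + y) = \<psi> x + \<psi> y"
    and scale: "\<And>r x. x \<in> K \<Longrightarrow> \<psi> (r *\<^sub>R x) = r * \<psi> x"
    and bound: "\<And>x. x \<in> K \<Longrightarrow> \<bar>\<psi> x\<bar> \<le> C * norm x"
  obtains y where "y \<in> K" "\<And>x. x \<in> K \<Longrightarrow> inner y x = \<psi> x"
proof -
  define J where "J = (\<lambda>x. (norm x)\<^sup>2 - 2 * \<psi> x)"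
  note sub = subspace_0[OF K(2)] subspace_add[OF K(2)] subspace_mul[OF K(2)] subspace_diff[OF K(2)]
  have lower: "- C\<^sup>2 \<le> J x" if "x \<in> K" for x
  proof -
    have "0 \<le> (norm x - C)\<^sup>2" by simp
    with bound[OF that] show ?thesis by (simp add: J_def power2_diff abs_le_iff algebra_simps)
  qed
  define I where "I = (INF x\<in>K. J x)"
  have bdd: "bdd_below (J ` K)" using lower by (auto intro!: bdd_belowI)
  have I_le: "I \<le> J x" if "x \<in> K" for x unfolding I_def using bdd that by (rule cINF_lower)
  have "\<exists>x\<in>K. J x < I + 1 / Suc n" for n
  proof (rule ccontr)
    assume "\<not> ?thesis"
    hence "I + 1 / Suc n \<le> J x" if "x \<in> K" for x using that by (auto simp: not_less)
    hence "I + 1 / Suc n \<le> I" unfolding I_def using sub(1) by (intro cINF_greatest) auto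
    thus False by (simp add: field_simps)
  qed
  then obtain X where X: "\<And>n. X n \<in> K" "\<And>n. J (X n) < I + 1 / Suc n" by metis
  \<comment> \<open>The midpoint lies in \<open>K\<close>, so \<open>J\<close> is at least
    \<open>I\<close> there; together with the parallelogram law this bounds the distance of two
    near-minimisers by their excess over \<open>I\<close>.\<close>
  have par: "(norm (x - y))\<^sup>2 \<le> 2 * (J x - I) + 2 * (J y - I)" if "x \<in> K" "y \<in> K" for x y
  proof -
    have "I \<le> J ((1/2) *\<^sub>R (x + y))" using that sub by (intro I_le) auto
    also have "\<dots> = (norm (x + y))\<^sup>2 / 4 - \<psi> x - \<psi> y"
      using that sub by (simp add: J_def scale add power_mult_distrib power_divide add_divide_distrib)
    finally have 1: "I \<le> (norm (x + y))\<^sup>2 / 4 - \<psi> x - \<psi> y" .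
    have 2: "(norm (x + y))\<^sup>2 + (norm (x - y))\<^sup>2 = 2 * (norm x)\<^sup>2 + 2 * (norm y)\<^sup>2"
      by (simp add: power2_norm_eq_inner inner_add_left inner_add_right inner_diff_left inner_diff_right inner_commute)
    show ?thesis using 1 2 by (simp add: J_def)
  qed
  have "Cauchy X"
  proof (rule CauchyI)
    fix e :: real assume e: "e > 0"
    then obtain N where N: "4 / e\<^sup>2 < real N" using reals_Archimedean2 by blast
    have "norm (X m - X n) < e" if "m \<ge> N" "n \<ge> N" for m n
    proof -
      have le: "1 / real (Suc k) \<le> 1 / real (Suc N)" if "k \<ge> N" for k using that by (simp add: frac_le)
      have "(norm (X m - X n))\<^sup>2 < 4 / Suc N"
        using par[OF X(1) X(1), of m n] X(2)[of m] X(2)[of n] le[OF that(1)] le[OF that(2)] by simp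
      also have "\<dots> < e\<^sup>2" using N e by (simp add: field_simps) (smt (verit) zero_less_power)
      finally show ?thesis using e by (simp add: power_less_imp_less_base)
    qed
    thus "\<exists>M. \<forall>m\<ge>M. \<forall>n\<ge>M. norm (X m - X n) < e" by blast
  qed
  then obtain y where y: "X \<longlonglongrightarrow> y" by (auto simp: Cauchy_convergent_iff convergent_def)
  have yK: "y \<in> K" using K(1) X(1) y by (rule closed_sequentially)
  have "(\<lambda>n. \<psi> (X n)) \<longlonglongrightarrow> \<psi> y"
  proof (rule LIM_zero_cancel, rule Lim_null_comparison)
    have "\<psi> (X n) - \<psi> y = \<psi> (X n - y)" for n
      using add[OF sub(4)[OF X(1) yK] yK, of n] by simp
    thus "\<forall>\<^sub>F n in sequentially. norm (\<psi> (X n) - \<psi> y) \<le> C * norm (X n - y)"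
      using bound sub(4)[OF X(1) yK] by simp
    show "(\<lambda>n. C * norm (X n - y)) \<longlonglongrightarrow> 0"
      using tendsto_mult_right_zero[OF tendsto_norm_zero[OF LIM_zero[OF y]]] by simp
  qed
  hence "(\<lambda>n. J (X n)) \<longlonglongrightarrow> J y" unfolding J_def by (intro tendsto_intros y)
  moreover have "(\<lambda>n. I + 1 / real (Suc n)) \<longlonglongrightarrow> I + 0"
    by (intro tendsto_intros LIMSEQ_Suc[OF lim_1_over_n])
  ultimately have "J y \<le> I + 0" using X(2) by (intro LIMSEQ_le) (auto intro: less_imp_le)
  hence Jy: "J y \<le> J x" if "x \<in> K" for x using I_le[OF that] by simp
  have "inner y x = \<psi> x" if x: "x \<in> K" for x
  proof (cases "x = 0")
    case True
    thus ?thesis using scale[OF sub(1), of 0] by simp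
  next
    case False
    define d where "d = inner y x - \<psi> x"
    \<comment> \<open>The minimiser of the quadratic polynomial \<open>J (y + t x)\<close> in
      \<open>t\<close>: moving there would lower \<open>J\<close> by \<open>d^2 / |x|^2\<close>, so
      \<open>d\<close> must vanish.\<close>
    define t where "t = - d / (norm x)\<^sup>2"
    have n0: "(norm x)\<^sup>2 \<noteq> 0" using False by simp
    have "J y \<le> J (y + t *\<^sub>R x)" using x yK sub by (intro Jy) auto
    also have "J (y + t *\<^sub>R x) = J y + 2 * t * d + t\<^sup>2 * (norm x)\<^sup>2"
      using x yK sub unfolding J_def d_def power2_norm_eq_inner
      by (simp add: add scale inner_add_left inner_add_right inner_commute algebra_simps power2_eq_square)
    also have "\<dots> = J y - d\<^sup>2 / (norm x)\<^sup>2"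
      using n0 by (simp add: t_def power_divide power2_eq_square) 
    finally have "d\<^sup>2 / (norm x)\<^sup>2 \<le> 0" by simp
    hence "d = 0" using n0 by (simp add: divide_le_0_iff)
    thus ?thesis by (simp add: d_def)
  qed
  with yK that show thesis by blast
qed

text \<open>The real theorem is applied to the real part of \<phi>. Since \<phi> and the second
  argument of \<open>cinner\<close> are both conjugate linear, testing against
  \<open>\<i> *\<^sub>C x\<close> recovers the imaginary part.\<close>

lemma riesz:
  fixes K :: "'a::complex_hilbert set"
  assumes K: "closed K" "csubspace K"
    and add: "\<And>x y. x \<in> K \<Longrightarrow> y \<in> K \<Longrightarrow> \<phi> (x + y) = \<phi> x + \<phi> y"
    and scale: "\<And>c x. x \<in> K \<Longrightarrow> \<phi> (c *\<^sub>C x) = cnj c * \<phi> x"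
    and bound: "\<And>x. x \<in> K \<Longrightarrow> cmod (\<phi> x) \<le> C * norm x"
  obtains y where "y \<in> K" "\<And>x. x \<in> K \<Longrightarrow> cinner y x = \<phi> x"
proof -
  obtain y where y: "y \<in> K" "\<And>x. x \<in> K \<Longrightarrow> inner y x = Re (\<phi> x)"
  proof (rule riesz_real[OF K(1) csubspaceD(1)[OF K(2)], of "\<lambda>x. Re (\<phi> x)" C])
    show "\<bar>Re (\<phi> x)\<bar> \<le> C * norm x" if "x \<in> K" for x
      using bound[OF that] abs_Re_le_cmod[of "\<phi> x"] by linarith
  qed (auto simp: add scale scaleR_eq_scaleC)
  have "cinner y x = \<phi> x" if x: "x \<in> K" for x
  proof (rule complex_eqI)
    show "Re (cinner y x) = Re (\<phi> x)" using y(2)[OF x] by (simp add: inner_eq_Re_cinner)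
    show "Im (cinner y x) = Im (\<phi> x)" using y(2)[OF csubspaceD(5)[OF K(2) x]] x by (simp add: Im_cinner scale)
  qed
  with y(1) that show thesis by blast
qed

text \<open>Riesz representation of \<open>cinner x\<close> restricted to \<open>K\<close>. The
  projection is defined on the whole type, so that an operator known only on \<open>K\<close>
  becomes a total bounded operator after composition with it.\<close>

lemma orthogonal_projection:
  fixes K :: "'a::complex_hilbert set"
  assumes K: "closed K" "csubspace K"
  obtains p where "bounded_linear p" "\<And>c x. p (c *\<^sub>C x) = c *\<^sub>C p x" "\<And>x. p x \<in> K"
    "\<And>x. x \<in> K \<Longrightarrow> p x = x" "\<And>x k. k \<in> K \<Longrightarrow> cinner (p x) k = cinner x k"
proof -
  note sub = csubspaceD[OF K(2)]
  have "\<exists>y\<in>K. \<forall>k\<in>K. cinner y k = cinner x k" for x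
    by (rule riesz[OF K, of "cinner x" "norm x"])
      (auto simp: cinner_add_right cinner_scaleC_right cmod_cinner_le)
  then obtain p where p: "\<And>x. p x \<in> K" "\<And>x k. k \<in> K \<Longrightarrow> cinner (p x) k = cinner x k" by metis
  have uniq: "y = p x" if "y \<in> K" "\<And>k. k \<in> K \<Longrightarrow> cinner y k = cinner x k" for x y
  proof -
    have "cinner (y - p x) (y - p x) = 0"
      using that(2)[OF sub(4)[OF that(1) p(1)], of x] p(2)[OF sub(4)[OF that(1) p(1)], of x x]
      by (simp add: cinner_diff_left)
    thus ?thesis by (simp add: cinner_self)
  qed
  have add: "p (x + y) = p x + p y" for x y
    by (rule uniq[symmetric]) (auto simp: p sub cinner_add_left)
  have scale: "p (c *\<^sub>C x) = c *\<^sub>C p x" for c x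
    by (rule uniq[symmetric]) (auto simp: p sub cinner_scaleC_left)
  have "norm (p x) \<le> norm x" for x
  proof -
    have "(norm (p x))\<^sup>2 = cmod (cinner (p x) (p x))" by (simp add: cinner_self norm_power)
    also have "\<dots> = cmod (cinner x (p x))" by (simp add: p)
    also have "\<dots> \<le> norm x * norm (p x)" by (rule cmod_cinner_le)
    finally show ?thesis by (cases "norm (p x) = 0") (auto simp: power2_eq_square)
  qed
  hence "bounded_linear p"
    by (intro bounded_linear_intro[of _ 1]) (auto simp: add scale scaleR_eq_scaleC)
  moreover have "p x = x" if "x \<in> K" for x using uniq[OF that, of x] by simp
  ultimately show thesis using that scale p by blast
qed

text \<open>By orthogonality the projection onto each summand kills the other one, so the sum is the
  fixed point set of the continuous map \<open>p + q\<close>.\<close>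

lemma orthogonal_sum_closed:
  fixes A B :: "'a::complex_hilbert set"
  assumes A: "closed A" "csubspace A" and B: "closed B" "csubspace B"
    and orth: "\<And>x y. x \<in> A \<Longrightarrow> y \<in> B \<Longrightarrow> cinner x y = 0"
  shows "closed {x + y |x y. x \<in> A \<and> y \<in> B}"
proof -
  obtain p where p: "bounded_linear p" "\<And>x. p x \<in> A"
    "\<And>x. x \<in> A \<Longrightarrow> p x = x" "\<And>x k. k \<in> A \<Longrightarrow> cinner (p x) k = cinner x k"
    using orthogonal_projection[OF A] by metis
  obtain q where q: "bounded_linear q" "\<And>x. q x \<in> B"
    "\<And>x. x \<in> B \<Longrightarrow> q x = x" "\<And>x k. k \<in> B \<Longrightarrow> cinner (q x) k = cinner x k"
    using orthogonal_projection[OF B] by metis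
  have py: "p y = 0" if "y \<in> B" for y
  proof -
    have "cinner (p y) (p y) = cnj (cinner (p y) y)" using p(2,4) by (metis cinner_commute)
    thus ?thesis using orth[OF p(2) that] by (simp add: cinner_self)
  qed
  have qx: "q x = 0" if "x \<in> A" for x
  proof -
    have "cinner (q x) (q x) = cinner x (q x)" using q(2,4) by blast
    thus ?thesis using orth[OF that q(2)] by (simp add: cinner_self)
  qed
  have "{x + y |x y. x \<in> A \<and> y \<in> B} = {z. p z + q z = z}"
  proof (intro set_eqI iffI)
    fix z assume "z \<in> {x + y |x y. x \<in> A \<and> y \<in> B}"
    then obtain x y where "z = x + y" "x \<in> A" "y \<in> B" by blast
    thus "z \<in> {z. p z + q z = z}"
      using py qx p(3) q(3) linear_add[OF bounded_linear.linear[OF p(1)]]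
        linear_add[OF bounded_linear.linear[OF q(1)]] by simp
  next
    fix z assume "z \<in> {z. p z + q z = z}"
    thus "z \<in> {x + y |x y. x \<in> A \<and> y \<in> B}" using p(2) q(2) by (intro CollectI exI[of _ "p z"] exI[of _ "q z"]) simp
  qed
  moreover have "closed {z. p z + q z = z}"
    using p(1) q(1) by (intro closed_Collect_eq continuous_intros linear_continuous_on) auto
  ultimately show ?thesis by simp
qed

lemma csubspace_sum: 
  fixes A B :: "'a::complex_hilbert set"
  assumes A: "csubspace A" and B: "csubspace B"
  shows "csubspace {x + y |x y. x \<in> A \<and> y \<in> B}"
proof (rule csubspaceI)
  show "0 \<in> {x + y |x y. x \<in> A \<and> y \<in> B}" using csubspaceD(2)[OF A] csubspaceD(2)[OF B] by force
next
  fix x y assume "x \<in> {x + y |x y. x \<in> A \<and> y \<in> B}" "y \<in> {x + y |x y. x \<in> A \<and> y \<in> B}"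
  then obtain a b a' b' where "x = a + b" "y = a' + b'" "a \<in> A" "a' \<in> A" "b \<in> B" "b' \<in> B" by blast
  hence "x + y = (a + a') + (b + b')" "a + a' \<in> A" "b + b' \<in> B"
    using csubspaceD(3)[OF A] csubspaceD(3)[OF B] by auto
  thus "x + y \<in> {x + y |x y. x \<in> A \<and> y \<in> B}" by blast
next
  fix c x assume "x \<in> {x + y |x y. x \<in> A \<and> y \<in> B}"
  then obtain a b where "x = a + b" "a \<in> A" "b \<in> B" by blast
  hence "c *\<^sub>C x = c *\<^sub>C a + c *\<^sub>C b" "c *\<^sub>C a \<in> A" "c *\<^sub>C b \<in> B"
    using csubspaceD(5)[OF A] csubspaceD(5)[OF B] by (auto simp: scaleC_add_right)
  thus "c *\<^sub>C x \<in> {x + y |x y. x \<in> A \<and> y \<in> B}" by blast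
qed

section \<open>Closed complex spans and isometries determined by Gram matrices\<close>

definition cspan :: "'a::complex_hilbert set \<Rightarrow> 'a set"
  where "cspan B = span {c *\<^sub>C b |c b. b \<in> B}"

definition ccspan :: "'a::complex_hilbert set \<Rightarrow> 'a set"
  where "ccspan B = closure (cspan B)"

lemma cspan_base: "b \<in> B \<Longrightarrow> b \<in> cspan B"
  unfolding cspan_def by (rule span_base) (metis (mono_tags, lifting) mem_Collect_eq scaleC_one)

lemma cspan_induct [consumes 1, case_names zero add]:
  assumes "x \<in> cspan B" "P 0" "\<And>c b y. b \<in> B \<Longrightarrow> y \<in> cspan B \<Longrightarrow> P y \<Longrightarrow> P (c *\<^sub>C b + y)"
  shows "P x"
proof -
  have "x \<in> cspan B \<and> P x"
    using assms(1)[unfolded cspan_def]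
  proof (induction rule: span_induct_alt)
    case base
    thus ?case using assms(2) by (simp add: cspan_def span_zero)
  next
    case (step r x y)
    then obtain c b where cb: "x = c *\<^sub>C b" "b \<in> B" by blast
    have "P ((complex_of_real r * c) *\<^sub>C b + y)" using step cb by (intro assms(3)) auto
    moreover have "(r *\<^sub>R x + y) \<in> cspan B"
      unfolding cspan_def
      by (rule span_add[OF span_scale[OF span_base[OF step(1)]]]) (use step in \<open>simp add: cspan_def\<close>)
    ultimately show ?case by (simp add: cb scaleR_eq_scaleC scaleC_scaleC)
  qed
  thus ?thesis ..
qed

lemma csubspace_cspan: "csubspace (cspan B)"
proof (rule csubspaceI)
  show "0 \<in> cspan B" by (simp add: cspan_def span_zero)
  show add: "x + y \<in> cspan B" if "x \<in> cspan B" "y \<in> cspan B" for x y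
    using that by (simp add: cspan_def span_add)
  show "c *\<^sub>C x \<in> cspan B" if "x \<in> cspan B" for c x
    using that
  proof (induction rule: cspan_induct)
    case zero
    thus ?case by (simp add: cspan_def span_zero)
  next
    case (add d b y)
    have "(c * d) *\<^sub>C b \<in> cspan B" unfolding cspan_def using add by (intro span_base) auto
    thus ?case using add by (simp add: scaleC_add_right scaleC_scaleC cspan_def span_add)
  qed
qed

lemma csubspace_closure:
  assumes "csubspace S" shows "csubspace (closure S)"
proof (rule csubspaceI)
  note S = csubspaceD[OF assms]
  show "0 \<in> closure S" using S(2) closure_subset by blast
  show "x + y \<in> closure S" if "x \<in> closure S" "y \<in> closure S" for x y
  proof -
    from that obtain f g where "\<And>n. f n \<in> S" "f \<longlonglongrightarrow> x" "\<And>n. g n \<in> S" "g \<longlonglongrightarrow> y"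
      unfolding closure_sequential by blast
    thus ?thesis unfolding closure_sequential
      by (intro exI[of _ "\<lambda>n. f n + g n"]) (auto intro: S tendsto_add)
  qed
  show "c *\<^sub>C x \<in> closure S" if "x \<in> closure S" for c x
  proof -
    from that obtain f where "\<And>n. f n \<in> S" "f \<longlonglongrightarrow> x"
      unfolding closure_sequential by blast
    thus ?thesis unfolding closure_sequential
      by (intro exI[of _ "\<lambda>n. c *\<^sub>C f n"]) (auto intro: S tendsto_scaleC)
  qed
qed

lemma csubspace_ccspan: "csubspace (ccspan B)"
  unfolding ccspan_def by (intro csubspace_closure csubspace_cspan)

lemma closed_ccspan: "closed (ccspan B)"
  by (simp add: ccspan_def)

lemma ccspan_base: "b \<in> B \<Longrightarrow> b \<in> ccspan B"
  unfolding ccspan_def using cspan_base closure_subset by blast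

lemma cspan_minimal: assumes "B \<subseteq> S" "csubspace S" shows "cspan B \<subseteq> S"
proof
  fix x assume "x \<in> cspan B"
  thus "x \<in> S" by (induction rule: cspan_induct) (use assms csubspaceD[OF assms(2)] in auto)
qed

lemma ccspan_minimal: "B \<subseteq> S \<Longrightarrow> csubspace S \<Longrightarrow> closed S \<Longrightarrow> ccspan B \<subseteq> S"
  unfolding ccspan_def by (intro closure_minimal cspan_minimal)

lemma ccspan_mono: "A \<subseteq> B \<Longrightarrow> ccspan A \<subseteq> ccspan B"
  by (intro ccspan_minimal csubspace_ccspan closed_ccspan) (auto intro: ccspan_base)

lemma cinner_eq_on_ccspan:
  assumes "\<And>b. b \<in> B \<Longrightarrow> cinner b x = cinner b y" "z \<in> ccspan B"
  shows "cinner z x = cinner z (y::'a::complex_hilbert)"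
proof -
  have "ccspan B \<subseteq> {z. cinner z x = cinner z y}"
  proof (rule ccspan_minimal)
    show "closed {z. cinner z x = cinner z y}"
      by (intro closed_Collect_eq linear_continuous_on bounded_linear_cinner_left)
    show "csubspace {z. cinner z x = cinner z y}"
      by (rule csubspaceI) (auto simp: cinner_add_left cinner_scaleC_left)
  qed (use assms in auto)
  thus ?thesis using assms(2) by blast
qed

lemma eq_if_cinner_eq_on_total:
  assumes "\<And>b. b \<in> B \<Longrightarrow> cinner b x = cinner b y" "x \<in> ccspan B" "y \<in> ccspan B"
  shows "x = (y::'a::complex_hilbert)"
proof -
  have "cinner (x - y) x = cinner (x - y) y"
    by (rule cinner_eq_on_ccspan[of B]) (use assms in \<open>auto intro: csubspaceD(4)[OF csubspace_ccspan]\<close>)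
  hence "cinner (x - y) (x - y) = 0" by (simp add: cinner_diff_right)
  thus ?thesis by (simp add: cinner_self)
qed

text \<open>The domain \<open>S\<close> may fail to be closed: the approximating combinations stay
  in \<open>S\<close>, and the bounds on \<open>S\<close> suffice to pass to the limit. This is the
  form needed for the odd operators, which act on smooth vectors only.\<close>

lemma eq_on_total:
  fixes F G :: "'a::complex_hilbert \<Rightarrow> 'b::complex_hilbert"
  assumes S: "csubspace S" "B \<subseteq> S"
    and F: "clinear_on S F" "\<And>x. x \<in> S \<Longrightarrow> norm (F x) \<le> C * norm x"
    and G: "clinear_on S G" "\<And>x. x \<in> S \<Longrightarrow> norm (G x) \<le> C' * norm x"
    and eq: "\<And>b. b \<in> B \<Longrightarrow> F b = G b" and x: "x \<in> S" "x \<in> ccspan B"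
  shows "F x = G x"
proof -
  note sub = csubspaceD[OF S(1)]
  have cs: "cspan B \<subseteq> S" by (intro cspan_minimal S)
  have "y \<in> S \<and> F y = G y" if "y \<in> cspan B" for y
    using that
  proof (induction rule: cspan_induct)
    case zero
    thus ?case using F(2)[OF sub(2)] G(2)[OF sub(2)] sub(2) by simp
  next
    case (add c b y)
    hence "b \<in> S" using S by blast
    thus ?case using F(1) G(1) add eq unfolding clinear_on_def by (simp add: sub)
  qed
  hence on: "F y = G y" if "y \<in> cspan B" for y using that by blast
  obtain f where f: "\<And>n. f n \<in> cspan B" "f \<longlonglongrightarrow> x" using x(2) unfolding ccspan_def closure_sequential by blast
  have lim: "(\<lambda>n. H (f n)) \<longlonglongrightarrow> H x"
    if H: "clinear_on S H" "\<And>x. x \<in> S \<Longrightarrow> norm (H x) \<le> D * norm x" for H :: "'a \<Rightarrow> 'b" and D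
  proof (rule LIM_zero_cancel, rule Lim_null_comparison)
    have "H (f n) = H (f n - x) + H x" for n
      using H(1) f(1)[of n] cs x(1) sub(4)[of "f n" x] unfolding clinear_on_def
      by (metis (no_types, lifting) diff_add_cancel subsetD)
    hence "H (f n) - H x = H (f n - x)" for n by simp
    thus "\<forall>\<^sub>F n in sequentially. norm (H (f n) - H x) \<le> D * norm (f n - x)"
      using H(2) f(1) cs x(1) sub(4) by (intro always_eventually) (metis subsetD)
    show "(\<lambda>n. D * norm (f n - x)) \<longlonglongrightarrow> 0"
      using tendsto_mult_right_zero[OF tendsto_norm_zero[OF LIM_zero[OF f(2)]]] by simp
  qed
  have "(\<lambda>n. F (f n)) = (\<lambda>n. G (f n))" using on f(1) by auto
  thus ?thesis using lim[OF F] lim[OF G] LIMSEQ_unique by metis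
qed

text \<open>The image of \<open>x\<close> under the isometry to come is produced by relations
  instead of a map on linear combinations, so that the question whether such a map is well defined
  does not arise.\<close>

lemma gram_partner:
  fixes f :: "'i \<Rightarrow> 'a::complex_hilbert" and g :: "'i \<Rightarrow> 'b::complex_hilbert"
  assumes gram: "\<And>i j. i \<in> I \<Longrightarrow> j \<in> I \<Longrightarrow> cinner (f i) (f j) = cinner (g i) (g j)"
    and x: "x \<in> ccspan (f ` I)"
  obtains y where "y \<in> ccspan (g ` I)" "\<And>i. i \<in> I \<Longrightarrow> cinner (f i) x = cinner (g i) y"
    "norm y = norm x"
proof -
  define P where "P = (\<lambda>x y. x \<in> ccspan (f ` I) \<and> y \<in> ccspan (g ` I) \<and>
    (\<forall>i\<in>I. cinner (f i) x = cinner (g i) y))"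
  \<comment> \<open>\<open>Q\<close> asks for equal inner products with all \<open>P\<close>-pairs,
    among them the pairs \<open>(f i, g i)\<close>. So \<open>Q\<close> implies \<open>P\<close>, is
    compatible with differences, and, tested against the pair itself, preserves the norm. Limits of
    \<open>Q\<close>-pairs then exist.\<close>
  define Q where "Q = (\<lambda>x y. x \<in> ccspan (f ` I) \<and> y \<in> ccspan (g ` I) \<and>
    (\<forall>x' y'. P x' y' \<longrightarrow> cinner x x' = cinner y y'))"
  have base: "P (f i) (g i)" if "i \<in> I" for i
    using that gram by (auto simp: P_def intro: ccspan_base)
  have QP: "P x y" if "Q x y" for x y
    unfolding P_def
  proof (intro conjI ballI)
    show "cinner (f i) x = cinner (g i) y" if "i \<in> I" for i
      using \<open>Q x y\<close> base[OF that] by (metis Q_def cinner_commute)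
  qed (use that in \<open>auto simp: Q_def\<close>)
  have Qdiff: "Q (x - x') (y - y')" if "Q x y" "Q x' y'" for x x' y y'
    using that by (auto simp: Q_def cinner_diff_left intro: csubspaceD(4)[OF csubspace_ccspan])
  have Qnorm: "norm y = norm x" if "Q x y" for x y
  proof -
    have "cinner x x = cinner y y" using that QP[OF that] unfolding Q_def by blast
    hence "(norm x)\<^sup>2 = (norm y)\<^sup>2" unfolding cinner_self of_real_eq_iff .
    thus ?thesis by (simp add: power2_eq_iff_nonneg)
  qed
  have span: "\<exists>y. Q x y" if "x \<in> cspan (f ` I)" for x
    using that
  proof (induction rule: cspan_induct)
    case zero
    have "Q 0 0" by (simp add: Q_def csubspaceD(2)[OF csubspace_ccspan])
    thus ?case ..
  next
    case (add c b y)
    then obtain i z where i: "b = f i" "i \<in> I" and z: "Q y z" by blast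
    have "Q (c *\<^sub>C f i + y) (c *\<^sub>C g i + z)"
      unfolding Q_def
    proof (intro conjI allI impI)
      show "c *\<^sub>C f i + y \<in> ccspan (f ` I)" "c *\<^sub>C g i + z \<in> ccspan (g ` I)"
        using z i by (auto simp: Q_def intro!: csubspaceD(3)[OF csubspace_ccspan]
            csubspaceD(5)[OF csubspace_ccspan] intro: ccspan_base)
      fix x' y' assume "P x' y'"
      thus "cinner (c *\<^sub>C f i + y) x' = cinner (c *\<^sub>C g i + z) y'"
        using z i by (simp add: Q_def P_def cinner_add_left cinner_scaleC_left)
    qed
    thus ?case using i by blast
  qed
  obtain X where X: "\<And>n. X n \<in> cspan (f ` I)" "X \<longlonglongrightarrow> x"
    using x unfolding ccspan_def closure_sequential by blast
  obtain Y where Y: "\<And>n. Q (X n) (Y n)" using span[OF X(1)] by metis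
  have "norm (Y m - Y n) = norm (X m - X n)" for m n using Qnorm[OF Qdiff[OF Y Y]] .
  hence "Cauchy Y" using LIMSEQ_imp_Cauchy[OF X(2)] by (simp add: Cauchy_def dist_norm)
  then obtain y where y: "Y \<longlonglongrightarrow> y" by (auto simp: Cauchy_convergent_iff convergent_def)
  have "y \<in> ccspan (g ` I)"
    using closed_ccspan _ y by (rule closed_sequentially) (use Y in \<open>simp add: Q_def\<close>)
  moreover have "cinner x x' = cinner y y'" if "P x' y'" for x' y'
  proof (rule LIMSEQ_unique)
    show "(\<lambda>n. cinner (X n) x') \<longlonglongrightarrow> cinner x x'" by (intro tendsto_cinner X tendsto_const)
    have "(\<lambda>n. cinner (Y n) y') \<longlonglongrightarrow> cinner y y'" by (intro tendsto_cinner y tendsto_const)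
    thus "(\<lambda>n. cinner (X n) x') \<longlonglongrightarrow> cinner y y'" using Y that by (simp add: Q_def)
  qed
  ultimately have "Q x y" using x by (simp add: Q_def)
  thus thesis using that[of y] QP Qnorm by (auto simp: P_def)
qed

text \<open>Partners are unique because the \<open>g i\<close> are total in their closed span;
  uniqueness gives linearity, and exchanging the two families gives surjectivity. Composition with
  the projection makes the map bounded and linear on the whole type, so that it can be applied to
  derivatives and limits without membership conditions.\<close>

lemma gram_isometry:
  fixes f :: "'i \<Rightarrow> 'a::complex_hilbert" and g :: "'i \<Rightarrow> 'b::complex_hilbert"
  assumes gram: "\<And>i j. i \<in> I \<Longrightarrow> j \<in> I \<Longrightarrow> cinner (f i) (f j) = cinner (g i) (g j)"
  obtains T where "bounded_linear T" "\<And>c x. T (c *\<^sub>C x) = c *\<^sub>C T x" "\<And>i. i \<in> I \<Longrightarrow> T (f i) = g i"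
    "\<And>x. x \<in> ccspan (f ` I) \<Longrightarrow> norm (T x) = norm x"
    "\<And>x y. x \<in> ccspan (f ` I) \<Longrightarrow> y \<in> ccspan (f ` I) \<Longrightarrow> cinner (T x) (T y) = cinner x y"
    "T ` ccspan (f ` I) = ccspan (g ` I)"
proof -
  let ?F = "ccspan (f ` I)" and ?G = "ccspan (g ` I)"
  note sF = csubspaceD[OF csubspace_ccspan[of "f ` I"]] and sG = csubspaceD[OF csubspace_ccspan[of "g ` I"]]
  have uniq: "y = y'" if "y \<in> ?G" "y' \<in> ?G" "\<And>i. i \<in> I \<Longrightarrow> cinner (g i) y = cinner (g i) y'" for y y'
    by (rule eq_if_cinner_eq_on_total[OF _ that(1,2)]) (use that(3) in auto)
  have "\<forall>x\<in>?F. \<exists>y. y \<in> ?G \<and> (\<forall>i\<in>I. cinner (f i) x = cinner (g i) y) \<and> norm y = norm x"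
  proof
    fix x assume "x \<in> ?F"
    with gram show "\<exists>y. y \<in> ?G \<and> (\<forall>i\<in>I. cinner (f i) x = cinner (g i) y) \<and> norm y = norm x"
      by (rule gram_partner) auto
  qed
  then obtain S where S: "\<And>x. x \<in> ?F \<Longrightarrow> S x \<in> ?G"
    "\<And>x i. x \<in> ?F \<Longrightarrow> i \<in> I \<Longrightarrow> cinner (f i) x = cinner (g i) (S x)"
    "\<And>x. x \<in> ?F \<Longrightarrow> norm (S x) = norm x" by metis
  have Sadd: "S (x + y) = S x + S y" if "x \<in> ?F" "y \<in> ?F" for x y
    by (rule uniq) (use that S sF(3) sG(3) in \<open>auto simp: cinner_add_right S(2)[symmetric]\<close>)
  have Sscale: "S (c *\<^sub>C x) = c *\<^sub>C S x" if "x \<in> ?F" for c x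
    by (rule uniq) (use that S sF(5) sG(5) in \<open>auto simp: cinner_scaleC_right S(2)[symmetric]\<close>)
  have Sf: "S (f i) = g i" if "i \<in> I" for i
  proof (rule uniq)
    have "f i \<in> ?F" using that by (intro ccspan_base imageI)
    thus "S (f i) \<in> ?G" by (rule S)
    show "cinner (g j) (S (f i)) = cinner (g j) (g i)" if "j \<in> I" for j
      using S(2)[OF \<open>f i \<in> ?F\<close> that] gram[OF that \<open>i \<in> I\<close>] by simp
    show "g i \<in> ?G" using that by (intro ccspan_base imageI)
  qed
  obtain p where p: "bounded_linear p" "\<And>c x. p (c *\<^sub>C x) = c *\<^sub>C p x" "\<And>x. p x \<in> ?F"
    "\<And>x. x \<in> ?F \<Longrightarrow> p x = x"
    using orthogonal_projection[OF closed_ccspan csubspace_ccspan] by metis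
  define T where "T = (\<lambda>x. S (p x))"
  have Tadd: "T (x + y) = T x + T y" for x y
    using p by (simp add: T_def linear_add[OF bounded_linear.linear[OF p(1)]] Sadd)
  have Tscale: "T (c *\<^sub>C x) = c *\<^sub>C T x" for c x
    using p by (simp add: T_def Sscale)
  have T: "T x = S x" if "x \<in> ?F" for x using that p by (simp add: T_def)
  obtain C where C: "\<And>x. norm (p x) \<le> norm x * C" using bounded_linear.bounded[OF p(1)] by blast
  have bl: "bounded_linear T"
    by (rule bounded_linear_intro[of _ C])
      (simp_all add: Tadd Tscale scaleR_eq_scaleC, simp add: T_def S(3) p(3) C)
  have Tf: "T (f i) = g i" if "i \<in> I" for i using that by (simp add: T ccspan_base Sf)
  have nT: "norm (T x) = norm x" if "x \<in> ?F" for x using that by (simp add: T S)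
  have inn: "cinner (T x) (T y) = cinner x y" if "x \<in> ?F" "y \<in> ?F" for x y
  proof -
    \<comment> \<open>Polarisation: the real inner product is determined by norms, and turning the
      second vector by \<open>\<i>\<close> then gives the imaginary part.\<close>
    have re: "inner (T x) (T y) = inner x y" if "x \<in> ?F" "y \<in> ?F" for x y
      using that nT[OF that(1)] nT[OF that(2)] nT[OF sF(3)[OF that]]
      by (simp add: dot_norm Tadd)
    show ?thesis
    proof (rule complex_eqI)
      show "Re (cinner (T x) (T y)) = Re (cinner x y)" using re[OF that] by (simp add: inner_eq_Re_cinner)
      show "Im (cinner (T x) (T y)) = Im (cinner x y)"
        using re[OF that(1) sF(5)[OF that(2)]] by (simp add: Im_cinner Tscale)
    qed
  qed
  have "T ` ?F = ?G"
  proof (intro equalityI subsetI)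
    fix y assume y: "y \<in> ?G"
    obtain x where x: "x \<in> ?F" "\<And>i. i \<in> I \<Longrightarrow> cinner (g i) y = cinner (f i) x"
      by (rule gram_partner[OF gram[symmetric] y]) auto
    have "y = T x" unfolding T[OF x(1)]
      by (rule uniq[OF y S(1)[OF x(1)]]) (use x S(2) in simp)
    thus "y \<in> T ` ?F" using x by blast
  qed (auto simp: T S)
  with bl Tscale Tf nT inn that show thesis by blast
qed

lemma Ck_on_SucE:
  assumes "Ck_on (Suc k) S f"
  obtains f' where "\<And>x. x \<in> S \<Longrightarrow> (f has_derivative f' x) (at x within S)"
    "\<And>v. v \<in> S \<Longrightarrow> Ck_on k S (\<lambda>x. f' x v)"
  using assms by auto

lemma Ck_on_continuous: "Ck_on k S f \<Longrightarrow> continuous_on S f"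
  by (cases k) (auto elim!: Ck_on_SucE intro: has_derivative_continuous_on simp del: Ck_on.simps(2))

section \<open>Smooth functions on a subspace\<close>

lemma Ck_on_SucI:
  assumes "\<And>x. x \<in> S \<Longrightarrow> (f has_derivative f' x) (at x within S)"
    and "\<And>v. v \<in> S \<Longrightarrow> Ck_on k S (\<lambda>x. f' x v)"
  shows "Ck_on (Suc k) S f"
  using assms by auto

lemma Ck_on_Suc_imp: "Ck_on (Suc k) S f \<Longrightarrow> Ck_on k S f"
proof (induction k arbitrary: f)
  case 0
  thus ?case using Ck_on_continuous[of "Suc 0" S f] by simp
next
  case (Suc k)
  obtain f' where f': "\<And>x. x \<in> S \<Longrightarrow> (f has_derivative f' x) (at x within S)"
    "\<And>v. v \<in> S \<Longrightarrow> Ck_on (Suc k) S (\<lambda>x. f' x v)" using Suc.prems by (rule Ck_on_SucE) blast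
  thus ?case using Suc.IH by (intro Ck_on_SucI[of S f f']) blast+
qed

lemma Ck_on_cong:
  assumes "\<And>x. x \<in> S \<Longrightarrow> f x = g x" "Ck_on k S f"
  shows "Ck_on k S g"
proof (cases k)
  case 0
  thus ?thesis using assms continuous_on_cong[of S S f g] by simp
next
  case (Suc l)
  then obtain f' where f': "\<And>x. x \<in> S \<Longrightarrow> (f has_derivative f' x) (at x within S)"
    "\<And>v. v \<in> S \<Longrightarrow> Ck_on l S (\<lambda>x. f' x v)" using assms(2) by auto
  show ?thesis unfolding Suc
  proof (rule Ck_on_SucI)
    show "(g has_derivative f' x) (at x within S)" if "x \<in> S" for x
      by (rule has_derivative_transform[OF that _ f'(1)[OF that]]) (simp add: assms(1))
  qed (rule f'(2))
qed

lemma Ck_on_const: "Ck_on k S (\<lambda>x. c)"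
  by (induction k arbitrary: c) (auto intro!: exI[of _ "\<lambda>_ _. 0"])

lemma Ck_on_bounded_linear: "bounded_linear L \<Longrightarrow> Ck_on k S L"
  by (cases k) (auto intro!: exI[of _ "\<lambda>_. L"] bounded_linear_imp_has_derivative Ck_on_const linear_continuous_on)

lemma Ck_on_bounded_linear_comp:
  assumes "bounded_linear T" shows "Ck_on k S f \<Longrightarrow> Ck_on k S (\<lambda>x. T (f x))"
proof (induction k arbitrary: f)
  case 0
  thus ?case using bounded_linear.continuous_on[OF assms] by simp
next
  case (Suc k)
  then obtain f' where "\<And>x. x \<in> S \<Longrightarrow> (f has_derivative f' x) (at x within S)"
    "\<And>v. v \<in> S \<Longrightarrow> Ck_on k S (\<lambda>x. f' x v)" by auto
  thus ?case using Suc.IH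
    by (intro Ck_on_SucI[of S _ "\<lambda>x v. T (f' x v)"] bounded_linear.has_derivative[OF assms]) auto
qed

lemma Ck_on_add: "Ck_on k S f \<Longrightarrow> Ck_on k S g \<Longrightarrow> Ck_on k S (\<lambda>x. f x + g x)"
proof (induction k arbitrary: f g)
  case 0
  thus ?case by (simp add: continuous_on_add)
next
  case (Suc k)
  obtain f' where f': "\<And>x. x \<in> S \<Longrightarrow> (f has_derivative f' x) (at x within S)"
    "\<And>v. v \<in> S \<Longrightarrow> Ck_on k S (\<lambda>x. f' x v)" using Suc.prems(1) by (rule Ck_on_SucE) blast
  obtain g' where g': "\<And>x. x \<in> S \<Longrightarrow> (g has_derivative g' x) (at x within S)"
    "\<And>v. v \<in> S \<Longrightarrow> Ck_on k S (\<lambda>x. g' x v)" using Suc.prems(2) by (rule Ck_on_SucE) blast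
  show ?case using f' g' Suc.IH
    by (intro Ck_on_SucI[of S _ "\<lambda>x v. f' x v + g' x v"] has_derivative_add) auto
qed

lemma Ck_on_bilinear:
  assumes "bounded_bilinear op"
  shows "Ck_on k S f \<Longrightarrow> Ck_on k S g \<Longrightarrow> Ck_on k S (\<lambda>x. op (f x) (g x))"
proof (induction k arbitrary: f g)
  case 0
  thus ?case using bounded_bilinear.continuous_on[OF assms] by simp
next
  case (Suc k)
  obtain f' where f': "\<And>x. x \<in> S \<Longrightarrow> (f has_derivative f' x) (at x within S)"
    "\<And>v. v \<in> S \<Longrightarrow> Ck_on k S (\<lambda>x. f' x v)" using Suc.prems(1) by (rule Ck_on_SucE) blast
  obtain g' where g': "\<And>x. x \<in> S \<Longrightarrow> (g has_derivative g' x) (at x within S)"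
    "\<And>v. v \<in> S \<Longrightarrow> Ck_on k S (\<lambda>x. g' x v)" using Suc.prems(2) by (rule Ck_on_SucE) blast
  show ?case using f' g' Suc.IH Suc.prems[THEN Ck_on_Suc_imp]
    by (intro Ck_on_SucI[of S _ "\<lambda>x v. op (f x) (g' x v) + op (f' x v) (g x)"]
          bounded_bilinear.FDERIV[OF assms] Ck_on_add) auto
qed

text \<open>The condition on \<open>L x\<close> without the translation concerns directions: the
  derivative of \<open>f\<close> is differentiated again only along directions in \<open>S'\<close>,
  and the chain rule supplies the direction \<open>L v\<close>.\<close>

lemma Ck_on_affine:
  fixes L :: "'a::euclidean_space \<Rightarrow> 'b::euclidean_space"
  assumes L: "bounded_linear L" "\<And>x. x \<in> S \<Longrightarrow> L x \<in> S'" "\<And>x. x \<in> S \<Longrightarrow> L x + a \<in> S'"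
  shows "Ck_on k S' f \<Longrightarrow> Ck_on k S (\<lambda>x. f (L x + a))"
proof (induction k arbitrary: f)
  case 0
  show ?case unfolding Ck_on.simps
    by (rule continuous_on_compose2[of S' f])
      (use 0 L(3) continuous_on_add[OF linear_continuous_on[OF L(1)] continuous_on_const] in auto)
next
  case (Suc k)
  then obtain f' where f': "\<And>x. x \<in> S' \<Longrightarrow> (f has_derivative f' x) (at x within S')"
    "\<And>v. v \<in> S' \<Longrightarrow> Ck_on k S' (\<lambda>x. f' x v)" by auto
  show ?case
  proof (rule Ck_on_SucI[of S _ "\<lambda>x v. f' (L x + a) (L v)"])
    fix x assume x: "x \<in> S"
    have 1: "((\<lambda>x. L x + a) has_derivative L) (at x within S)"
      using has_derivative_add[OF bounded_linear_imp_has_derivative[OF L(1)] has_derivative_const] by simp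
    show "((\<lambda>x. f (L x + a)) has_derivative (\<lambda>v. f' (L x + a) (L v))) (at x within S)"
      by (rule has_derivative_in_compose2[of S' f f', OF f'(1) _ x 1]) (use L in auto)
    show "Ck_on k S (\<lambda>x. f' (L x + a) (L v))" if "v \<in> S" for v
      by (rule Suc.IH[OF f'(2)[OF L(2)[OF that]]])
  qed
qed

lemma Ck_on_exp:
  fixes f :: "'a::euclidean_space \<Rightarrow> complex"
  shows "Ck_on k S f \<Longrightarrow> Ck_on k S (\<lambda>x. exp (f x))"
proof (induction k)
  case 0
  thus ?case by (simp add: continuous_on_exp)
next
  case (Suc k)
  then obtain f' where f': "\<And>x. x \<in> S \<Longrightarrow> (f has_derivative f' x) (at x within S)"
    "\<And>v. v \<in> S \<Longrightarrow> Ck_on k S (\<lambda>x. f' x v)" by auto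
  show ?case
  proof (rule Ck_on_SucI[of S _ "\<lambda>x v. exp (f x) * f' x v"])
    show "((\<lambda>x. exp (f x)) has_derivative (\<lambda>v. exp (f x) * f' x v)) (at x within S)" if "x \<in> S" for x
      using has_derivative_compose[OF f'(1)[OF that], of exp "\<lambda>h. exp (f x) * h"] DERIV_exp[of "f x"]
      by (simp add: has_field_derivative_def)
    show "Ck_on k S (\<lambda>x. exp (f x) * f' x v)" if "v \<in> S" for v
      using Suc.IH[OF Ck_on_Suc_imp[OF Suc.prems]] f'(2)[OF that] by (rule Ck_on_bilinear[OF bounded_bilinear_mult])
  qed
qed

section \<open>Everywhere convergent power series with vector coefficients\<close>

definition entire_coeffs :: "(nat \<Rightarrow> 'a::complex_hilbert) \<Rightarrow> bool"
  where "entire_coeffs a \<longleftrightarrow> (\<forall>r>0. summable (\<lambda>k. norm (a k) * r ^ k))"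

definition vec_series :: "(nat \<Rightarrow> 'a::complex_hilbert) \<Rightarrow> complex \<Rightarrow> 'a"
  where "vec_series a c = (\<Sum>k. c ^ k *\<^sub>C a k)"

lemma entire_coeffs_summable:
  assumes "entire_coeffs a" shows "summable (\<lambda>k. norm (c ^ k *\<^sub>C a k))"
proof (rule summable_comparison_test')
  show "summable (\<lambda>k. norm (a k) * (cmod c + 1) ^ k)" using assms by (simp add: entire_coeffs_def add_nonneg_pos)
  show "norm (norm (c ^ k *\<^sub>C a k)) \<le> norm (a k) * (cmod c + 1) ^ k" for k
    by (simp add: norm_scaleC norm_power mult.commute mult_left_mono power_mono)
qed

lemma vec_series_sums: "entire_coeffs a \<Longrightarrow> (\<lambda>k. c ^ k *\<^sub>C a k) sums vec_series a c"
  unfolding vec_series_def by (rule summable_sums[OF summable_norm_cancel[OF entire_coeffs_summable]])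

text \<open>The factor \<open>Suc k\<close> is at most \<open>2 ^ Suc k\<close>, which is paid for
  by doubling the radius.\<close>

lemma entire_coeffs_deriv:
  assumes "entire_coeffs a" shows "entire_coeffs (\<lambda>k. of_nat (Suc k) *\<^sub>C a (Suc k))"
  unfolding entire_coeffs_def
proof (intro allI impI, rule summable_comparison_test')
  fix r :: real assume r: "r > 0"
  have "summable (\<lambda>k. norm (a (Suc k)) * (2 * r) ^ (Suc k))"
    using assms r by (subst summable_Suc_iff) (simp only: entire_coeffs_def mult_pos_pos zero_less_numeral)
  thus "summable (\<lambda>k. (1 / r) * (norm (a (Suc k)) * (2 * r) ^ (Suc k)))" by (rule summable_mult)
  fix k
  have "real (Suc k) \<le> 2 ^ Suc k" using of_nat_less_two_power[of "Suc k", where 'a = real] by (simp only: less_imp_le)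
  hence "norm (a (Suc k)) * (real (Suc k) * r ^ k) \<le> norm (a (Suc k)) * (2 ^ Suc k * r ^ k)"
    using r by (intro mult_left_mono mult_right_mono) auto
  thus "norm (norm (of_nat (Suc k) *\<^sub>C a (Suc k)) * r ^ k) \<le> (1 / r) * (norm (a (Suc k)) * (2 * r) ^ (Suc k))"
    using r by (simp add: norm_scaleC power_mult_distrib abs_mult mult_ac del: of_nat_Suc)
qed

text \<open>Termwise differentiation on a ball around 0 containing \<open>c\<close>: the derived
  series is dominated there by the numbers \<open>b\<close>, its absolute values at the radius, so
  it converges uniformly.\<close>

lemma vec_series_has_derivative:
  assumes a: "entire_coeffs a"
  shows "(vec_series a has_derivative (\<lambda>v. v *\<^sub>C vec_series (\<lambda>k. of_nat (Suc k) *\<^sub>C a (Suc k)) c)) (at c)"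
proof -
  let ?a' = "\<lambda>k. of_nat (Suc k) *\<^sub>C a (Suc k)"
  define R where "R = cmod c + 1"
  have R: "R > 0" by (simp add: R_def add_nonneg_pos)
  define f' where "f' = (\<lambda>n x v. v *\<^sub>C ((of_nat n * x ^ (n - 1)) *\<^sub>C a n))"
  have a': "entire_coeffs ?a'" by (rule entire_coeffs_deriv[OF a])
  define b where "b = (\<lambda>k. norm (?a' k) * R ^ k)"
  have b: "summable b" using a' R by (simp add: entire_coeffs_def b_def)
  have "\<exists>g. \<forall>x\<in>ball 0 R. (\<lambda>n. x ^ n *\<^sub>C a n) sums (g x) \<and>
      (g has_derivative (\<lambda>v. v *\<^sub>C vec_series ?a' x)) (at x within ball 0 R)"
  proof (rule has_derivative_series[where f' = f'])
    show "convex (ball 0 R :: complex set)" by simp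
    show "((\<lambda>x. x ^ n *\<^sub>C a n) has_derivative f' n x) (at x within ball 0 R)" for n x
    proof -
      have "((\<lambda>x. x ^ n) has_derivative (\<lambda>v. of_nat n * x ^ (n - 1) * v)) (at x within ball 0 R)"
        by (auto intro!: derivative_eq_intros simp: mult_ac)
      from bounded_bilinear.FDERIV[OF bounded_bilinear_scaleC this has_derivative_const, of "a n"]
      show ?thesis by (simp add: f'_def scaleC_scaleC mult_ac)
    qed
    show "\<forall>\<^sub>F n in sequentially. \<forall>x\<in>ball 0 R. \<forall>v. norm ((\<Sum>i<n. f' i x v) - v *\<^sub>C vec_series ?a' x) \<le> e * norm v"
      if e: "e > 0" for e
    proof -
      obtain N where N: "\<And>n. n \<ge> N \<Longrightarrow> norm (\<Sum>i. b (i + n)) < e" using suminf_exist_split[OF e b] by blast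
      show ?thesis unfolding eventually_sequentially
      \<comment> \<open>The constant term has derivative zero, so \<open>n\<close> terms of the
        series give \<open>n - 1\<close> terms of the derived series; hence the extra one.\<close>
      proof (intro exI[of _ "Suc N"] allI impI ballI)
        fix n x v assume n: "n \<ge> Suc N" and x: "x \<in> ball (0::complex) R"
        obtain m where m: "n = Suc m" "m \<ge> N" using n by (cases n) auto
        have "(\<Sum>i<n. f' i x v) = v *\<^sub>C (\<Sum>i<m. x ^ i *\<^sub>C ?a' i)"
          unfolding m sum.lessThan_Suc_shift
          by (simp add: f'_def linear_sum[OF bounded_linear.linear[OF bounded_linear_scaleC]] scaleC_scaleC mult_ac)
        hence n_eq: "norm ((\<Sum>i<n. f' i x v) - v *\<^sub>C vec_series ?a' x) =
            norm v * norm (vec_series ?a' x - (\<Sum>i<m. x ^ i *\<^sub>C ?a' i))"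
          by (simp only: scaleC_diff_right[symmetric] norm_scaleC norm_minus_commute)
        have "vec_series ?a' x - (\<Sum>i<m. x ^ i *\<^sub>C ?a' i) = (\<Sum>i. x ^ (i + m) *\<^sub>C ?a' (i + m))"
          using suminf_split_initial_segment[OF sums_summable[OF vec_series_sums[OF a']], of x m]
          unfolding vec_series_def[of ?a' x] by simp
        also have "norm \<dots> \<le> (\<Sum>i. b (i + m))"
        proof (rule norm_suminf_le)
          show "norm (x ^ (i + m) *\<^sub>C ?a' (i + m)) \<le> b (i + m)" for i
            using x unfolding b_def norm_scaleC norm_power
            by (subst mult.commute) (intro mult_left_mono power_mono mult_nonneg_nonneg, auto)
          show "summable (\<lambda>i. b (i + m))" using b by (rule summable_ignore_initial_segment)
        qed
        also have "\<dots> \<le> e" using N[OF m(2)] by simp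
        finally show "norm ((\<Sum>i<n. f' i x v) - v *\<^sub>C vec_series ?a' x) \<le> e * norm v"
          unfolding n_eq by (subst mult.commute) (rule mult_right_mono, auto)
      qed
    qed
    show "(0::complex) \<in> ball 0 R" using R by simp
    show "(\<lambda>n. 0 ^ n *\<^sub>C a n) sums vec_series a 0" by (rule vec_series_sums[OF a])
  qed
  then obtain g where g: "\<And>x. x \<in> ball 0 R \<Longrightarrow> (\<lambda>n. x ^ n *\<^sub>C a n) sums (g x)"
    "\<And>x. x \<in> ball 0 R \<Longrightarrow> (g has_derivative (\<lambda>v. v *\<^sub>C vec_series ?a' x)) (at x within ball 0 R)" by blast
  have eq: "g x = vec_series a x" if "x \<in> ball 0 R" for x
    using sums_unique2[OF g(1)[OF that] vec_series_sums[OF a]] .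
  have c: "c \<in> ball 0 R" by (simp add: R_def)
  have "(vec_series a has_derivative (\<lambda>v. v *\<^sub>C vec_series ?a' c)) (at c within ball 0 R)"
    by (rule has_derivative_transform[OF c _ g(2)[OF c]]) (simp add: eq)
  thus ?thesis using c by (simp add: at_within_open[OF _ open_ball])
qed

lemma Ck_on_vec_series: "entire_coeffs a \<Longrightarrow> Ck_on k S (vec_series a)"
proof (induction k arbitrary: a)
  case 0
  show ?case unfolding Ck_on.simps
    by (rule has_derivative_continuous_on) (rule has_derivative_at_withinI[OF vec_series_has_derivative[OF 0]])
next
  case (Suc k)
  show ?case
  proof (rule Ck_on_SucI)
    show "(vec_series a has_derivative (\<lambda>v. v *\<^sub>C vec_series (\<lambda>k. of_nat (Suc k) *\<^sub>C a (Suc k)) x)) (at x within S)" for x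
      by (rule has_derivative_at_withinI[OF vec_series_has_derivative[OF Suc.prems]])
    show "Ck_on k S (\<lambda>x. v *\<^sub>C vec_series (\<lambda>k. of_nat (Suc k) *\<^sub>C a (Suc k)) x)" for v
      by (rule Ck_on_bounded_linear_comp[OF bounded_linear_scaleC Suc.IH[OF entire_coeffs_deriv[OF Suc.prems]]])
  qed
qed

section \<open>Coherent states in the sequence space\<close>

lemma ell2_coord_scaleC [simp]: "ell2_coord (c *\<^sub>C x) n = c * ell2_coord x n"
  by transfer simp

definition ell2_basis :: "nat \<Rightarrow> ell2"
  where "ell2_basis k = Abs_ell2 (\<lambda>n. if n = k then 1 else 0)"

lemma ell2_coord_basis [simp]: "ell2_coord (ell2_basis k) n = (if n = k then 1 else 0)"
proof -
  have "summable (\<lambda>n. (cmod (if n = k then 1 else 0))\<^sup>2)"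
    by (rule summable_finite[of "{k}"]) auto
  thus ?thesis by (simp add: ell2_basis_def Abs_ell2_inverse)
qed

lemma cinner_basis_right [simp]: "cinner x (ell2_basis k) = ell2_coord x k"
proof -
  have "(\<lambda>n. ell2_coord x n * cnj (ell2_coord (ell2_basis k) n)) = (\<lambda>n. if n = k then ell2_coord x k else 0)"
    by auto
  moreover have "(\<Sum>n. if n = k then ell2_coord x k else 0) = ell2_coord x k"
    by (rule sums_unique[OF sums_single, symmetric])
  ultimately show ?thesis unfolding cinner_ell2_def ell2_cinner_def by simp
qed

lemma norm_basis [simp]: "norm (ell2_basis k) = 1"
  by (simp add: norm_eq_sqrt_inner inner_eq_Re_cinner)

text \<open>The Hilbert space tensor product, brought back into the same type by a pairing of the
  natural numbers. All modes and the spinors of the model can thus be accommodated in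
  \<open>ell2\<close>.\<close>

definition ell2_tensor :: "ell2 \<Rightarrow> ell2 \<Rightarrow> ell2"
  where "ell2_tensor x y =
    Abs_ell2 (\<lambda>n. ell2_coord x (fst (prod_decode n)) * ell2_coord y (snd (prod_decode n)))"

lemma sums_prod_decode:
  fixes f g :: "nat \<Rightarrow> complex"
  assumes "summable (\<lambda>n. cmod (f n))" "summable (\<lambda>n. cmod (g n))"
  shows "summable (\<lambda>n. cmod (f (fst (prod_decode n)) * g (snd (prod_decode n))))"
    and "(\<lambda>n. f (fst (prod_decode n)) * g (snd (prod_decode n))) sums (suminf f * suminf g)"
proof -
  let ?h = "\<lambda>(i, j). f i * g j"
  have f: "(\<lambda>x. norm (f x)) summable_on UNIV" and g: "(\<lambda>x. norm (g x)) summable_on UNIV"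
    using assms by (simp_all add: summable_on_UNIV_nonneg_real_iff)
  have inner: "(\<lambda>y. norm (f x * g y)) summable_on UNIV" for x
    using summable_on_cmult_right[OF g, of "norm (f x)"] by (simp add: norm_mult)
  have "(\<Sum>\<^sub>\<infinity>y. norm (f x * g y)) = norm (f x) * (\<Sum>\<^sub>\<infinity>y. norm (g y))" for x
    unfolding norm_mult by (rule infsum_cmult_right) (use g in simp)
  hence "(\<lambda>x. norm (\<Sum>\<^sub>\<infinity>y. norm (f x * g y))) summable_on UNIV"
    using summable_on_cmult_left[OF f, of "norm (\<Sum>\<^sub>\<infinity>y. norm (g y))"] by (simp add: abs_mult)
  hence h: "(\<lambda>p. norm (?h p)) summable_on UNIV \<times> UNIV"
    using inner by (intro Infinite_Sum.abs_summable_on_Sigma_iff[where f = ?h, THEN iffD2]) simp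
  have bij: "bij_betw prod_decode UNIV (UNIV \<times> UNIV)" by (simp add: bij_prod_decode)
  have "(\<lambda>n. norm (?h (prod_decode n))) summable_on UNIV"
    using summable_on_reindex_bij_betw[OF bij, of "\<lambda>p. norm (?h p)"] h by simp
  thus 1: "summable (\<lambda>n. cmod (f (fst (prod_decode n)) * g (snd (prod_decode n))))"
    by (simp add: case_prod_unfold summable_on_UNIV_nonneg_real_iff)
  have hs: "?h summable_on UNIV \<times> UNIV" using h by (rule abs_summable_summable)
  have fs: "suminf f = infsum f UNIV" "suminf g = infsum g UNIV"
    using assms by (auto intro!: sums_unique[symmetric] has_sum_imp_sums has_sum_infsum norm_summable_imp_summable_on)
  have "infsum ?h (UNIV \<times> UNIV) = (\<Sum>\<^sub>\<infinity>x. \<Sum>\<^sub>\<infinity>y. f x * g y)"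
    using infsum_Sigma_banach[OF hs] by simp
  also have "\<dots> = infsum f UNIV * infsum g UNIV"
    using assms by (simp add: infsum_cmult_right' infsum_cmult_left')
  finally have "(?h has_sum (suminf f * suminf g)) (UNIV \<times> UNIV)"
    using has_sum_infsum[OF hs] fs by simp
  hence "((\<lambda>n. ?h (prod_decode n)) has_sum (suminf f * suminf g)) UNIV"
    using has_sum_reindex_bij_betw[OF bij, of ?h] by simp
  from has_sum_imp_sums[OF this]
  show "(\<lambda>n. f (fst (prod_decode n)) * g (snd (prod_decode n))) sums (suminf f * suminf g)"
    by (simp add: case_prod_unfold)
qed

lemma ell2_coord_tensor:
  "ell2_coord (ell2_tensor x y) n = ell2_coord x (fst (prod_decode n)) * ell2_coord y (snd (prod_decode n))"
proof -
  have "summable (\<lambda>n. cmod (complex_of_real ((cmod (ell2_coord x (fst (prod_decode n))))\<^sup>2) *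
      complex_of_real ((cmod (ell2_coord y (snd (prod_decode n))))\<^sup>2)))"
    by (rule sums_prod_decode(1)) (auto simp: norm_power ell2_summable_sq)
  hence "summable (\<lambda>n. (cmod (ell2_coord x (fst (prod_decode n)) * ell2_coord y (snd (prod_decode n))))\<^sup>2)"
    by (simp add: norm_mult norm_power power_mult_distrib)
  thus ?thesis unfolding ell2_tensor_def by (subst Abs_ell2_inverse) auto
qed

lemma ell2_summable_cinner_norm: "summable (\<lambda>n. cmod (ell2_coord x n * cnj (ell2_coord y n)))"
proof (rule summable_comparison_test')
  show "summable (\<lambda>n. (cmod (ell2_coord x n))\<^sup>2 + (cmod (ell2_coord y n))\<^sup>2)"
    by (intro summable_add ell2_summable_sq)
  fix n
  have "2 * cmod (ell2_coord x n) * cmod (ell2_coord y n) \<le> (cmod (ell2_coord x n))\<^sup>2 + (cmod (ell2_coord y n))\<^sup>2"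
    by (rule sum_squares_bound)
  hence "2 * (cmod (ell2_coord x n) * cmod (ell2_coord y n)) \<le> (cmod (ell2_coord x n))\<^sup>2 + (cmod (ell2_coord y n))\<^sup>2"
    by (simp only: mult.assoc)
  moreover have "0 \<le> cmod (ell2_coord x n) * cmod (ell2_coord y n)" by simp
  ultimately show "norm (cmod (ell2_coord x n * cnj (ell2_coord y n))) \<le> (cmod (ell2_coord x n))\<^sup>2 + (cmod (ell2_coord y n))\<^sup>2"
    unfolding real_norm_def norm_mult complex_mod_cnj by (subst abs_of_nonneg, simp, linarith)
qed

lemma cinner_tensor: "cinner (ell2_tensor x y) (ell2_tensor x' y') = cinner x x' * cinner y y'"
proof -
  have "(\<lambda>n. (ell2_coord x (fst (prod_decode n)) * cnj (ell2_coord x' (fst (prod_decode n)))) *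
     (ell2_coord y (snd (prod_decode n)) * cnj (ell2_coord y' (snd (prod_decode n))))) sums
     ((\<Sum>n. ell2_coord x n * cnj (ell2_coord x' n)) * (\<Sum>n. ell2_coord y n * cnj (ell2_coord y' n)))"
    by (rule sums_prod_decode(2)[OF ell2_summable_cinner_norm ell2_summable_cinner_norm])
  thus ?thesis unfolding cinner_ell2_def ell2_cinner_def ell2_coord_tensor
    by (intro sums_unique[symmetric]) (simp add: mult_ac)
qed

lemma norm_tensor: "norm (ell2_tensor x y) = norm x * norm y"
proof -
  have "complex_of_real ((norm (ell2_tensor x y))\<^sup>2) = complex_of_real ((norm x * norm y)\<^sup>2)"
    by (simp only: cinner_self[symmetric] cinner_tensor power_mult_distrib of_real_mult)
  thus ?thesis by (simp only: of_real_eq_iff) (simp add: power2_eq_iff_nonneg)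
qed

lemma bounded_bilinear_tensor: "bounded_bilinear ell2_tensor"
proof
  show "\<exists>K. \<forall>a b. norm (ell2_tensor a b) \<le> norm a * norm b * K"
    by (intro exI[of _ 1]) (simp add: norm_tensor)
qed (rule ell2_eqI, simp add: ell2_coord_tensor algebra_simps)+

text \<open>The coefficients are chosen so that the Gram function becomes the exponential series,
  that is, the reproducing kernel of Bargmann-Fock space. The vectors are left unnormalised because
  only then do they depend holomorphically on \<open>c\<close>.\<close>

definition coherent :: "complex \<Rightarrow> ell2"
  where "coherent = vec_series (\<lambda>k. (1 / sqrt (fact k)) *\<^sub>R ell2_basis k)"

lemma entire_coeffs_coherent: "entire_coeffs (\<lambda>k. (1 / sqrt (fact k)) *\<^sub>R ell2_basis k)"
  unfolding entire_coeffs_def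
proof (intro allI impI)
  fix r :: real assume r: "r > 0"
  show "summable (\<lambda>k. norm ((1 / sqrt (fact k)) *\<^sub>R ell2_basis k) * r ^ k)"
  proof (rule summable_comparison_test')
    show "summable (\<lambda>k. (1/2) ^ k + (1 / fact k) * (4 * r\<^sup>2) ^ k :: real)"
    proof (rule summable_add)
      show "summable (\<lambda>k. (1/2::real) ^ k)" by (rule summable_geometric) simp
      show "summable (\<lambda>k. (1 / fact k) * (4 * r\<^sup>2) ^ k :: real)"
        unfolding inverse_eq_divide[symmetric] by (rule summable_exp)
    qed
    fix k
    \<comment> \<open>AM-GM: the geometric factor makes the square root harmless\<close>
    have "2 * ((1/2) ^ k) * ((2 * r) ^ k / sqrt (fact k)) \<le> ((1/2) ^ k)\<^sup>2 + ((2 * r) ^ k / sqrt (fact k))\<^sup>2"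
      by (rule sum_squares_bound)
    moreover have "((1/2::real) ^ k)\<^sup>2 \<le> (1/2) ^ k"
      by (simp add: power2_eq_square mult_le_cancel_left1 power_le_one)
    moreover have "((2 * r) ^ k / sqrt (fact k))\<^sup>2 = (1 / fact k) * (4 * r\<^sup>2) ^ k"
      by (simp add: power_divide power_mult_distrib power_mult[symmetric] mult.commute[of k 2])
         (simp add: power_mult)
    moreover have "2 * ((1/2) ^ k) * ((2 * r) ^ k / sqrt (fact k)) = 2 * (r ^ k / sqrt (fact k))"
      by (simp add: power_mult_distrib power_divide)
    moreover have "0 \<le> r ^ k / sqrt (fact k)" using r by simp
    moreover have "norm (norm ((1 / sqrt (fact k)) *\<^sub>R ell2_basis k) * r ^ k) = r ^ k / sqrt (fact k)"
      using r by (simp add: abs_mult)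
    ultimately show "norm (norm ((1 / sqrt (fact k)) *\<^sub>R ell2_basis k) * r ^ k) \<le> (1/2) ^ k + (1 / fact k) * (4 * r\<^sup>2) ^ k"
      by linarith
  qed
qed

lemma ell2_coord_coherent: "ell2_coord (coherent c) n = c ^ n / sqrt (fact n)"
proof -
  have "(\<lambda>k. cinner (c ^ k *\<^sub>C ((1 / sqrt (fact k)) *\<^sub>R ell2_basis k)) (ell2_basis n)) sums cinner (coherent c) (ell2_basis n)"
    unfolding coherent_def
    by (rule bounded_linear.sums[OF bounded_linear_cinner_left vec_series_sums[OF entire_coeffs_coherent]])
  moreover have "(\<lambda>k. cinner (c ^ k *\<^sub>C ((1 / sqrt (fact k)) *\<^sub>R ell2_basis k)) (ell2_basis n)) =
      (\<lambda>k. if k = n then c ^ n / sqrt (fact n) else 0)"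
    by (auto simp: fun_eq_iff)
  ultimately have "(\<lambda>k. if k = n then c ^ n / sqrt (fact n) else 0) sums ell2_coord (coherent c) n" by simp
  moreover have "(\<lambda>k. if k = n then c ^ n / sqrt (fact n) else 0) sums (c ^ n / sqrt (fact n))"
    by (rule sums_If_finite_set'[of "\<lambda>_. 0" 0 "{n}", THEN sums_cong[THEN iffD1, rotated]]) auto
  ultimately show ?thesis by (rule sums_unique2)
qed

lemma cinner_coherent: "cinner (coherent c) (coherent d) = exp (c * cnj d)"
proof -
  have "ell2_coord (coherent c) n * cnj (ell2_coord (coherent d) n) = (c * cnj d) ^ n /\<^sub>R fact n" for n
    by (simp add: ell2_coord_coherent scaleR_conv_of_real power_mult_distrib field_simps flip: of_real_mult)
  thus ?thesis unfolding cinner_ell2_def ell2_cinner_def exp_def by simp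
qed

lemma Ck_on_coherent: "Ck_on k S coherent"
  unfolding coherent_def by (rule Ck_on_vec_series[OF entire_coeffs_coherent])

section \<open>Gaussian integrals over the plane\<close>

text \<open>Integrals run over pairs of reals, where integrability can be obtained from product
  functions through \<open>lborel_prod\<close>; the complex number only enters the
  integrand.\<close>

definition plane :: "real \<times> real \<Rightarrow> complex"
  where "plane p = Complex (fst p) (snd p)"

text \<open>The exponent matches the cocycle \<open>cis (Im (c * cnj d))\<close>: for this width a
  translated Gaussian and the cocycle combine to a holomorphic factor.\<close>

definition gauss :: "real \<times> real \<Rightarrow> real"
  where "gauss p = exp (- (norm p)\<^sup>2 / 2)"

lemma cmod_plane [simp]: "cmod (plane p) = norm p"
  by (simp add: plane_def norm_prod_def cmod_def)

lemma gauss_pos: "gauss p > 0"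
  by (simp add: gauss_def)

lemma continuous_on_plane [continuous_intros]:
  "continuous_on S f \<Longrightarrow> continuous_on S (\<lambda>x. plane (f x))"
  unfolding plane_def complex_eq by (intro continuous_intros)

lemma continuous_on_gauss [continuous_intros]:
  "continuous_on S f \<Longrightarrow> continuous_on S (\<lambda>x. gauss (f x))"
  unfolding gauss_def by (intro continuous_intros) auto

lemma integrable_exp_abs: "integrable lborel (\<lambda>x::real. exp (- \<bar>x\<bar>))"
proof -
  define g where "g = (\<lambda>x::real. indicator {0..} x *\<^sub>R exp (- x))"
  have g_meas: "g \<in> borel_measurable borel"
    unfolding g_def by (auto intro!: borel_measurable_continuous_on_indicator continuous_intros)
  have "integrable lebesgue g"
    unfolding g_def by (intro nonnegative_absolutely_integrable_1 [unfolded set_integrable_def])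
      (use integrable_on_exp_minus_to_infinity[of 1 0] in auto)
  hence g: "integrable lborel g" using integrable_completion[of g lborel] g_meas by simp
  from lborel_integrable_real_affine[OF g, of "-1" 0] have g': "integrable lborel (\<lambda>x. g (- x))" by simp
  show ?thesis
    by (rule Bochner_Integration.integrable_bound[OF Bochner_Integration.integrable_add[OF g g']])
      (auto simp: g_def indicator_def)
qed

lemma integrable_exp_abs_prod: "integrable lborel (\<lambda>p::real \<times> real. exp (- \<bar>fst p\<bar>) * exp (- \<bar>snd p\<bar>))"
  unfolding lborel_prod[symmetric]
proof (rule lborel_pair.Fubini_integrable)
  show "integrable lborel (\<lambda>x. LINT y|lborel. norm (exp (- \<bar>fst (x::real, y::real)\<bar>) * exp (- \<bar>snd (x, y)\<bar>)))"
    by (simp add: abs_mult integrable_exp_abs)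
  show "AE x in lborel. integrable lborel (\<lambda>y. exp (- \<bar>fst (x::real, y::real)\<bar>) * exp (- \<bar>snd (x, y)\<bar>))"
    by (simp add: integrable_exp_abs)
qed (measurable)

lemma continuous_borel_measurable_lborel [intro]:
  "continuous_on UNIV f \<Longrightarrow> f \<in> borel_measurable lborel"
  by (simp add: borel_measurable_continuous_onI)

lemma integrable_gauss_exp: "integrable lborel (\<lambda>p. exp (r * norm p) * gauss p)"
proof (rule Bochner_Integration.integrable_bound)
  show "integrable lborel (\<lambda>p::real \<times> real. exp ((r + 2)\<^sup>2 / 2) * (exp (- \<bar>fst p\<bar>) * exp (- \<bar>snd p\<bar>)))"
    by (intro integrable_mult_right integrable_exp_abs_prod)
  show "AE p in lborel. norm (exp (r * norm p) * gauss p)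
      \<le> norm (exp ((r + 2)\<^sup>2 / 2) * (exp (- \<bar>fst p\<bar>) * exp (- \<bar>snd p\<bar>)))"
  proof (rule AE_I2)
    fix p :: "real \<times> real"
    have "\<bar>fst p\<bar> \<le> norm p" "\<bar>snd p\<bar> \<le> norm p" using norm_fst_le[of "fst p" "snd p"] norm_snd_le[of "snd p" "fst p"] by auto
    \<comment> \<open>Completing the square at \<open>r + 2\<close> leaves
      \<open>- 2 * norm p\<close> to spare, one \<open>norm p\<close> for each coordinate.\<close>
    moreover have "0 \<le> (norm p - (r + 2))\<^sup>2" by simp
    ultimately have "r * norm p - (norm p)\<^sup>2 / 2 \<le> (r + 2)\<^sup>2 / 2 - \<bar>fst p\<bar> - \<bar>snd p\<bar>"
      by (simp add: power2_diff algebra_simps)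
    thus "norm (exp (r * norm p) * gauss p)
      \<le> norm (exp ((r + 2)\<^sup>2 / 2) * (exp (- \<bar>fst p\<bar>) * exp (- \<bar>snd p\<bar>)))"
      by (simp add: abs_mult gauss_def exp_add[symmetric] algebra_simps)
  qed
qed (intro continuous_borel_measurable_lborel continuous_intros)

lemma integrable_gauss: "integrable lborel gauss"
  using integrable_gauss_exp[of 0] by simp

lemma integrable_gauss_bound:
  fixes \<phi> :: "real \<times> real \<Rightarrow> complex"
  assumes "\<phi> \<in> borel_measurable lborel" "\<And>p. cmod (\<phi> p) \<le> M * gauss p"
  shows "integrable lborel \<phi>"
  by (rule Bochner_Integration.integrable_bound[OF integrable_mult_right[OF integrable_gauss, of M] assms(1)])
    (use assms(2) abs_ge_self order_trans in \<open>fastforce simp: abs_mult\<close>)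

text \<open>The exponential is expanded under the integral sign. Its partial sums are dominated by
  \<open>exp (cmod c * norm p)\<close>, which the Gaussian bound makes integrable, so the integral
  is a power series in \<open>c\<close> that converges everywhere.\<close>

lemma entire_laplace:
  fixes \<phi> :: "real \<times> real \<Rightarrow> complex"
  assumes meas: "continuous_on UNIV \<phi>" and bound: "\<And>p. cmod (\<phi> p) \<le> M * gauss p"
  shows "(\<lambda>c. LINT p|lborel. exp (c * cnj (plane p)) * \<phi> p) field_differentiable at c"
proof -
  define a where "a = (\<lambda>k. LINT p|lborel. (cnj (plane p) ^ k /\<^sub>R fact k) * \<phi> p)"
  have M: "M \<ge> 0"
    using order_trans[OF norm_ge_zero bound[of 0]] gauss_pos[of 0] by (simp add: zero_le_mult_iff)
  have cont: "continuous_on UNIV (\<lambda>p. cnj (plane p) ^ k /\<^sub>R fact k * \<phi> p)" for k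
    by (intro continuous_intros meas)
  have dom: "cmod ((\<Sum>k<n. (c * cnj (plane p)) ^ k /\<^sub>R fact k) * \<phi> p) \<le> M * (exp (cmod c * norm p) * gauss p)"
    for c p and n :: nat
  proof -
    have "cmod (\<Sum>k<n. (c * cnj (plane p)) ^ k /\<^sub>R fact k) \<le> (\<Sum>k<n. (cmod c * norm p) ^ k /\<^sub>R fact k)"
      by (rule sum_norm_le) (simp add: norm_mult norm_power norm_divide divide_inverse)
    also have "\<dots> \<le> exp (cmod c * norm p)"
      unfolding exp_def by (rule sum_le_suminf[OF summable_exp_generic]) simp_all
    finally have "cmod (\<Sum>k<n. (c * cnj (plane p)) ^ k /\<^sub>R fact k) * cmod (\<phi> p) \<le> exp (cmod c * norm p) * (M * gauss p)"
      by (intro mult_mono bound) auto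
    thus ?thesis by (simp add: norm_mult mult_ac)
  qed
  have int_term: "integrable lborel (\<lambda>p. cnj (plane p) ^ k /\<^sub>R fact k * \<phi> p)" for k
  proof (rule Bochner_Integration.integrable_bound[OF integrable_mult_right[OF integrable_gauss_exp[of 1], of M]])
    show "AE p in lborel. norm (cnj (plane p) ^ k /\<^sub>R fact k * \<phi> p) \<le> norm (M * (exp (1 * norm p) * gauss p))"
    proof (rule AE_I2)
      fix p :: "real \<times> real"
      have "norm p ^ k /\<^sub>R fact k = (\<Sum>j\<in>{k}. norm p ^ j /\<^sub>R fact j)" by simp
      also have "\<dots> \<le> exp (norm p)" unfolding exp_def by (rule sum_le_suminf[OF summable_exp_generic]) simp_all
      finally have "(norm p ^ k /\<^sub>R fact k) * cmod (\<phi> p) \<le> exp (norm p) * (M * gauss p)"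
        by (intro mult_mono bound) auto
      thus "norm (cnj (plane p) ^ k /\<^sub>R fact k * \<phi> p) \<le> norm (M * (exp (1 * norm p) * gauss p))"
        using M gauss_pos[of p] by (simp add: norm_mult norm_power norm_divide divide_inverse mult_ac abs_mult)
    qed
  qed (rule continuous_borel_measurable_lborel[OF cont])
  have sums: "(\<lambda>k. a k * c ^ k) sums (LINT p|lborel. exp (c * cnj (plane p)) * \<phi> p)" for c
  proof -
    have "(\<lambda>n. LINT p|lborel. (\<Sum>k<n. (c * cnj (plane p)) ^ k /\<^sub>R fact k) * \<phi> p) \<longlonglongrightarrow>
        (LINT p|lborel. exp (c * cnj (plane p)) * \<phi> p)"
    proof (rule integral_dominated_convergence)
      show "integrable lborel (\<lambda>p. M * (exp (cmod c * norm p) * gauss p))"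
        by (intro integrable_mult_right integrable_gauss_exp)
      show "AE p in lborel. (\<lambda>n. (\<Sum>k<n. (c * cnj (plane p)) ^ k /\<^sub>R fact k) * \<phi> p) \<longlonglongrightarrow> exp (c * cnj (plane p)) * \<phi> p"
        using exp_converges unfolding sums_def by (intro AE_I2 tendsto_mult tendsto_const) blast
      show "AE p in lborel. cmod ((\<Sum>k<n. (c * cnj (plane p)) ^ k /\<^sub>R fact k) * \<phi> p) \<le> M * (exp (cmod c * norm p) * gauss p)" for n
        using dom by (intro AE_I2)
    qed (intro continuous_borel_measurable_lborel continuous_intros meas)+
    moreover have "(LINT p|lborel. (\<Sum>k<n. (c * cnj (plane p)) ^ k /\<^sub>R fact k) * \<phi> p) = (\<Sum>k<n. a k * c ^ k)" for n
    proof -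
      have "(\<lambda>p. (\<Sum>k<n. (c * cnj (plane p)) ^ k /\<^sub>R fact k) * \<phi> p) =
          (\<lambda>p. \<Sum>k<n. c ^ k * (cnj (plane p) ^ k /\<^sub>R fact k * \<phi> p))"
        by (intro ext) (subst sum_distrib_right, rule sum.cong, auto simp: power_mult_distrib scaleR_conv_of_real mult_ac)
      hence "(LINT p|lborel. (\<Sum>k<n. (c * cnj (plane p)) ^ k /\<^sub>R fact k) * \<phi> p) =
          (\<Sum>k<n. LINT p|lborel. c ^ k * (cnj (plane p) ^ k /\<^sub>R fact k * \<phi> p))"
        by (simp only: Bochner_Integration.integral_sum[OF integrable_mult_right[OF int_term]])
      thus ?thesis unfolding integral_mult_right_zero a_def by (simp only: mult.commute)
    qed
    ultimately show ?thesis by (simp add: sums_def)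
  qed
  have eq: "(\<lambda>c. LINT p|lborel. exp (c * cnj (plane p)) * \<phi> p) = (\<lambda>c. \<Sum>k. a k * c ^ k)"
    using sums by (auto simp: sums_iff fun_eq_iff)
  \<comment> \<open>Differentiability at \<open>c\<close> is read off from convergence at a point of
    larger modulus.\<close>
  have "summable (\<lambda>k. a k * (of_real (cmod c + 1)) ^ k)" using sums sums_summable by blast
  moreover have "cmod c < cmod (of_real (cmod c + 1))" by (simp only: norm_of_real)
  ultimately have "DERIV (\<lambda>c. \<Sum>k. a k * c ^ k) c :> (\<Sum>k. diffs a k * c ^ k)" by (rule termdiffs_strong)
  thus ?thesis unfolding eq using field_differentiable_def by blast
qed

lemma lborel_integral_scaleR:
  fixes f :: "real \<times> real \<Rightarrow> complex"
  assumes "f \<in> borel_measurable borel" "c \<noteq> 0"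
  shows "(LINT p|lborel. f p) = of_real (c\<^sup>2) * (LINT p|lborel. f (c *\<^sub>R p))"
proof -
  have "(LINT p|lborel. f p) =
      (LINT p|density (distr lborel borel (\<lambda>x::real \<times> real. 0 + c *\<^sub>R x)) (\<lambda>_. ennreal (\<bar>c\<bar> ^ DIM(real \<times> real))). f p)"
    by (subst lborel_affine[OF assms(2), of 0]) (simp add: ennreal_power)
  also have "\<dots> = (LINT p|distr lborel borel (\<lambda>x::real \<times> real. 0 + c *\<^sub>R x). \<bar>c\<bar> ^ DIM(real \<times> real) *\<^sub>R f p)"
    using assms by (subst integral_density) auto
  also have "\<dots> = (LINT p|lborel. \<bar>c\<bar> ^ DIM(real \<times> real) *\<^sub>R f (c *\<^sub>R p))"
    using assms(1) by (subst integral_distr) auto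
  finally show ?thesis by (simp add: scaleR_conv_of_real power2_eq_square)
qed

lemma lborel_integral_translate:
  fixes f :: "real \<times> real \<Rightarrow> complex"
  assumes "f \<in> borel_measurable borel"
  shows "(LINT p|lborel. f p) = (LINT p|lborel. f (c + p))"
  by (subst lborel_distr_plus[of c, symmetric]) (use assms in \<open>simp add: integral_distr\<close>)

lemma cos_power_limit: "(\<lambda>n. cos (t / sqrt (real n)) ^ n) \<longlonglongrightarrow> exp (- (t * t / 2))"
  by real_asymp

text \<open>The trigonometric polynomials \<open>cos (a x / sqrt n) ^ n\<close> approximate a Gaussian boundedly, and
  narrow Gaussians approximate a point mass.\<close>

lemma fourier_transform_zero_imp:
  fixes g :: "real \<times> real \<Rightarrow> complex"
  assumes cont: "continuous_on UNIV g" and bound: "\<And>p. cmod (g p) \<le> B" and int: "integrable lborel g"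
    and zero: "\<And>\<alpha> \<beta>. (LINT p|lborel. g p * cis (\<alpha> * fst p + \<beta> * snd p)) = 0"
  shows "g 0 = 0"
proof -
  \<comment> \<open>The class of functions whose Fourier transform vanishes is closed under
    multiplication by cosines, because a cosine only splits each frequency into two shifted ones.
    Powers of cosines, and in the limit Gaussians, can therefore be put under the integral.\<close>
  define Z where "Z = (\<lambda>f :: real \<times> real \<Rightarrow> complex. continuous_on UNIV f \<and> integrable lborel f \<and>
    (\<forall>\<alpha> \<beta>. (LINT p|lborel. f p * cis (\<alpha> * fst p + \<beta> * snd p)) = 0))"
  have cis_cont: "continuous_on UNIV (\<lambda>p. cis (\<alpha> * fst p + \<beta> * snd p))" for \<alpha> \<beta>
    unfolding cis_conv_exp by (intro continuous_intros)
  have step: "Z (\<lambda>p. f p * of_real (cos (\<gamma> * fst p + \<delta> * snd p)))" if f: "Z f" for f \<gamma> \<delta>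
    unfolding Z_def
  proof (intro conjI allI)
    have fc: "continuous_on UNIV f" and fi: "integrable lborel f"
      and fz: "\<And>\<alpha> \<beta>. (LINT p|lborel. f p * cis (\<alpha> * fst p + \<beta> * snd p)) = 0" using f by (auto simp: Z_def)
    show c: "continuous_on UNIV (\<lambda>p. f p * of_real (cos (\<gamma> * fst p + \<delta> * snd p)))"
      by (intro continuous_intros fc)
    show "integrable lborel (\<lambda>p. f p * of_real (cos (\<gamma> * fst p + \<delta> * snd p)))"
      by (rule Bochner_Integration.integrable_bound[OF fi continuous_borel_measurable_lborel[OF c]])
        (auto simp: norm_mult mult_left_le)
    have fcis: "integrable lborel (\<lambda>p. f p * cis (\<alpha> * fst p + \<beta> * snd p))" for \<alpha> \<beta>
      by (rule Bochner_Integration.integrable_bound[OF fi continuous_borel_measurable_lborel])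
        (auto simp: norm_mult intro!: continuous_intros fc cis_cont)
    fix \<alpha> \<beta>
    have "f p * of_real (cos (\<gamma> * fst p + \<delta> * snd p)) * cis (\<alpha> * fst p + \<beta> * snd p) =
       (f p * cis ((\<alpha> + \<gamma>) * fst p + (\<beta> + \<delta>) * snd p) + f p * cis ((\<alpha> - \<gamma>) * fst p + (\<beta> - \<delta>) * snd p)) / 2" for p
    proof -
      have "complex_of_real (cos t) * cis s = (cis (s + t) + cis (s - t)) / 2" for s t
        by (simp add: complex_eq_iff cos_add cos_diff sin_add sin_diff)
      from this[of "\<gamma> * fst p + \<delta> * snd p" "\<alpha> * fst p + \<beta> * snd p"]
      show ?thesis by (simp add: algebra_simps)
    qed
    hence "(LINT p|lborel. f p * of_real (cos (\<gamma> * fst p + \<delta> * snd p)) * cis (\<alpha> * fst p + \<beta> * snd p)) =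
      (LINT p|lborel. (f p * cis ((\<alpha> + \<gamma>) * fst p + (\<beta> + \<delta>) * snd p) +
        f p * cis ((\<alpha> - \<gamma>) * fst p + (\<beta> - \<delta>) * snd p)) / 2)" by (simp only:)
    also have "\<dots> = 0" using fcis fz by (simp add: Bochner_Integration.integral_add)
    finally show "(LINT p|lborel. f p * of_real (cos (\<gamma> * fst p + \<delta> * snd p)) * cis (\<alpha> * fst p + \<beta> * snd p)) = 0" .
  qed
  have steps: "Z (\<lambda>p. f p * of_real (cos (\<gamma> * fst p + \<delta> * snd p)) ^ n)" if f: "Z f" for f \<gamma> \<delta> n
  proof (induction n)
    case 0
    thus ?case using f by simp
  next
    case (Suc n)
    from step[OF this, of \<gamma> \<delta>] show ?case by (simp add: mult_ac)
  qed
  have Zg: "Z g" using cont int zero by (simp add: Z_def)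
  have gauss0: "(LINT p|lborel. g p * of_real (exp (- (a * fst p * (a * fst p) / 2)) * exp (- (a * snd p * (a * snd p) / 2)))) = 0" for a
  proof (rule LIMSEQ_unique)
    let ?c = "\<lambda>n t. cos (a * t / sqrt (real n)) ^ n"
    show "(\<lambda>n. LINT p|lborel. g p * of_real (?c n (fst p) * ?c n (snd p))) \<longlonglongrightarrow>
      (LINT p|lborel. g p * of_real (exp (- (a * fst p * (a * fst p) / 2)) * exp (- (a * snd p * (a * snd p) / 2))))"
    proof (rule integral_dominated_convergence)
      show "integrable lborel (\<lambda>p. cmod (g p))" using int by simp
      show "AE p in lborel. (\<lambda>n. g p * of_real (?c n (fst p) * ?c n (snd p))) \<longlonglongrightarrow>
         g p * of_real (exp (- (a * fst p * (a * fst p) / 2)) * exp (- (a * snd p * (a * snd p) / 2)))"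
        by (intro AE_I2 tendsto_intros cos_power_limit)
      show "AE p in lborel. cmod (g p * of_real (?c n (fst p) * ?c n (snd p))) \<le> cmod (g p)" for n
        by (intro AE_I2) (simp add: norm_mult norm_power mult_left_le mult_le_one power_le_one)
      show "(\<lambda>p. g p * of_real (?c n (fst p) * ?c n (snd p))) \<in> borel_measurable lborel" for n
        by (intro continuous_borel_measurable_lborel)
          (cases "n = 0", auto intro!: continuous_intros cont)
      show "(\<lambda>p. g p * of_real (exp (- (a * fst p * (a * fst p) / 2)) * exp (- (a * snd p * (a * snd p) / 2))))
          \<in> borel_measurable lborel"
        by (intro continuous_borel_measurable_lborel continuous_intros cont) auto
    qed
    have "(LINT p|lborel. g p * of_real (?c n (fst p) * ?c n (snd p))) = 0" for n
      using steps[OF steps[OF Zg, of "a / sqrt n" 0 n], of 0 "a / sqrt n" n]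
      unfolding Z_def by (elim conjE allE[of _ 0]) (simp add: mult_ac)
    thus "(\<lambda>n. LINT p|lborel. g p * of_real (?c n (fst p) * ?c n (snd p))) \<longlonglongrightarrow> 0" by simp
  qed
  \<comment> \<open>A change of variables trades the narrowing Gaussian for a fixed one and a
    stretched \<open>g\<close>, whose limit is the constant \<open>g 0\<close>.\<close>
  have scaled: "(LINT p|lborel. g ((1 / real (Suc n)) *\<^sub>R p) * of_real (gauss p)) = 0" for n
  proof -
    define a where "a = real (Suc n)"
    have a: "a \<noteq> 0" unfolding a_def by simp
    let ?F = "\<lambda>p. g p * of_real (exp (- (a * fst p * (a * fst p) / 2)) * exp (- (a * snd p * (a * snd p) / 2)))"
    have "?F \<in> borel_measurable borel"
      by (intro borel_measurable_continuous_onI continuous_intros cont) auto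
    from lborel_integral_scaleR[OF this, of "1 / a"]
    have "(LINT p|lborel. ?F ((1 / a) *\<^sub>R p)) = 0" using gauss0[of a] a by simp
    moreover have "?F ((1 / a) *\<^sub>R p) = g ((1 / a) *\<^sub>R p) * of_real (gauss p)" for p
      using a by (simp add: gauss_def norm_prod_def exp_add[symmetric] power2_eq_square add_divide_distrib)
    ultimately show ?thesis unfolding a_def by (simp only:)
  qed
  have "(\<lambda>n. LINT p|lborel. g ((1 / real (Suc n)) *\<^sub>R p) * of_real (gauss p)) \<longlonglongrightarrow> (LINT p|lborel. g 0 * of_real (gauss p))"
  proof (rule integral_dominated_convergence)
    show "integrable lborel (\<lambda>p. B * gauss p)" by (intro integrable_mult_right integrable_gauss)
    show "AE p in lborel. (\<lambda>n. g ((1 / real (Suc n)) *\<^sub>R p) * of_real (gauss p)) \<longlonglongrightarrow> g 0 * of_real (gauss p)"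
    proof (intro AE_I2 tendsto_mult tendsto_const)
      fix p :: "real \<times> real"
      have "(\<lambda>n. (1 / real (Suc n)) *\<^sub>R p) \<longlonglongrightarrow> 0 *\<^sub>R p" by (rule tendsto_scaleR[OF LIMSEQ_Suc[OF lim_1_over_n] tendsto_const])
      hence 1: "(\<lambda>n. (1 / real (Suc n)) *\<^sub>R p) \<longlonglongrightarrow> 0" by simp
      show "(\<lambda>n. g ((1 / real (Suc n)) *\<^sub>R p)) \<longlonglongrightarrow> g 0"
        using continuous_on_tendsto_compose[OF cont 1] by simp
    qed
    show "AE p in lborel. cmod (g ((1 / real (Suc n)) *\<^sub>R p) * of_real (gauss p)) \<le> B * gauss p" for n
      by (intro AE_I2) (simp add: norm_mult less_imp_le[OF gauss_pos] mult_right_mono bound abs_of_pos[OF gauss_pos])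
    have c2: "continuous_on UNIV (\<lambda>p. g ((1 / real (Suc n)) *\<^sub>R p))" for n
      by (rule continuous_on_compose2[OF cont]) (auto intro!: continuous_intros)
    show "(\<lambda>p. g ((1 / real (Suc n)) *\<^sub>R p) * of_real (gauss p)) \<in> borel_measurable lborel" for n
      by (intro continuous_borel_measurable_lborel continuous_intros c2)
    show "(\<lambda>p. g 0 * of_real (gauss p)) \<in> borel_measurable lborel"
      by (intro continuous_borel_measurable_lborel continuous_intros)
  qed
  hence "(LINT p|lborel. g 0 * of_real (gauss p)) = 0" unfolding scaled by (rule LIMSEQ_unique[OF _ tendsto_const])
  hence "g 0 = 0 \<or> (LINT p|lborel. gauss p) = 0" by simp
  moreover have "(LINT p|lborel. gauss p) \<noteq> 0"
  proof
    assume "(LINT p|lborel. gauss p) = 0"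
    hence "AE p in lborel. gauss p = 0"
      using integral_nonneg_eq_0_iff_AE[OF integrable_gauss] gauss_pos by (simp add: less_imp_le)
    hence "AE p in (lborel :: (real \<times> real) measure). False" by eventually_elim (use gauss_pos in \<open>metis less_irrefl\<close>)
    hence "emeasure lborel (UNIV :: (real \<times> real) set) = 0"
      by (subst (asm) AE_iff_measurable[OF _ refl]) auto
    thus False by (simp add: emeasure_lborel_UNIV)
  qed
  ultimately show ?thesis by blast
qed

text \<open>The derivative of the conjugate function is both complex linear and conjugate linear;
  comparing its values at \<open>1\<close> and \<open>\<i>\<close> shows that it vanishes.\<close>

lemma entire_cnj_entire_constant:
  assumes f: "\<And>c. f field_differentiable (at c)" and g: "\<And>c. (\<lambda>c. cnj (f c)) field_differentiable (at c)"
  shows "f c = f 0"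
proof -
  have "(f has_field_derivative 0) (at c within UNIV)" for c
  proof -
    obtain d where d: "(f has_field_derivative d) (at c)" using f unfolding field_differentiable_def by blast
    obtain d' where d': "((\<lambda>c. cnj (f c)) has_field_derivative d') (at c)" using g unfolding field_differentiable_def by blast
    have "((\<lambda>c. cnj (f c)) has_derivative (\<lambda>h. cnj (d * h))) (at c)"
      by (rule bounded_linear.has_derivative[OF bounded_linear_cnj d[unfolded has_field_derivative_def]])
    hence "(\<lambda>h. cnj (d * h)) = (\<lambda>h. d' * h)"
      using has_derivative_unique d'[unfolded has_field_derivative_def] by blast
    hence h: "cnj (d * h) = d' * h" for h by (rule fun_cong)
    have "d = 0" using h[of 1] h[of \<i>] by (simp add: complex_eq_iff)
    thus ?thesis using d by simp
  qed
  thus ?thesis using has_field_derivative_zero_constant[of UNIV f] by (metis UNIV_I convex_UNIV)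
qed

lemma cinner_self_eq_iff_norm_eq: "cinner x x = cinner y y \<longleftrightarrow> norm (x::'a::complex_hilbert) = norm (y::'b::complex_hilbert)"
  unfolding cinner_self of_real_eq_iff by (simp add: power2_eq_iff_nonneg)

section \<open>Weyl systems and their vacua\<close>

text \<open>One degree of freedom: the Heisenberg group modulo its centre is the complex plane, and fixing the
  central character leaves a projective representation with the symplectic form in its cocycle.\<close>

locale weyl_mode =
  fixes K :: "'h::complex_hilbert set" and V :: "complex \<Rightarrow> 'h \<Rightarrow> 'h"
  assumes closed_K: "closed K" and csub_K: "csubspace K"
    and V_in: "\<And>c v. v \<in> K \<Longrightarrow> V c v \<in> K"
    and V_lin: "\<And>c. clinear_on K (V c)"
    and V_inner: "\<And>c v w. v \<in> K \<Longrightarrow> w \<in> K \<Longrightarrow> cinner (V c v) (V c w) = cinner v w"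
    and V_0: "\<And>v. v \<in> K \<Longrightarrow> V 0 v = v"
    and V_V: "\<And>c d v. v \<in> K \<Longrightarrow> V c (V d v) = cis (Im (c * cnj d)) *\<^sub>C V (c + d) v"
    and V_cont: "\<And>v. v \<in> K \<Longrightarrow> continuous_on UNIV (\<lambda>c. V c v)"
begin

lemma V_scaleC: "v \<in> K \<Longrightarrow> V c (a *\<^sub>C v) = a *\<^sub>C V c v"
  using V_lin by (auto simp: clinear_on_def)

lemma norm_V: "v \<in> K \<Longrightarrow> norm (V c v) = norm v"
  using V_inner[of v v c] by (simp only: cinner_self_eq_iff_norm_eq[symmetric])

lemma V_inv: "v \<in> K \<Longrightarrow> V (- c) (V c v) = v"
  using V_V[of v "- c" c] by (simp add: V_0)

lemma V_inv': "v \<in> K \<Longrightarrow> V c (V (- c) v) = v"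
  using V_inv[of v "- c"] by simp

lemma V_adjoint: "v \<in> K \<Longrightarrow> w \<in> K \<Longrightarrow> cinner (V c v) w = cinner v (V (- c) w)"
  using V_inner[of v "V (- c) w" c] by (simp add: V_in V_inv')

text \<open>The integral of \<open>gauss p\<close> times \<open>V (plane p) v\<close>, understood
  weakly through its coefficients. It is a relation because existence is proved separately by Riesz
  representation.\<close>

definition gauss_avg :: "'h \<Rightarrow> 'h \<Rightarrow> bool"
  where "gauss_avg v x \<longleftrightarrow> x \<in> K \<and>
    (\<forall>u\<in>K. cinner x u = (LINT p|lborel. of_real (gauss p) * cinner (V (plane p) v) u))"

text \<open>The vacuum condition in Bargmann form: for the vacuum itself, \<open>exp (|c|\<^sup>2 / 2) V c x\<close> is the
  unnormalised coherent state, which is an entire function of \<open>c\<close>.\<close>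

definition hol_vec :: "'h \<Rightarrow> bool"
  where "hol_vec x \<longleftrightarrow> x \<in> K \<and> (\<forall>u\<in>K. \<forall>c.
    (\<lambda>c. of_real (exp ((cmod c)\<^sup>2 / 2)) * cinner (V c x) u) field_differentiable (at c))"

lemma continuous_coeff: "v \<in> K \<Longrightarrow> continuous_on UNIV (\<lambda>p. cinner (V (plane p) v) u)"
  by (intro continuous_on_cinner continuous_on_compose2[OF V_cont] continuous_on_plane) auto

lemma integrable_coeff:
  assumes "v \<in> K"
  shows "integrable lborel (\<lambda>p. of_real (gauss p) * cinner (V (plane p) v) u)"
proof (rule integrable_gauss_bound)
  show "cmod (of_real (gauss p) * cinner (V (plane p) v) u) \<le> (norm v * norm u) * gauss p" for p
    using cmod_cinner_le[of "V (plane p) v" u] norm_V[OF assms] gauss_pos[of p]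
    by (simp add: norm_mult mult.commute)
qed (intro continuous_borel_measurable_lborel continuous_intros continuous_coeff assms)

text \<open>The average is constructed inside the invariant subspace \<open>K1\<close> although it
  is tested against all of \<open>K\<close>: replacing a test vector by its projection to
  \<open>K1\<close> changes neither side. This is how vacua are found in a prescribed
  subspace.\<close>

lemma gauss_avg_exists:
  assumes K1: "closed K1" "csubspace K1" "K1 \<subseteq> K" "\<And>c v. v \<in> K1 \<Longrightarrow> V c v \<in> K1" and v: "v \<in> K1"
  obtains x where "x \<in> K1" "gauss_avg v x"
proof -
  have vK: "v \<in> K" using v K1 by blast
  let ?\<phi> = "\<lambda>u. LINT p|lborel. of_real (gauss p) * cinner (V (plane p) v) u"
  obtain x where x: "x \<in> K1" "\<And>u. u \<in> K1 \<Longrightarrow> cinner x u = ?\<phi> u"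
  proof (rule riesz[OF K1(1,2), of ?\<phi> "norm v * (LINT p|lborel. gauss p)"])
    show "?\<phi> (x + y) = ?\<phi> x + ?\<phi> y" for x y
      using integrable_coeff[OF vK] by (simp add: cinner_add_right distrib_left Bochner_Integration.integral_add)
    show "?\<phi> (c *\<^sub>C x) = cnj c * ?\<phi> x" for c x
    proof -
      have "(\<lambda>p. of_real (gauss p) * cinner (V (plane p) v) (c *\<^sub>C x)) =
          (\<lambda>p. cnj c * (of_real (gauss p) * cinner (V (plane p) v) x))"
        by (auto simp: cinner_scaleC_right)
      thus ?thesis by simp
    qed
    show "cmod (?\<phi> x) \<le> norm v * (LINT p|lborel. gauss p) * norm x" for x
    proof -
      have "cmod (?\<phi> x) \<le> (LINT p|lborel. norm v * norm x * gauss p)"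
      proof (rule Bochner_Integration.integral_norm_bound_integral)
        show "cmod (of_real (gauss p) * cinner (V (plane p) v) x) \<le> norm v * norm x * gauss p" for p
          using cmod_cinner_le[of "V (plane p) v" x] norm_V[OF vK] gauss_pos[of p]
          by (simp add: norm_mult mult.commute)
      qed (intro integrable_coeff vK integrable_mult_right integrable_gauss)+
      thus ?thesis by (simp add: mult_ac)
    qed
  qed auto
  obtain pr where pr: "\<And>x. pr x \<in> K1" "\<And>x k. k \<in> K1 \<Longrightarrow> cinner (pr x) k = cinner x k"
    by (rule orthogonal_projection[OF K1(1,2)]) auto
  have pr': "cinner k u = cinner k (pr u)" if "k \<in> K1" for k u
    using pr(2)[OF that, of u] by (metis cinner_commute)
  have "cinner x u = ?\<phi> u" for u
    using x(2)[OF pr(1), of u] pr'[OF x(1)] pr'[OF K1(4)[OF v]] by simp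
  thus thesis using that x(1) K1(3) by (auto simp: gauss_avg_def)
qed

text \<open>Translating the integration variable by \<open>c\<close> turns the Gaussian and the cocycle together into the
  factor \<open>exp (c * cnj z)\<close>, which is holomorphic in \<open>c\<close>.\<close>

lemma hol_vec_gauss_avg:
  assumes v: "v \<in> K" and avg: "gauss_avg v x"
  shows "hol_vec x"
proof -
  have x: "x \<in> K" using avg by (simp add: gauss_avg_def)
  have "(\<lambda>c. of_real (exp ((cmod c)\<^sup>2 / 2)) * cinner (V c x) u) field_differentiable (at d)" if u: "u \<in> K" for u d
  proof -
    define \<phi> where "\<phi> = (\<lambda>p. of_real (gauss p) * cinner (V (plane p) v) u)"
    have \<phi>_cont: "continuous_on UNIV \<phi>" unfolding \<phi>_def by (intro continuous_intros continuous_coeff v)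
    have \<phi>_bound: "cmod (\<phi> p) \<le> (norm v * norm u) * gauss p" for p
      using cmod_cinner_le[of "V (plane p) v" u] norm_V[OF v] gauss_pos[of p]
      by (simp add: \<phi>_def norm_mult mult.commute)
    have "of_real (exp ((cmod c)\<^sup>2 / 2)) * cinner (V c x) u = (LINT p|lborel. exp (c * cnj (plane p)) * \<phi> p)" for c
    proof -
      let ?F = "\<lambda>p. of_real (gauss p) * (cis (Im (c * cnj (plane p))) * cinner (V (c + plane p) v) u)"
      have F_cont: "continuous_on UNIV ?F"
        unfolding cis_conv_exp
        by (intro continuous_intros continuous_on_cinner continuous_on_compose2[OF V_cont[OF v]]) auto
      have "cinner (V c x) u = (LINT p|lborel. of_real (gauss p) * cinner (V (plane p) v) (V (- c) u))"
        using avg u x by (simp add: V_adjoint gauss_avg_def V_in)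
      also have "\<dots> = (LINT p|lborel. ?F p)"
        using u v by (simp add: V_adjoint[symmetric] V_in V_V cinner_scaleC_left)
      also have "\<dots> = (LINT p|lborel. ?F (- (Re c, Im c) + p))"
        by (rule lborel_integral_translate) (intro borel_measurable_continuous_onI F_cont)
      finally have 1: "cinner (V c x) u = (LINT p|lborel. ?F (- (Re c, Im c) + p))" .
      have "of_real (exp ((cmod c)\<^sup>2 / 2)) * ?F (- (Re c, Im c) + p) = exp (c * cnj (plane p)) * \<phi> p" for p
      proof -
        have pl: "c + plane (- (Re c, Im c) + p) = plane p" by (simp add: plane_def complex_eq_iff)
        have im: "Im (c * cnj (plane (- (Re c, Im c) + p))) = Im (c * cnj (plane p))"
          by (simp add: plane_def algebra_simps)
        \<comment> \<open>Only moduli are compared here. The cocycle contributes the phase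
          \<open>Im (c * cnj (plane p))\<close>, which completes the exponent to
          \<open>c * cnj (plane p)\<close>.\<close>
        have "(cmod c)\<^sup>2 / 2 + - (norm (- (Re c, Im c) + p))\<^sup>2 / 2 = Re (c * cnj (plane p)) + - (norm p)\<^sup>2 / 2"
          unfolding cmod_plane[symmetric] cmod_power2 by (simp add: plane_def power2_eq_square field_simps)
        hence "exp ((cmod c)\<^sup>2 / 2) * gauss (- (Re c, Im c) + p) = exp (Re (c * cnj (plane p))) * gauss p"
          unfolding gauss_def exp_add[symmetric] by simp
        hence "of_real (exp ((cmod c)\<^sup>2 / 2)) * complex_of_real (gauss (- (Re c, Im c) + p)) =
            of_real (exp (Re (c * cnj (plane p)))) * of_real (gauss p)" by (simp only: of_real_mult[symmetric])
        hence "of_real (exp ((cmod c)\<^sup>2 / 2)) * ?F (- (Re c, Im c) + p) = of_real (exp (Re (c * cnj (plane p)))) *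
            of_real (gauss p) * (cis (Im (c * cnj (plane p))) * cinner (V (plane p) v) u)"
          unfolding pl im by (simp only: mult.assoc[symmetric])
        thus ?thesis unfolding exp_eq_polar[of "c * cnj (plane p)"] \<phi>_def by (simp only: mult_ac)
      qed
      thus ?thesis unfolding 1 integral_mult_right_zero[symmetric] by (simp only:)
    qed
    thus ?thesis using entire_laplace[OF \<phi>_cont \<phi>_bound, of d] by (simp only:)
  qed
  thus ?thesis using x by (simp add: hol_vec_def)
qed

text \<open>The matrix coefficient of two such vectors and its complex conjugate are both entire, so it is
  constant up to the Gaussian factor.\<close>

lemma hol_vec_pair:
  assumes x: "hol_vec x" and y: "hol_vec y"
  shows "cinner (V c x) y = of_real (exp (- (cmod c)\<^sup>2 / 2)) * cinner x y"
proof -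
  have xK: "x \<in> K" and yK: "y \<in> K" using x y by (auto simp: hol_vec_def)
  let ?k = "\<lambda>c. of_real (exp ((cmod c)\<^sup>2 / 2)) * cinner (V c x) y"
  let ?l = "\<lambda>c. of_real (exp ((cmod c)\<^sup>2 / 2)) * cinner (V c y) x"
  have k: "?k field_differentiable (at c)" for c using x yK by (simp add: hol_vec_def)
  have l: "?l field_differentiable (at c)" for c using y xK by (simp add: hol_vec_def)
  have "cnj (?k c) = ?l (- c)" for c
  proof -
    have "cnj (cinner (V c x) y) = cinner (V (- c) y) x"
      using V_adjoint[OF xK yK, of c] by (metis cinner_commute)
    thus ?thesis by simp
  qed
  moreover have "(\<lambda>c. ?l (- c)) field_differentiable (at c)" for c
    using field_differentiable_compose[OF field_differentiable_minus[OF field_differentiable_ident] l]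
    unfolding o_def .
  ultimately have "(\<lambda>c. cnj (?k c)) field_differentiable (at c)" for c by (simp only:)
  from entire_cnj_entire_constant[OF k this, of c]
  have "of_real (exp ((cmod c)\<^sup>2 / 2)) * cinner (V c x) y = cinner x y" using xK by (simp add: V_0)
  hence "of_real (exp (- (cmod c)\<^sup>2 / 2)) * (of_real (exp ((cmod c)\<^sup>2 / 2)) * cinner (V c x) y) =
      of_real (exp (- (cmod c)\<^sup>2 / 2)) * cinner x y" by simp
  thus ?thesis unfolding mult.assoc[symmetric] of_real_mult[symmetric] exp_add[symmetric] by simp
qed

text \<open>If all averages vanished, so would the Fourier transform of \<open>gauss p * cinner (V p v) v\<close>.\<close>

lemma gauss_avg_nonzero:
  assumes v: "v \<in> K" "v \<noteq> 0"
  obtains w where "\<And>x. gauss_avg (V w v) x \<Longrightarrow> x \<noteq> 0"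
proof (rule ccontr)
  assume *: "\<not> thesis"
  have avg0: "gauss_avg (V w v) 0" for w using * that by blast
  define g where "g = (\<lambda>p. of_real (gauss p) * cinner (V (plane p) v) v)"
  have "(LINT p|lborel. g p * cis (\<alpha> * fst p + \<beta> * snd p)) = 0" for \<alpha> \<beta>
  proof -
    \<comment> \<open>Conjugation by \<open>V w\<close> multiplies \<open>V (plane p)\<close> by
      \<open>cis (2 * Im (plane p * cnj w))\<close>; this \<open>w\<close> produces the frequency
      \<open>(\<alpha>, \<beta>)\<close>.\<close>
    define w where "w = Complex (\<beta> / 2) (- \<alpha> / 2)"
    have "g p * cis (\<alpha> * fst p + \<beta> * snd p) = of_real (gauss p) * cinner (V (plane p) (V w v)) (V w v)" for p
    proof -
      have "cinner (V (plane p) (V w v)) (V w v) = cinner (V (- w) (V (plane p) (V w v))) v"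
        using v by (simp add: V_adjoint V_in)
      also have "V (- w) (V (plane p) (V w v)) = (cis (Im (plane p * cnj w)) * cis (Im (- w * cnj (plane p + w)))) *\<^sub>C V (plane p) v"
        using v by (simp add: V_V V_in V_scaleC scaleC_scaleC)
      also have "cis (Im (plane p * cnj w)) * cis (Im (- w * cnj (plane p + w))) = cis (\<alpha> * fst p + \<beta> * snd p)"
        unfolding cis_mult by (rule arg_cong[where f = cis]) (simp add: plane_def w_def algebra_simps)
      finally show ?thesis by (simp add: g_def cinner_scaleC_left)
    qed
    hence "(LINT p|lborel. g p * cis (\<alpha> * fst p + \<beta> * snd p)) =
        (LINT p|lborel. of_real (gauss p) * cinner (V (plane p) (V w v)) (V w v))" by (simp only:)
    also have "\<dots> = 0" using avg0[of w] v by (simp add: gauss_avg_def V_in)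
    finally show ?thesis .
  qed
  moreover have "cmod (g p) \<le> norm v * norm v" for p
  proof -
    have "gauss p \<le> 1" by (simp add: gauss_def)
    moreover have "cmod (cinner (V (plane p) v) v) \<le> norm v * norm v"
      using cmod_cinner_le[of "V (plane p) v" v] norm_V[OF v(1)] by simp
    ultimately have "gauss p * cmod (cinner (V (plane p) v) v) \<le> 1 * (norm v * norm v)"
      using gauss_pos[of p] by (intro mult_mono) auto
    thus ?thesis using gauss_pos[of p] by (simp add: g_def norm_mult)
  qed
  moreover have "continuous_on UNIV g" "integrable lborel g"
    unfolding g_def by (intro continuous_intros continuous_coeff v, rule integrable_coeff[OF v(1)])
  ultimately have "g 0 = 0" by (intro fourier_transform_zero_imp[of g "norm v * norm v"])
  moreover have "plane 0 = 0" by (simp add: plane_def complex_eq_iff)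
  ultimately show False using v by (simp add: g_def gauss_def V_0 cinner_self)
qed

text \<open>Averaging is a symmetric operation, since \<open>gauss\<close> is even and
  \<open>V (- c)\<close> is the adjoint of \<open>V c\<close>. It allows an average to be moved to
  the test vector.\<close>

lemma gauss_avg_adjoint:
  assumes v: "v \<in> K" "gauss_avg v x" and u: "u \<in> K" "gauss_avg u z"
  shows "cinner x u = cinner v z"
proof -
  have "cinner z v = (LINT p|lborel. of_real (gauss p) * cinner (V (plane p) u) v)"
    using u v by (simp add: gauss_avg_def)
  also have "\<dots> = (LINT p|lborel. of_real (gauss (- p)) * cinner (V (plane (- p)) u) v)"
    using lborel_integral_scaleR[of "\<lambda>p. of_real (gauss p) * cinner (V (plane p) u) v" "-1"] integrable_coeff[OF u(1), of v]
    by simp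
  also have "\<dots> = (LINT p|lborel. cnj (of_real (gauss p) * cinner (V (plane p) v) u))"
  proof (rule arg_cong[where f = "integral\<^sup>L lborel"], rule ext)
    fix p
    have "plane (- p) = - plane p" by (simp add: plane_def complex_eq_iff)
    hence "cinner (V (plane (- p)) u) v = cinner u (V (plane p) v)" using u v by (simp add: V_adjoint)
    also have "\<dots> = cnj (cinner (V (plane p) v) u)" by (rule cinner_commute)
    finally show "of_real (gauss (- p)) * cinner (V (plane (- p)) u) v = cnj (of_real (gauss p) * cinner (V (plane p) v) u)"
      by (simp add: gauss_def)
  qed
  also have "\<dots> = cnj (LINT p|lborel. of_real (gauss p) * cinner (V (plane p) v) u)"
    by (rule integral_bounded_linear[OF bounded_linear_cnj integrable_coeff[OF v(1)]])
  also have "\<dots> = cnj (cinner x u)" using u v by (simp add: gauss_avg_def)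
  finally show ?thesis using cinner_commute[of v z] by simp
qed

text \<open>An operator with an adjoint passes through a weak integral. It will be a Weyl operator
  of another mode.\<close>

lemma gauss_avg_commuting:
  assumes v: "v \<in> K" "gauss_avg v x" and A: "\<And>y. y \<in> K \<Longrightarrow> A y \<in> K" "\<And>y. y \<in> K \<Longrightarrow> B y \<in> K"
    and adj: "\<And>y z. y \<in> K \<Longrightarrow> z \<in> K \<Longrightarrow> cinner (A y) z = cinner y (B z)"
    and comm: "\<And>c y. y \<in> K \<Longrightarrow> V c (A y) = A (V c y)"
  shows "gauss_avg (A v) (A x)"
  using assms unfolding gauss_avg_def by (auto simp: V_in)

text \<open>A vector with the Gram function of the vacuum is the image of a coherent state under an isometry.\<close>

lemma hol_vec_if_gram:
  assumes x: "x \<in> K" and gram: "\<And>c. cinner (V c x) x = of_real (exp (- (cmod c)\<^sup>2 / 2)) * cinner x x"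
  shows "hol_vec x"
proof -
  \<comment> \<open>Both families are scaled to the Gram matrix
    \<open>exp (c * cnj d) * cinner x x\<close>. The isometry then transfers holomorphic dependence
    on \<open>c\<close> from coherent states to the orbit of \<open>x\<close>.\<close>
  define f where "f = (\<lambda>c. of_real (norm x) *\<^sub>C coherent c)"
  define g where "g = (\<lambda>c. of_real (exp ((cmod c)\<^sup>2 / 2)) *\<^sub>C V c x)"
  have gram_fg: "cinner (f c) (f d) = cinner (g c) (g d)" for c d
  proof -
    have "cinner (V c x) (V d x) = cinner (V (- d) (V c x)) x" using x by (simp add: V_adjoint V_in)
    also have "\<dots> = cis (Im (c * cnj d)) * (of_real (exp (- (cmod (c - d))\<^sup>2 / 2)) * cinner x x)"
    proof -
      have "Im (- d * cnj c) = Im (c * cnj d)" by simp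
      thus ?thesis using x by (simp only: V_V cinner_scaleC_left gram) (simp add: gram)
    qed
    finally have 1: "cinner (g c) (g d) = of_real (exp ((cmod c)\<^sup>2 / 2)) * of_real (exp ((cmod d)\<^sup>2 / 2)) *
        of_real (exp (- (cmod (c - d))\<^sup>2 / 2)) * cis (Im (c * cnj d)) * cinner x x"
      by (simp add: g_def cinner_scaleC_left cinner_scaleC_right mult_ac)
    have "(cmod c)\<^sup>2 / 2 + (cmod d)\<^sup>2 / 2 + - (cmod (c - d))\<^sup>2 / 2 = Re (c * cnj d)"
      unfolding cmod_power2 by (simp add: power2_eq_square field_simps)
    hence "cinner (g c) (g d) = exp (c * cnj d) * cinner x x"
      unfolding 1 exp_eq_polar[of "c * cnj d"] of_real_mult[symmetric] exp_add[symmetric] by (simp only:)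
    thus ?thesis
      by (simp add: f_def cinner_scaleC_left cinner_scaleC_right cinner_coherent cinner_self power2_eq_square mult_ac)
  qed
  obtain T where T: "bounded_linear T" "\<And>c x. T (c *\<^sub>C x) = c *\<^sub>C T x" "\<And>c. T (f c) = g c"
    by (rule gram_isometry[of UNIV f g, OF gram_fg]) auto
  have "(\<lambda>c. of_real (exp ((cmod c)\<^sup>2 / 2)) * cinner (V c x) u) field_differentiable (at d)" for u d
  proof -
    define E' where "E' = vec_series (\<lambda>k. of_nat (Suc k) *\<^sub>C (1 / sqrt (fact (Suc k))) *\<^sub>R ell2_basis (Suc k)) d"
    have "(coherent has_derivative (\<lambda>v. v *\<^sub>C E')) (at d)"
      unfolding coherent_def E'_def by (rule vec_series_has_derivative[OF entire_coeffs_coherent])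
    hence "((\<lambda>c. cinner (T (of_real (norm x) *\<^sub>C coherent c)) u) has_derivative
        (\<lambda>v. cinner (T (of_real (norm x) *\<^sub>C (v *\<^sub>C E'))) u)) (at d)"
      by (intro bounded_linear.has_derivative[OF bounded_linear_cinner_left]
          bounded_linear.has_derivative[OF T(1)] bounded_linear.has_derivative[OF bounded_linear_scaleC])
    hence "((\<lambda>c. cinner (T (f c)) u) has_derivative (\<lambda>v. v * (of_real (norm x) * cinner (T E') u))) (at d)"
      by (simp add: f_def T cinner_scaleC_left mult_ac)
    hence "((\<lambda>c. cinner (g c) u) has_field_derivative (of_real (norm x) * cinner (T E') u)) (at d)"
      unfolding has_field_derivative_def T(3) by (simp add: mult.commute[of _ "_ * _"])
    thus ?thesis unfolding field_differentiable_def g_def cinner_scaleC_left by blast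
  qed
  thus ?thesis using x by (simp add: hol_vec_def)
qed

end

section \<open>Coordinates and characters\<close>

text \<open>A hyperbolic pair \<open>e\<close>, \<open>f\<close> is split off and the induction
  continues on its symplectic complement, which is again nondegenerate because a vector orthogonal
  to the complement, to \<open>e\<close> and to \<open>f\<close> is orthogonal to
  everything.\<close>

lemma symplectic_basis:
  fixes V :: "'v::euclidean_space set"
  assumes V: "subspace V" and bil: "bilinear w"
    and alt: "\<And>x y. x \<in> V \<Longrightarrow> y \<in> V \<Longrightarrow> w x y = - (w y x :: real)"
    and nondeg: "\<And>x. x \<in> V \<Longrightarrow> (\<And>y. y \<in> V \<Longrightarrow> w x y = 0) \<Longrightarrow> x = 0"
  obtains n :: nat and E F where "\<And>j. j < n \<Longrightarrow> E j \<in> V" "\<And>j. j < n \<Longrightarrow> F j \<in> V"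
    "\<And>i j. i < n \<Longrightarrow> j < n \<Longrightarrow> w (E i) (F j) = (if i = j then 1 else 0)"
    "\<And>i j. i < n \<Longrightarrow> j < n \<Longrightarrow> w (E i) (E j) = 0"
    "\<And>i j. i < n \<Longrightarrow> j < n \<Longrightarrow> w (F i) (F j) = 0"
    "\<And>v. v \<in> V \<Longrightarrow> v = (\<Sum>j<n. w v (F j) *\<^sub>R E j + w (E j) v *\<^sub>R F j)"
proof -
  note form = bilinear_ladd[OF bil] bilinear_radd[OF bil] bilinear_lmul[OF bil] bilinear_rmul[OF bil]
    bilinear_lsub[OF bil] bilinear_rsub[OF bil] bilinear_lzero[OF bil] bilinear_rzero[OF bil]
  define P where "P = (\<lambda>V (n :: nat) E F. (\<forall>j<n. E j \<in> V) \<and> (\<forall>j<n. F j \<in> V) \<and>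
    (\<forall>i<n. \<forall>j<n. w (E i) (F j) = (if i = j then 1 else 0)) \<and>
    (\<forall>i<n. \<forall>j<n. w (E i) (E j) = 0) \<and> (\<forall>i<n. \<forall>j<n. w (F i) (F j) = 0) \<and>
    (\<forall>v\<in>V. v = (\<Sum>j<n. w v (F j) *\<^sub>R E j + w (E j) v *\<^sub>R F j)))"
  have "\<exists>n E F. P V n E F"
    using V alt nondeg
  proof (induction "dim V" arbitrary: V rule: less_induct)
    case less
    note V = less.prems(1) and alt = less.prems(2) and nondeg = less.prems(3)
    note sub = subspace_0[OF V] subspace_add[OF V] subspace_mul[OF V] subspace_diff[OF V]
    show ?case
    proof (cases "V = {0}")
      case True
      thus ?thesis by (intro exI[of _ 0]) (auto simp: P_def)
    next
      case False
      then obtain e where e: "e \<in> V" "e \<noteq> 0" using sub(1) by blast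
      then obtain f0 where f0: "f0 \<in> V" "w e f0 \<noteq> 0" using nondeg by blast
      define f where "f = (1 / w e f0) *\<^sub>R f0"
      have f: "f \<in> V" "w e f = 1" using f0 sub by (auto simp: f_def form)
      have self: "w x x = 0" if "x \<in> V" for x using alt[OF that that] by simp
      define V' where "V' = {v \<in> V. w e v = 0 \<and> w v f = 0}"
      have V'sub: "V' \<subseteq> V" by (auto simp: V'_def)
      have V': "subspace V'"
        unfolding V'_def subspace_def using sub by (auto simp: form)
      have split: "v - w v f *\<^sub>R e - w e v *\<^sub>R f \<in> V'" if "v \<in> V" for v
        using that sub e f by (auto simp: V'_def form self)
      have "e \<notin> V'" using f by (simp add: V'_def)
      hence "V' \<subset> V" using V'sub e by blast
      hence dim: "dim V' < dim V" using V V' by (intro dim_psubset) (simp add: span_eq_iff[THEN iffD2])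
      have nondeg': "x = 0" if x: "x \<in> V'" and 0: "\<And>y. y \<in> V' \<Longrightarrow> w x y = 0" for x
      proof (rule nondeg)
        show "x \<in> V" using x V'sub by blast
        fix y assume y: "y \<in> V"
        have "w x e = 0" using x e alt[of x e] by (simp add: V'_def)
        thus "w x y = 0" using 0[OF split[OF y]] x by (simp add: form V'_def)
      qed
      have "\<exists>n E F. P V' n E F"
        by (rule less.hyps[OF dim V']) (use alt V'sub nondeg' in blast)+
      then obtain n E F where "P V' n E F" by blast
      hence EF: "\<And>j. j < n \<Longrightarrow> E j \<in> V'" "\<And>j. j < n \<Longrightarrow> F j \<in> V'"
        "\<And>i j. i < n \<Longrightarrow> j < n \<Longrightarrow> w (E i) (F j) = (if i = j then 1 else 0)"
        "\<And>i j. i < n \<Longrightarrow> j < n \<Longrightarrow> w (E i) (E j) = 0"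
        "\<And>i j. i < n \<Longrightarrow> j < n \<Longrightarrow> w (F i) (F j) = 0"
        "\<And>v. v \<in> V' \<Longrightarrow> v = (\<Sum>j<n. w v (F j) *\<^sub>R E j + w (E j) v *\<^sub>R F j)"
        unfolding P_def by blast+
      have EFe: "w (E j) f = 0" "w e (F j) = 0" "w e (E j) = 0" "w (F j) f = 0" "w (E j) e = 0" "w f (F j) = 0"
        "w f (E j) = 0" "w (F j) e = 0"
        if "j < n" for j
        using EF(1,2)[OF that] alt[of "E j" e] alt[of "F j" e] alt[of f "F j"] alt[of f "E j"] e f by (auto simp: V'_def)
      have dec: "v = (\<Sum>j<Suc n. w v ((F(n := f)) j) *\<^sub>R (E(n := e)) j + w ((E(n := e)) j) v *\<^sub>R (F(n := f)) j)"
        if v: "v \<in> V" for v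
      proof -
        let ?v = "v - w v f *\<^sub>R e - w e v *\<^sub>R f"
        have "?v = (\<Sum>j<n. w ?v (F j) *\<^sub>R E j + w (E j) ?v *\<^sub>R F j)" by (rule EF(6)[OF split[OF v]])
        also have "\<dots> = (\<Sum>j<n. w v (F j) *\<^sub>R E j + w (E j) v *\<^sub>R F j)"
          by (rule sum.cong) (auto simp: form EFe)
        finally have "v = (\<Sum>j<n. w v (F j) *\<^sub>R E j + w (E j) v *\<^sub>R F j) + (w v f *\<^sub>R e + w e v *\<^sub>R f)"
          by (simp add: algebra_simps)
        thus ?thesis by simp
      qed
      have "P V (Suc n) (E(n := e)) (F(n := f))"
        unfolding P_def
      proof (intro conjI ballI)
        show "v = (\<Sum>j<Suc n. w v ((F(n := f)) j) *\<^sub>R (E(n := e)) j + w ((E(n := e)) j) v *\<^sub>R (F(n := f)) j)"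
          if "v \<in> V" for v by (rule dec[OF that])
      qed (use EF(1-5) V'sub e f self EFe in \<open>auto simp: less_Suc_eq\<close>)
      thus ?thesis by blast
    qed
  qed
  then obtain n E F where "P V n E F" by blast
  thus thesis unfolding P_def by (intro that[of n E F]) blast+
qed

lemma orthonormal_basis_of_form:
  fixes V :: "'v::euclidean_space set"
  assumes V: "subspace V" and bil: "bilinear b"
    and sym: "\<And>x y. x \<in> V \<Longrightarrow> y \<in> V \<Longrightarrow> b x y = (b y x :: real)"
    and pos: "\<And>x. x \<in> V \<Longrightarrow> x \<noteq> 0 \<Longrightarrow> b x x > 0"
  obtains m :: nat and u where "\<And>j. j < m \<Longrightarrow> u j \<in> V"
    "\<And>i j. i < m \<Longrightarrow> j < m \<Longrightarrow> b (u i) (u j) = (if i = j then 1 else 0)"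
    "\<And>v. v \<in> V \<Longrightarrow> v = (\<Sum>j<m. b v (u j) *\<^sub>R u j)"
proof -
  note form = bilinear_ladd[OF bil] bilinear_radd[OF bil] bilinear_lmul[OF bil] bilinear_rmul[OF bil]
    bilinear_lsub[OF bil] bilinear_rsub[OF bil] bilinear_lzero[OF bil] bilinear_rzero[OF bil]
  define P where "P = (\<lambda>V (m :: nat) u. (\<forall>j<m. u j \<in> V) \<and>
    (\<forall>i<m. \<forall>j<m. b (u i) (u j) = (if i = j then 1 else 0)) \<and>
    (\<forall>v\<in>V. v = (\<Sum>j<m. b v (u j) *\<^sub>R u j)))"
  have "\<exists>m u. P V m u"
    using V sym pos
  proof (induction "dim V" arbitrary: V rule: less_induct)
    case less
    note V = less.prems(1) and sym = less.prems(2) and pos = less.prems(3)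
    note sub = subspace_0[OF V] subspace_add[OF V] subspace_mul[OF V] subspace_diff[OF V]
    show ?case
    proof (cases "V = {0}")
      case True
      thus ?thesis by (intro exI[of _ 0]) (auto simp: P_def)
    next
      case False
      then obtain e0 where e0: "e0 \<in> V" "e0 \<noteq> 0" using sub(1) by blast
      define e where "e = (1 / sqrt (b e0 e0)) *\<^sub>R e0"
      have e: "e \<in> V" "b e e = 1" using e0 sub pos[OF e0] by (auto simp: e_def form)
      define V' where "V' = {v \<in> V. b v e = 0}"
      have V'sub: "V' \<subseteq> V" by (auto simp: V'_def)
      have V': "subspace V'" unfolding V'_def subspace_def using sub by (auto simp: form)
      have split: "v - b v e *\<^sub>R e \<in> V'" if "v \<in> V" for v
        using that sub e by (auto simp: V'_def form)
      have "e \<notin> V'" using e by (simp add: V'_def)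
      hence "V' \<subset> V" using V'sub e by blast
      hence dim: "dim V' < dim V" using V V' by (intro dim_psubset) (simp add: span_eq_iff[THEN iffD2])
      have "\<exists>m u. P V' m u"
        by (rule less.hyps[OF dim V']) (use sym pos V'sub in blast)+
      then obtain m u where "P V' m u" by blast
      hence u: "\<And>j. j < m \<Longrightarrow> u j \<in> V'"
        "\<And>i j. i < m \<Longrightarrow> j < m \<Longrightarrow> b (u i) (u j) = (if i = j then 1 else 0)"
        "\<And>v. v \<in> V' \<Longrightarrow> v = (\<Sum>j<m. b v (u j) *\<^sub>R u j)"
        unfolding P_def by blast+
      have ue: "b (u j) e = 0" "b e (u j) = 0" if "j < m" for j
        using u(1)[OF that] sym[of e "u j"] e by (auto simp: V'_def)
      have dec: "v = (\<Sum>j<Suc m. b v ((u(m := e)) j) *\<^sub>R (u(m := e)) j)" if v: "v \<in> V" for v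
      proof -
        let ?v = "v - b v e *\<^sub>R e"
        have "?v = (\<Sum>j<m. b ?v (u j) *\<^sub>R u j)" by (rule u(3)[OF split[OF v]])
        also have "\<dots> = (\<Sum>j<m. b v (u j) *\<^sub>R u j)" by (rule sum.cong) (auto simp: form ue)
        finally have "v = (\<Sum>j<m. b v (u j) *\<^sub>R u j) + b v e *\<^sub>R e" by (simp add: algebra_simps)
        thus ?thesis by simp
      qed
      have "P V (Suc m) (u(m := e))"
        unfolding P_def
      proof (intro conjI ballI)
        show "v = (\<Sum>j<Suc m. b v ((u(m := e)) j) *\<^sub>R (u(m := e)) j)" if "v \<in> V" for v by (rule dec[OF that])
      qed (use u(1,2) V'sub e ue in \<open>auto simp: less_Suc_eq\<close>)
      thus ?thesis by blast
    qed
  qed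
  then obtain m u where "P V m u" by blast
  thus thesis unfolding P_def by (intro that[of m u]) blast+
qed

text \<open>Continuity becomes differentiability by integration: \<open>f t\<close> times an
  integral of \<open>f\<close> is a difference of values of an antiderivative \<open>F\<close>. The
  equation \<open>f' = d f\<close> then gives an exponential, and modulus one makes \<open>d\<close>
  imaginary.\<close>

lemma unitary_character_real:
  fixes f :: "real \<Rightarrow> complex"
  assumes cont: "continuous_on UNIV f" and unit: "\<And>t. cmod (f t) = 1" and hom: "\<And>s t. f (s + t) = f s * f t"
  obtains a where "\<And>t. f t = cis (a * t)"
proof -
  have f0: "f 0 = 1"
  proof -
    have "f 0 * f 0 = f 0 * 1" using hom[of 0 0] by simp
    moreover have "f 0 \<noteq> 0" using unit[of 0] by auto
    ultimately show ?thesis by simp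
  qed
  \<comment> \<open>The interval is large enough that for \<open>t\<close> in (-1, 1) and
    \<open>s\<close> in [0, 1) the points \<open>t\<close>, \<open>s\<close> and
    \<open>t + s\<close> stay in its interior.\<close>
  obtain F where F: "\<And>x. x \<in> {-2..2} \<Longrightarrow> (F has_vector_derivative f x) (at x within {-2..2})"
    using antiderivative_continuous[of "-2" 2 f] continuous_on_subset[OF cont] by blast
  have Fat: "(F has_vector_derivative f x) (at x)" if "-2 < x" "x < 2" for x
    using F[of x] that at_within_interior[of x "{-2..2}"] by auto
  have affine_deriv: "((\<lambda>s. c + s) has_vector_derivative 1) (at x)" for c x :: real
    unfolding has_real_derivative_iff_has_vector_derivative[symmetric] by (auto intro!: derivative_eq_intros)
  have shift: "F (t + s) - f t * F s = F t - f t * F 0" if t: "-1 < t" "t < 1" and s: "0 \<le> s" "s < 1" for t s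
  proof -
    have "((\<lambda>s. F (t + s) - f t * F s) has_vector_derivative 0) (at x within {0..s})" if x: "x \<in> {0..s}" for x
    proof -
      have "((\<lambda>s. F (t + s)) has_vector_derivative f (t + x)) (at x)"
        using vector_diff_chain_at[OF affine_deriv[of t x] Fat[of "t + x"]] t s x by (simp add: o_def)
      moreover have "((\<lambda>s. f t * F s) has_vector_derivative f t * f x) (at x)"
        using Fat[of x] s x by (intro has_vector_derivative_mult_right) auto
      ultimately have "((\<lambda>s. F (t + s) - f t * F s) has_vector_derivative (f (t + x) - f t * f x)) (at x)"
        by (rule has_vector_derivative_diff)
      thus ?thesis by (simp add: hom has_vector_derivative_at_within)
    qed
    then obtain c where "\<And>x. x \<in> {0..s} \<Longrightarrow> F (t + x) - f t * F x = c"
      by (rule has_vector_derivative_zero_constant[of "{0..s}", rotated]) auto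
    from this[of s] this[of 0] s show ?thesis by simp
  qed
  \<comment> \<open>A nonzero integral to divide by: if \<open>F\<close> were constant to the right
    of 0, its derivative there would vanish, whereas \<open>f 0 = 1\<close>.\<close>
  have "\<exists>a. 0 \<le> a \<and> a < 1 \<and> F a \<noteq> F 0"
  proof (rule ccontr)
    assume "\<not> ?thesis"
    hence const: "F x = F 0" if "x \<in> {0..1/2}" for x
    proof -
      have "0 \<le> x \<and> x < 1" using that by simp
      thus ?thesis using \<open>\<not> (\<exists>a\<ge>0. a < 1 \<and> F a \<noteq> F 0)\<close> by blast
    qed
    have "(F has_vector_derivative f 0) (at 0 within {0..1/2})" using Fat[of 0] by (simp add: has_vector_derivative_at_within)
    moreover have "((\<lambda>_. F 0) has_vector_derivative 0) (at 0 within {0..1/2})" by simp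
    hence "(F has_vector_derivative 0) (at 0 within {0..1/2})"
      by (rule has_vector_derivative_transform[rotated 2]) (auto intro: const)
    ultimately have "f 0 = 0" by (intro vector_derivative_unique_within_closed_interval[of 0 "1/2" 0 F]) auto
    thus False using f0 by simp
  qed
  then obtain a where a: "0 \<le> a" "a < 1" "F a \<noteq> F 0" by blast
  define k where "k = F a - F 0"
  have k: "k \<noteq> 0" using a by (simp add: k_def)
  have fk: "f t = (F (t + a) - F t) / k" if "-1 < t" "t < 1" for t
    using shift[OF that a(1,2)] k by (simp add: field_simps k_def)
  define d where "d = (f a - f 0) / k"
  have "((\<lambda>t. (F (t + a) - F t) / k) has_vector_derivative d) (at 0)"
  proof -
    have "((\<lambda>s. F (s + a)) has_vector_derivative f (0 + a)) (at 0)"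
      using vector_diff_chain_at[OF affine_deriv[of a 0] Fat[of "a + 0"]] a by (simp add: o_def add.commute)
    thus ?thesis unfolding d_def divide_inverse using Fat[of 0]
      by (intro has_vector_derivative_mult_left has_vector_derivative_diff) auto
  qed
  hence "(f has_vector_derivative d) (at 0)"
    by (rule has_vector_derivative_transform_within_open[of _ _ _ "{-1<..<1}"]) (auto simp: fk)
  hence der: "(f has_vector_derivative d * f t) (at t)" for t
  proof -
    assume "(f has_vector_derivative d) (at 0)"
    hence "((\<lambda>s. f (s - t)) has_vector_derivative d) (at t)"
      using vector_diff_chain_at[OF affine_deriv[of "- t" t], of f d] by (simp add: o_def)
    hence "((\<lambda>s. f t * f (s - t)) has_vector_derivative f t * d) (at t)" by (rule has_vector_derivative_mult_right)
    thus ?thesis by (simp add: hom[symmetric] mult.commute)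
  qed
  have "((\<lambda>t. f t * exp (- (t *\<^sub>R d))) has_vector_derivative 0) (at t within UNIV)" for t
  proof -
    have "((\<lambda>t. exp (t *\<^sub>R (- d))) has_vector_derivative (exp (t *\<^sub>R (- d)) * - d)) (at t)"
      by (rule exp_scaleR_has_vector_derivative_right)
    from has_vector_derivative_mult[OF der[of t] this]
    show ?thesis by (simp add: mult_ac)
  qed
  then obtain c where c: "\<And>t. f t * exp (- (t *\<^sub>R d)) = c"
    by (rule has_vector_derivative_zero_constant[of UNIV, rotated]) auto
  have fexp: "f t = exp (t *\<^sub>R d)" for t
  proof -
    have "f t * exp (- (t *\<^sub>R d)) = 1" using c[of t] c[of 0] f0 by simp
    thus ?thesis by (simp add: exp_minus field_simps)
  qed
  have "Re d = 0" using unit[of 1] fexp[of 1] by simp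
  hence "f t = cis (Im d * t)" for t
    unfolding fexp by (simp add: exp_eq_polar mult.commute)
  thus thesis using that by blast
qed

section \<open>Representations in coordinates\<close>

text \<open>Coordinates in which \<open>lam\<close> times the symplectic form is twice the imaginary part of the
  standard Hermitian form: \<open>co j\<close> are complex coordinates and \<open>emb j\<close> the coordinate planes.\<close>

locale weyl_frame =
  fixes D :: "'v::euclidean_space hc_data" and chi :: "'v \<times> real \<Rightarrow> complex" and lam :: real
    and n :: nat and emb :: "nat \<Rightarrow> complex \<Rightarrow> 'v" and co :: "nat \<Rightarrow> 'v \<Rightarrow> complex"
  assumes hc: "heisenberg_clifford D"
    and chi: "\<And>t. chi (0, t) = cis (lam * t)"
    and emb_in: "\<And>j c. j < n \<Longrightarrow> emb j c \<in> hc_even D"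
    and emb_lin: "\<And>j. bounded_linear (emb j)"
    and co_lin: "\<And>j. bounded_linear (co j)"
    and co_emb: "\<And>i j c. i < n \<Longrightarrow> j < n \<Longrightarrow> co i (emb j c) = (if i = j then c else 0)"
    and expand: "\<And>v. v \<in> hc_even D \<Longrightarrow> v = (\<Sum>j<n. emb j (co j v))"
    and symp: "\<And>v w. v \<in> hc_even D \<Longrightarrow> w \<in> hc_even D \<Longrightarrow>
      lam * hc_form D v w = 2 * (\<Sum>j<n. Im (co j v * cnj (co j w)))"
begin

lemma hcD: "subspace (hc_even D)" "subspace (hc_odd D)" "hc_even D \<inter> hc_odd D = {0}" "bilinear (hc_form D)"
  "\<And>P Q. P \<in> hc_even D \<Longrightarrow> Q \<in> hc_odd D \<Longrightarrow> hc_form D P Q = 0"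
  "\<And>P Q. P \<in> hc_even D \<Longrightarrow> Q \<in> hc_odd D \<Longrightarrow> hc_form D Q P = 0"
  "\<And>P Q. P \<in> hc_odd D \<Longrightarrow> Q \<in> hc_odd D \<Longrightarrow> hc_form D P Q = hc_form D Q P"
  using hc unfolding heisenberg_clifford_def by blast+

lemmas sub_even = subspace_0[OF hcD(1)] subspace_add[OF hcD(1)] subspace_neg[OF hcD(1)] subspace_diff[OF hcD(1)]
  subspace_mul[OF hcD(1)] subspace_sum[OF hcD(1)]
lemmas hc_form_simps = bilinear_ladd[OF hcD(4)] bilinear_radd[OF hcD(4)] bilinear_lzero[OF hcD(4)]
  bilinear_rzero[OF hcD(4)] bilinear_lneg[OF hcD(4)] bilinear_rneg[OF hcD(4)] bilinear_lmul[OF hcD(4)] bilinear_rmul[OF hcD(4)]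
lemmas co_simps = linear_add[OF bounded_linear.linear[OF co_lin]] linear_diff[OF bounded_linear.linear[OF co_lin]]
  linear_0[OF bounded_linear.linear[OF co_lin]] linear_neg[OF bounded_linear.linear[OF co_lin]]
  linear_sum[OF bounded_linear.linear[OF co_lin]]
lemmas emb_simps = linear_add[OF bounded_linear.linear[OF emb_lin]] linear_0[OF bounded_linear.linear[OF emb_lin]]
  linear_neg[OF bounded_linear.linear[OF emb_lin]]

definition herm :: "'v \<Rightarrow> 'v \<Rightarrow> complex"
  where "herm v w = (\<Sum>j<n. co j v * cnj (co j w))"

definition qf :: "'v \<Rightarrow> real"
  where "qf v = (\<Sum>j<n. (cmod (co j v))\<^sup>2) / 2"

lemma herm_simps: "herm (- v) w = - herm v w" "herm v (- w) = - herm v w"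
  "herm (v + v') w = herm v w + herm v' w" "herm w (v + v') = herm w v + herm w v'"
  by (simp_all add: herm_def co_simps sum_negf ring_distribs sum.distrib)

lemma cnj_herm: "cnj (herm v w) = herm w v"
  by (simp add: herm_def mult.commute)

lemma qf_diff: "- qf (v - w) = Re (herm v w) - qf v - qf w"
proof -
  have "(cmod (a - b))\<^sup>2 = (cmod a)\<^sup>2 + (cmod b)\<^sup>2 - 2 * Re (a * cnj b)" for a b
    unfolding cmod_power2 by (simp add: power2_eq_square algebra_simps)
  thus ?thesis
    by (simp add: qf_def herm_def co_simps sum.distrib sum_subtractf sum_distrib_left[symmetric] add_divide_distrib diff_divide_distrib)
qed

lemma qf_emb: "j < n \<Longrightarrow> qf (emb j c) = (cmod c)\<^sup>2 / 2"
proof -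
  assume j: "j < n"
  have "(\<Sum>i<n. (cmod (co i (emb j c)))\<^sup>2) = (\<Sum>i<n. if i = j then (cmod c)\<^sup>2 else 0)"
    by (rule sum.cong) (use j in \<open>auto simp: co_emb\<close>)
  thus ?thesis using j by (simp add: qf_def)
qed

lemma herm_emb: "j < n \<Longrightarrow> herm (emb j c) w = c * cnj (co j w)"
proof -
  assume j: "j < n"
  have "(\<Sum>i<n. co i (emb j c) * cnj (co i w)) = (\<Sum>i<n. if i = j then c * cnj (co j w) else 0)"
    by (rule sum.cong) (use j in \<open>auto simp: co_emb\<close>)
  thus ?thesis using j by (simp add: herm_def)
qed

section \<open>Weyl operators and vacua of a representation\<close>

definition is_rep :: "('v, 'h::complex_hilbert) hc_rep \<Rightarrow> bool"
  where "is_rep R \<longleftrightarrow> unitary_rep D R \<and> has_central_character R chi"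

text \<open>The group elements with vanishing central coordinate; the central character reduces
  every group operator to one of these up to a phase.\<close>

definition wop :: "('v, 'h::complex_hilbert) hc_rep \<Rightarrow> 'v \<Rightarrow> 'h \<Rightarrow> 'h"
  where "wop R w = grp_op R (w, 0)"

lemma rep_space_props:
  fixes R :: "('v, 'h::complex_hilbert) hc_rep"
  assumes "graded_hilbert R"
  shows "closed (rep_space R)" "csubspace (rep_space R)" "even_part R \<subseteq> rep_space R" "odd_part R \<subseteq> rep_space R"
proof -
  have g: "csubspace (even_part R)" "closed (even_part R)" "csubspace (odd_part R)" "closed (odd_part R)"
    "\<And>x y. x \<in> even_part R \<Longrightarrow> y \<in> odd_part R \<Longrightarrow> cinner x y = 0"
    using assms by (auto simp: graded_hilbert_def)
  show "closed (rep_space R)" unfolding rep_space_def by (rule orthogonal_sum_closed) (use g in auto)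
  show "csubspace (rep_space R)" unfolding rep_space_def by (rule csubspace_sum) (use g in auto)
  show "even_part R \<subseteq> rep_space R" "odd_part R \<subseteq> rep_space R"
    unfolding rep_space_def using csubspaceD(2)[OF g(1)] csubspaceD(2)[OF g(3)] by force+
qed

context
  fixes R :: "('v, 'h::complex_hilbert) hc_rep"
  assumes R: "is_rep R"
begin

lemma graded: "graded_hilbert R" and group_rep: "even_unitary_group_rep D R" and unitary: "unitary_rep D R"
  using R by (auto simp: is_rep_def unitary_rep_def)

lemmas rep_closed = rep_space_props(1)[OF graded] and rep_csub = rep_space_props(2)[OF graded]
  and even_sub = rep_space_props(3)[OF graded] and odd_sub = rep_space_props(4)[OF graded]
lemmas rep_sub = csubspaceD[OF rep_csub]

lemma grp_facts:
  assumes "w \<in> hc_even D"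
  shows "clinear_on (rep_space R) (grp_op R (w, t))"
    "v \<in> even_part R \<Longrightarrow> grp_op R (w, t) v \<in> even_part R"
    "v \<in> odd_part R \<Longrightarrow> grp_op R (w, t) v \<in> odd_part R"
    "v \<in> rep_space R \<Longrightarrow> v' \<in> rep_space R \<Longrightarrow> cinner (grp_op R (w, t) v) (grp_op R (w, t) v') = cinner v v'"
  using group_rep assms unfolding even_unitary_group_rep_def hc_N0_def hc_n0_def by fast+

lemma grp_in: "w \<in> hc_even D \<Longrightarrow> v \<in> rep_space R \<Longrightarrow> grp_op R (w, t) v \<in> rep_space R"
proof -
  assume w: "w \<in> hc_even D" and "v \<in> rep_space R"
  then obtain x y where xy: "v = x + y" "x \<in> even_part R" "y \<in> odd_part R" by (auto simp: rep_space_def)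
  hence "grp_op R (w, t) v = grp_op R (w, t) x + grp_op R (w, t) y"
    using grp_facts(1)[OF w] even_sub odd_sub unfolding clinear_on_def by blast
  thus ?thesis using grp_facts(2,3)[OF w] xy unfolding rep_space_def by blast
qed

lemma grp_mult:
  assumes "w \<in> hc_even D" "w' \<in> hc_even D" "v \<in> rep_space R"
  shows "grp_op R (w, t) (grp_op R (w', t') v) = grp_op R (w + w', t + t' + hc_form D w w' / 2) v"
proof -
  have "grp_op R (hc_mult D (w, t) (w', t')) v = grp_op R (w, t) (grp_op R (w', t') v)"
    using group_rep assms unfolding even_unitary_group_rep_def hc_N0_def hc_n0_def by (auto simp: mem_Times_iff)
  thus ?thesis by (simp add: hc_mult_def hc_bracket_def)
qed

lemma grp_centre: "v \<in> rep_space R \<Longrightarrow> grp_op R (0, t) v = cis (lam * t) *\<^sub>C v"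
  using R chi unfolding is_rep_def has_central_character_def hc_centre_def hc_exp_def by auto

lemma grp_wop:
  assumes "w \<in> hc_even D" "v \<in> rep_space R"
  shows "grp_op R (w, t) v = cis (lam * t) *\<^sub>C wop R w v"
  using grp_mult[of 0 w v t 0] assms grp_centre[OF grp_in[OF assms]] by (simp add: sub_even hc_form_simps wop_def)

lemma wop_in: "w \<in> hc_even D \<Longrightarrow> v \<in> rep_space R \<Longrightarrow> wop R w v \<in> rep_space R"
  by (simp add: wop_def grp_in)

lemma wop_add: "w \<in> hc_even D \<Longrightarrow> v \<in> rep_space R \<Longrightarrow> v' \<in> rep_space R \<Longrightarrow> wop R w (v + v') = wop R w v + wop R w v'"
  and wop_scaleC: "w \<in> hc_even D \<Longrightarrow> v \<in> rep_space R \<Longrightarrow> wop R w (c *\<^sub>C v) = c *\<^sub>C wop R w v"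
  using grp_facts(1)[of w 0] by (auto simp: clinear_on_def wop_def)

lemma wop_inner:
  "w \<in> hc_even D \<Longrightarrow> v \<in> rep_space R \<Longrightarrow> v' \<in> rep_space R \<Longrightarrow> cinner (wop R w v) (wop R w v') = cinner v v'"
  by (simp add: wop_def grp_facts)

lemma wop_0: "v \<in> rep_space R \<Longrightarrow> wop R 0 v = v"
  using grp_centre[of v 0] by (simp add: wop_def)

lemma wop_wop:
  assumes "w \<in> hc_even D" "w' \<in> hc_even D" "v \<in> rep_space R"
  shows "wop R w (wop R w' v) = cis (Im (herm w w')) *\<^sub>C wop R (w + w') v"
proof -
  have "wop R w (wop R w' v) = grp_op R (w + w', hc_form D w w' / 2) v"
    using grp_mult[OF assms, of 0 0] by (simp add: wop_def)
  also have "\<dots> = cis (lam * hc_form D w w' / 2) *\<^sub>C wop R (w + w') v"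
    using assms by (simp add: grp_wop sub_even)
  also have "lam * hc_form D w w' / 2 = Im (herm w w')"
    using symp[OF assms(1,2)] by (simp add: herm_def)
  finally show ?thesis .
qed

lemma wop_inv: "w \<in> hc_even D \<Longrightarrow> v \<in> rep_space R \<Longrightarrow> wop R w (wop R (- w) v) = v"
proof -
  assume w: "w \<in> hc_even D" and v: "v \<in> rep_space R"
  have "Im (herm w w) = 0" using cnj_herm[of w w] by (metis cnj.sel(2) neg_equal_zero)
  thus ?thesis using w v by (simp add: wop_wop sub_even herm_simps wop_0)
qed

lemma wop_adjoint:
  assumes "w \<in> hc_even D" "v \<in> rep_space R" "v' \<in> rep_space R"
  shows "cinner (wop R w v) v' = cinner v (wop R (- w) v')"
  using wop_inner[of w v "wop R (- w) v'"] assms by (simp add: wop_inv wop_in sub_even)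

lemma wop_cont: "v \<in> rep_space R \<Longrightarrow> continuous_on (hc_even D) (\<lambda>w. wop R w v)"
proof -
  assume "v \<in> rep_space R"
  hence "continuous_on (hc_even D \<times> UNIV) (\<lambda>g. grp_op R g v)"
    using group_rep by (simp add: even_unitary_group_rep_def hc_N0_def hc_n0_def)
  thus ?thesis unfolding wop_def
    by (rule continuous_on_compose2) (auto intro!: continuous_intros)
qed

lemma mode: "j < n \<Longrightarrow> weyl_mode (rep_space R) (\<lambda>c. wop R (emb j c))"
proof
  assume j: "j < n"
  show "clinear_on (rep_space R) (wop R (emb j c))" for c
    using grp_facts(1)[OF emb_in[OF j]] by (simp add: wop_def)
  show "wop R (emb j c) (wop R (emb j d) v) = cis (Im (c * cnj d)) *\<^sub>C wop R (emb j (c + d)) v"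
    if "v \<in> rep_space R" for c d v
    using j that by (simp add: wop_wop emb_in herm_emb co_emb emb_simps)
  show "continuous_on UNIV (\<lambda>c. wop R (emb j c) v)" if "v \<in> rep_space R" for v
    by (rule continuous_on_compose2[OF wop_cont[OF that] linear_continuous_on[OF emb_lin]]) (use j emb_in in auto)
qed (use rep_closed rep_csub wop_in emb_in wop_inner wop_0 emb_simps in auto)

text \<open>Only diagonal coefficients are prescribed. By the Weyl relation they determine the Gram
  matrix of the whole orbit, see \<open>vac_kernel\<close>.\<close>

definition vac :: "'h \<Rightarrow> bool"
  where "vac x \<longleftrightarrow> x \<in> rep_space R \<and>
    (\<forall>w\<in>hc_even D. cinner (wop R w x) x = of_real (exp (- qf w)) * cinner x x)"

text \<open>The vacuum condition in a single mode. It is linear in the vector, and holding in all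
  modes it is equivalent to \<open>vac\<close>, by \<open>vac_holo\<close> and
  \<open>vac_if_holo\<close>.\<close>

definition holo :: "nat \<Rightarrow> 'h \<Rightarrow> bool"
  where "holo j = weyl_mode.hol_vec (rep_space R) (\<lambda>c. wop R (emb j c))"

lemma holo_in: "j < n \<Longrightarrow> holo j x \<Longrightarrow> x \<in> rep_space R"
  unfolding holo_def weyl_mode.hol_vec_def[OF mode] by blast

lemma vac_holo: "vac x \<Longrightarrow> j < n \<Longrightarrow> holo j x"
  unfolding holo_def
  by (rule weyl_mode.hol_vec_if_gram[OF mode]) (auto simp: vac_def emb_in qf_emb)

lemma wop_commute:
  assumes "w \<in> hc_even D" "w' \<in> hc_even D" "v \<in> rep_space R" "herm w w' = 0"
  shows "wop R w (wop R w' v) = wop R w' (wop R w v)"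
  using assms cnj_herm[of w w'] by (simp add: wop_wop add.commute)

text \<open>A Weyl operator without component in mode \<open>j\<close> commutes with those of mode
  \<open>j\<close> and can be moved onto the test vector.\<close>

lemma holo_wop:
  assumes j: "j < n" and w: "w \<in> hc_even D" "co j w = 0" and x: "holo j x"
  shows "holo j (wop R w x)"
  unfolding holo_def weyl_mode.hol_vec_def[OF mode[OF j]]
proof (intro conjI ballI allI)
  have xS: "x \<in> rep_space R" by (rule holo_in[OF j x])
  thus "wop R w x \<in> rep_space R" using w by (simp add: wop_in)
  fix u d assume u: "u \<in> rep_space R"
  have "cinner (wop R (emb j c) (wop R w x)) u = cinner (wop R (emb j c) x) (wop R (- w) u)" for c
    using w j u xS by (simp add: wop_commute[of "emb j c"] emb_in herm_emb wop_adjoint[of w] wop_in)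
  moreover have "wop R (- w) u \<in> rep_space R" using w u by (simp add: wop_in sub_even)
  ultimately show "(\<lambda>c. of_real (exp ((cmod c)\<^sup>2 / 2)) * cinner (wop R (emb j c) (wop R w x)) u) field_differentiable at d"
    using x unfolding holo_def weyl_mode.hol_vec_def[OF mode[OF j]] by simp
qed

lemma holo_pair:
  assumes x: "\<And>j. j < n \<Longrightarrow> holo j x" "x \<in> rep_space R" and y: "\<And>j. j < n \<Longrightarrow> holo j y" "y \<in> rep_space R"
    and w: "w \<in> hc_even D"
  shows "cinner (wop R w x) y = of_real (exp (- qf w)) * cinner x y"
proof -
  \<comment> \<open>\<open>W k\<close> is the part of \<open>w\<close> in the first \<open>k\<close>
    modes. The next coordinate plane is Hermitian-orthogonal to it, so adding a component there
    produces no phase, and \<open>holo_wop\<close> keeps the translated vector holomorphic in mode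
    \<open>k\<close>.\<close>
  define W where "W = (\<lambda>k. \<Sum>j<k. emb j (co j w))"
  have W_in: "W k \<in> hc_even D" if "k \<le> n" for k
    unfolding W_def using that by (intro sub_even(6)) (auto intro: emb_in)
  have co_W: "co j (W k) = 0" if "k \<le> j" "j < n" for j k
    unfolding W_def co_simps using that by (intro sum.neutral) (auto simp: co_emb)
  have "cinner (wop R (W k) x) y = of_real (exp (- ((\<Sum>j<k. (cmod (co j w))\<^sup>2) / 2))) * cinner x y" if "k \<le> n" for k
    using that
  proof (induction k)
    case 0
    thus ?case using x by (simp add: W_def wop_0)
  next
    case (Suc k)
    hence k: "k < n" by simp
    have holk: "holo k (wop R (W k) x)" using k by (intro holo_wop W_in co_W x) auto
    have "wop R (emb k (co k w)) (wop R (W k) x) = wop R (W (Suc k)) x"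
      using k x W_in[of k] by (simp add: wop_wop emb_in herm_emb co_W) (simp add: W_def add.commute)
    hence "cinner (wop R (W (Suc k)) x) y = cinner (wop R (emb k (co k w)) (wop R (W k) x)) y" by simp
    also have "\<dots> = of_real (exp (- (cmod (co k w))\<^sup>2 / 2)) * cinner (wop R (W k) x) y"
      by (rule weyl_mode.hol_vec_pair[OF mode[OF k]]) (use holk y(1)[OF k] in \<open>simp_all add: holo_def\<close>)
    also have "\<dots> = of_real (exp (- (cmod (co k w))\<^sup>2 / 2)) * of_real (exp (- ((\<Sum>j<k. (cmod (co j w))\<^sup>2) / 2))) * cinner x y"
      using Suc by simp
    also have "of_real (exp (- (cmod (co k w))\<^sup>2 / 2)) * of_real (exp (- ((\<Sum>j<k. (cmod (co j w))\<^sup>2) / 2))) =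
        complex_of_real (exp (- ((\<Sum>j<Suc k. (cmod (co j w))\<^sup>2) / 2)))"
      unfolding of_real_mult[symmetric] exp_add[symmetric] by (simp add: add_divide_distrib add.commute)
    finally show ?case .
  qed
  from this[of n] show ?thesis using expand[OF w] by (simp add: W_def qf_def)
qed

lemma vac_if_holo: "(\<And>j. j < n \<Longrightarrow> holo j x) \<Longrightarrow> x \<in> rep_space R \<Longrightarrow> vac x"
  unfolding vac_def using holo_pair[of x x] by blast

lemma vac_pair: "vac x \<Longrightarrow> vac y \<Longrightarrow> w \<in> hc_even D \<Longrightarrow> cinner (wop R w x) y = of_real (exp (- qf w)) * cinner x y"
  using holo_pair[of x y w] vac_holo by (auto simp: vac_def)

text \<open>The defining condition is quadratic; the mixed terms are supplied by
  \<open>vac_pair\<close>, which rests on holomorphy.\<close>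

lemma vac_add: "vac x \<Longrightarrow> vac y \<Longrightarrow> vac (x + y)"
  using vac_pair[of x x] vac_pair[of x y] vac_pair[of y x] vac_pair[of y y] unfolding vac_def
  by (auto simp: rep_sub wop_add cinner_add_left cinner_add_right algebra_simps)

lemma vac_scaleC: "vac x \<Longrightarrow> vac (c *\<^sub>C x)"
  unfolding vac_def by (auto simp: rep_sub wop_scaleC cinner_scaleC_left cinner_scaleC_right algebra_simps)

lemma vac_kernel:
  assumes x: "vac x" and w: "w \<in> hc_even D" "w' \<in> hc_even D"
  shows "cinner (wop R w x) (wop R w' x) = exp (herm w w' - of_real (qf w) - of_real (qf w')) * cinner x x"
proof -
  have xS: "x \<in> rep_space R" using x by (simp add: vac_def)
  have "cinner (wop R w x) (wop R w' x) = cinner (wop R (- w') (wop R w x)) x"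
    using w xS by (simp add: wop_adjoint wop_in sub_even)
  also have "\<dots> = cis (Im (herm (- w') w)) * (of_real (exp (- qf (w - w'))) * cinner x x)"
    using x w xS by (simp add: wop_wop sub_even cinner_scaleC_left vac_def)
  also have "Im (herm (- w') w) = Im (herm w w')"
    using cnj_herm[of w w'] by (simp add: herm_simps) (metis cnj.sel(2) minus_minus)
  also have "- qf (w - w') = Re (herm w w') - qf w - qf w'" by (rule qf_diff)
  also have "cis (Im (herm w w')) * (of_real (exp (Re (herm w w') - qf w - qf w')) * cinner x x) =
      exp (herm w w' - of_real (qf w) - of_real (qf w')) * cinner x x"
    unfolding exp_eq_polar[of "herm w w' - _ - _"] by simp
  finally show ?thesis .
qed

text \<open>Averaging in mode \<open>k\<close> does not disturb holomorphy in mode \<open>j\<close>: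
  the average commutes with the Weyl operators of mode \<open>j\<close> and, being symmetric, moves
  to the test vector.\<close>

lemma holo_gauss_avg:
  assumes j: "j < n" and k: "k < n" "j \<noteq> k" and v: "holo j v"
    and avg: "weyl_mode.gauss_avg (rep_space R) (\<lambda>c. wop R (emb k c)) v x"
  shows "holo j x"
proof -
  interpret k: weyl_mode "rep_space R" "\<lambda>c. wop R (emb k c)" by (rule mode[OF k(1)])
  have vS: "v \<in> rep_space R" by (rule holo_in[OF j v])
  have xS: "x \<in> rep_space R" using avg by (simp add: k.gauss_avg_def)
  show ?thesis
    unfolding holo_def weyl_mode.hol_vec_def[OF mode[OF j]]
  proof (intro conjI ballI allI xS)
    fix u d assume u: "u \<in> rep_space R"
    obtain z where z: "z \<in> rep_space R" "k.gauss_avg u z"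
      by (rule k.gauss_avg_exists[OF rep_closed rep_csub subset_refl _ u]) (use k in \<open>auto simp: wop_in emb_in\<close>)
    have "cinner (wop R (emb j c) x) u = cinner (wop R (emb j c) v) z" for c
    proof (rule k.gauss_avg_adjoint[OF _ _ u z(2)])
      show "wop R (emb j c) v \<in> rep_space R" using vS j by (simp add: wop_in emb_in)
      show "k.gauss_avg (wop R (emb j c) v) (wop R (emb j c) x)"
        by (rule k.gauss_avg_commuting[OF vS avg, where B = "wop R (- emb j c)"])
          (use j k in \<open>auto simp: wop_in emb_in sub_even wop_adjoint herm_emb co_emb intro!: wop_commute\<close>)
    qed
    thus "(\<lambda>c. of_real (exp ((cmod c)\<^sup>2 / 2)) * cinner (wop R (emb j c) x) u) field_differentiable at d"
      using v z(1) unfolding holo_def weyl_mode.hol_vec_def[OF mode[OF j]] by simp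
  qed
qed

text \<open>The modes are averaged in turn. Each average creates holomorphy in its own mode,
  preserves it in the earlier ones and remains in \<open>K\<close>. A Weyl translation precedes the
  average because the average of the vector itself could be zero.\<close>

lemma vac_exists:
  assumes K: "closed K" "csubspace K" "K \<subseteq> rep_space R" "K \<noteq> {0}"
    and inv: "\<And>w v. w \<in> hc_even D \<Longrightarrow> v \<in> K \<Longrightarrow> wop R w v \<in> K"
  obtains x where "x \<in> K" "x \<noteq> 0" "vac x"
proof -
  have "\<exists>x\<in>K. x \<noteq> 0 \<and> (\<forall>j<k. holo j x)" if "k \<le> n" for k
    using that
  proof (induction k)
    case 0
    thus ?case using K csubspaceD(2)[OF K(2)] by auto
  next
    case (Suc k)
    hence k: "k < n" by simp
    interpret k: weyl_mode "rep_space R" "\<lambda>c. wop R (emb k c)" by (rule mode[OF k])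
    obtain x where x: "x \<in> K" "x \<noteq> 0" "\<And>j. j < k \<Longrightarrow> holo j x" using Suc by auto
    obtain w where w: "\<And>y. k.gauss_avg (wop R (emb k w) x) y \<Longrightarrow> y \<noteq> 0"
      by (rule k.gauss_avg_nonzero[of x]) (use x K in auto)
    have vK: "wop R (emb k w) x \<in> K" using k x by (intro inv emb_in)
    obtain y where y: "y \<in> K" "k.gauss_avg (wop R (emb k w) x) y"
      by (rule k.gauss_avg_exists[OF K(1-3) _ vK]) (use k inv emb_in in auto)
    have "holo j y" if "j < Suc k" for j
    proof (cases "j = k")
      case True
      thus ?thesis using k.hol_vec_gauss_avg[OF _ y(2)] vK K by (auto simp: holo_def)
    next
      case False
      hence j: "j < k" "j < n" using that k by auto
      have "holo j (wop R (emb k w) x)" using j k x(3) by (intro holo_wop) (auto simp: emb_in co_emb)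
      thus ?thesis using j k by (intro holo_gauss_avg[OF _ k _ _ y(2)]) auto
    qed
    thus ?case using y(1) w[OF y(2)] by blast
  qed
  from this[of n] obtain x where "x \<in> K" "x \<noteq> 0" "\<And>j. j < n \<Longrightarrow> holo j x" by auto
  thus thesis using that[of x] vac_if_holo[of x] K by blast
qed

end

end

lemma clinear_onD:
  assumes "clinear_on S f"
  shows "x \<in> S \<Longrightarrow> y \<in> S \<Longrightarrow> f (x + y) = f x + f y" "x \<in> S \<Longrightarrow> f (c *\<^sub>C x) = c *\<^sub>C f x"
  using assms by (auto simp: clinear_on_def)

context weyl_frame
begin

section \<open>Coherent states of all modes and smooth vectors\<close>

primrec coh :: "nat \<Rightarrow> 'v \<Rightarrow> ell2"
  where "coh 0 w = ell2_basis 0"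
  | "coh (Suc k) w = ell2_tensor (coh k w) (coherent (co k w))"

text \<open>The orbit map of the unit vacuum in the coherent state picture:
  \<open>exp (- qf w)\<close> normalises the coherent state and the central coordinate enters as a
  phase.\<close>

definition phi :: "'v \<times> real \<Rightarrow> ell2"
  where "phi g = exp (of_real (- qf (fst g)) + \<i> * of_real (lam * snd g)) *\<^sub>C coh n (fst g)"

lemma cinner_coh: "cinner (coh k w) (coh k w') = exp (\<Sum>j<k. co j w * cnj (co j w'))"
  by (induction k) (simp_all add: cinner_tensor cinner_coherent exp_add)

lemma cinner_phi:
  "cinner (phi (w, t)) (phi (w', t')) = cis (lam * (t - t')) * exp (herm w w' - of_real (qf w) - of_real (qf w'))"
proof -
  have exp_inner: "cinner (exp a *\<^sub>C x) (exp b *\<^sub>C y) = exp (a + cnj b) * cinner x y" for a b and x y :: ell2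
    by (simp add: cinner_scaleC_left cinner_scaleC_right exp_cnj exp_add)
  have "cinner (phi (w, t)) (phi (w', t')) = exp ((of_real (- qf w) + \<i> * of_real (lam * t)) +
      cnj (of_real (- qf w') + \<i> * of_real (lam * t')) + herm w w')"
    by (simp only: phi_def fst_conv snd_conv exp_inner cinner_coh herm_def exp_add[symmetric])
  also have "\<dots> = exp (\<i> * of_real (lam * (t - t')) + (herm w w' - of_real (qf w) - of_real (qf w')))"
    by (rule arg_cong[where f = exp]) (simp add: algebra_simps)
  finally show ?thesis by (simp add: exp_add cis_conv_exp)
qed

lemma bounded_linear_co_fst: "bounded_linear (\<lambda>g :: 'v \<times> real. co j (fst g))"
  by (rule bounded_linear_compose[OF co_lin bounded_linear_fst])

lemma Ck_on_coh: "Ck_on l S (\<lambda>g :: 'v \<times> real. coh k (fst g))"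
proof (induction k)
  case 0
  show ?case by (simp add: Ck_on_const)
next
  case (Suc k)
  have "Ck_on l S (\<lambda>g :: 'v \<times> real. coherent (co k (fst g) + 0))"
    by (rule Ck_on_affine[OF bounded_linear_co_fst _ _ Ck_on_coherent]) auto
  thus ?case using Ck_on_bilinear[OF bounded_bilinear_tensor Suc.IH] by simp
qed

lemma Ck_on_phi: "Ck_on l S phi"
proof -
  have sum: "Ck_on l S (\<lambda>g. \<Sum>j<k. co j (fst g) * cnj (co j (fst g)))" for k
  proof (induction k)
    case (Suc k)
    have "Ck_on l S (\<lambda>g. co k (fst g) * cnj (co k (fst g)))"
      by (intro Ck_on_bilinear[OF bounded_bilinear_mult] Ck_on_bounded_linear bounded_linear_co_fst
          Ck_on_bounded_linear_comp[OF bounded_linear_cnj])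
    thus ?case using Ck_on_add[OF Suc] by simp
  qed (simp add: Ck_on_const)
  have q: "complex_of_real (- qf w) = (- 1 / 2) * (\<Sum>j<n. co j w * cnj (co j w))" for w
    unfolding qf_def complex_norm_square[symmetric] by simp
  have "bounded_linear (\<lambda>g :: 'v \<times> real. lam * snd g)"
    by (rule bounded_linear_compose[OF bounded_linear_mult_right bounded_linear_snd])
  hence "bounded_linear (\<lambda>g :: 'v \<times> real. complex_of_real (lam * snd g))"
    by (rule bounded_linear_compose[OF bounded_linear_of_real])
  hence "Ck_on l S (\<lambda>g :: 'v \<times> real. \<i> * complex_of_real (lam * snd g))"
    by (intro Ck_on_bounded_linear_comp[OF bounded_linear_mult_right] Ck_on_bounded_linear)
  moreover have "Ck_on l S (\<lambda>g :: 'v \<times> real. complex_of_real (- qf (fst g)))"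
    unfolding q by (rule Ck_on_bounded_linear_comp[OF bounded_linear_mult_right sum])
  ultimately have "Ck_on l S (\<lambda>g. exp (complex_of_real (- qf (fst g)) + \<i> * complex_of_real (lam * snd g)))"
    by (intro Ck_on_exp Ck_on_add)
  from Ck_on_bilinear[OF bounded_bilinear_scaleC this Ck_on_coh] show ?thesis by (simp add: phi_def[abs_def])
qed

lemma N0_iff: "g \<in> hc_N0 D \<longleftrightarrow> fst g \<in> hc_even D"
  by (simp add: hc_N0_def hc_n0_def mem_Times_iff)

text \<open>The hypothesis concerns one vector only, so that the lemma also serves the model before
  it is known to be a representation.\<close>

lemma inf_action_centre:
  fixes R :: "('v, 'h::complex_hilbert) hc_rep"
  assumes centre: "\<And>t. grp_op R (0, t) v = cis (lam * t) *\<^sub>C v"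
  shows "inf_action R (0, b) v = (\<i> * of_real (lam * b)) *\<^sub>C v"
proof -
  have "((\<lambda>t. cis (lam * b * t)) has_vector_derivative (\<i> * of_real (lam * b)) * exp (0 *\<^sub>R (\<i> * of_real (lam * b)))) (at 0)"
    using exp_scaleR_has_vector_derivative_left[of "\<i> * of_real (lam * b)" 0]
    by (simp add: cis_conv_exp scaleR_conv_of_real mult_ac)
  hence "((\<lambda>t. cis (lam * b * t) *\<^sub>C v) has_vector_derivative (\<i> * of_real (lam * b)) *\<^sub>C v) (at 0)"
    by (drule_tac bounded_linear.has_vector_derivative[OF bounded_bilinear.bounded_linear_left[OF bounded_bilinear_scaleC]]) simp
  moreover have "(\<lambda>t. grp_op R (hc_exp (t *\<^sub>R (0, b))) v) = (\<lambda>t. cis (lam * b * t) *\<^sub>C v)"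
    using centre by (simp add: hc_exp_def mult_ac)
  ultimately show ?thesis by (simp add: inf_action_def vector_derivative_at)
qed

section \<open>The odd operators\<close>

definition rho :: "('v, 'h::complex_hilbert) hc_rep \<Rightarrow> 'v \<Rightarrow> 'h \<Rightarrow> 'h"
  where "rho R X = odd_op R (X, 0)"

context
  fixes R :: "('v, 'h::complex_hilbert) hc_rep"
  assumes R: "is_rep R"
begin

lemma vac_in: "vac R x \<Longrightarrow> x \<in> rep_space R"
  using vac_def[OF R] by simp

lemma vac_grp_kernel:
  assumes x: "vac R x" and w: "w \<in> hc_even D" "w' \<in> hc_even D"
  shows "cinner (grp_op R (w, t) x) (grp_op R (w', t') x) = cinner (phi (w, t)) (phi (w', t')) * cinner x x"
  using w vac_in[OF x] vac_kernel[OF R x w]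
  by (simp add: grp_wop[OF R] cinner_phi cinner_scaleC_left cinner_scaleC_right cis_mult cis_cnj
      right_diff_distrib mult.assoc[symmetric])

text \<open>On the group the orbit map is the smooth map \<open>phi\<close> followed by a bounded
  linear map. This yields smooth vectors without smoothing by test functions.\<close>

lemma vac_smooth:
  assumes x: "vac R x"
  shows "x \<in> smooth_vectors D R"
proof -
  define f where "f = (\<lambda>g. of_real (norm x) *\<^sub>C phi g)"
  have gram: "cinner (f g) (f h) = cinner (grp_op R g x) (grp_op R h x)" if "g \<in> hc_N0 D" "h \<in> hc_N0 D" for g h
    using vac_grp_kernel[OF x, of "fst g" "fst h" "snd g" "snd h"] that
    by (simp add: N0_iff f_def cinner_scaleC_left cinner_scaleC_right cinner_self power2_eq_square)
  obtain T where T: "bounded_linear T" "\<And>g. g \<in> hc_N0 D \<Longrightarrow> T (f g) = grp_op R g x"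
    by (rule gram_isometry[of "hc_N0 D" f "\<lambda>g. grp_op R g x", OF gram]) auto
  have "Ck_on k (hc_N0 D) (\<lambda>g. grp_op R g x)" for k
    by (rule Ck_on_cong[OF T(2) Ck_on_bounded_linear_comp[OF T(1)]])
      (simp_all add: f_def Ck_on_bounded_linear_comp[OF bounded_linear_scaleC Ck_on_phi])
  thus ?thesis using vac_in[OF x] by (simp add: smooth_vectors_def smooth_on_def)
qed

lemma smooth_in: "v \<in> smooth_vectors D R \<Longrightarrow> v \<in> rep_space R"
  by (simp add: smooth_vectors_def)

lemma csubspace_smooth: "csubspace (smooth_vectors D R)"
proof (rule csubspaceI)
  note lin = clinear_onD[OF grp_facts(1)[OF R]] and sub = rep_sub[OF R]
  have cong: "(\<And>g. g \<in> hc_N0 D \<Longrightarrow> f g = grp_op R g v) \<Longrightarrow> (\<And>k. Ck_on k (hc_N0 D) f) \<Longrightarrow> v \<in> rep_space R \<Longrightarrow>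
     v \<in> smooth_vectors D R" for f v
    by (auto simp: smooth_vectors_def smooth_on_def intro: Ck_on_cong[of "hc_N0 D" f])
  have add: "grp_op R g x + grp_op R g y = grp_op R g (x + y)"
    and scale: "c *\<^sub>C grp_op R g x = grp_op R g (c *\<^sub>C x)"
    if "g \<in> hc_N0 D" "x \<in> rep_space R" "y \<in> rep_space R" for g x y c
    using that lin[of "fst g" _ _ "snd g"] lin(2)[of "fst g" x "snd g"] by (auto simp: N0_iff)
  show "x + y \<in> smooth_vectors D R" if "x \<in> smooth_vectors D R" "y \<in> smooth_vectors D R" for x y
    by (rule cong[of "\<lambda>g. grp_op R g x + grp_op R g y"])
      (use that add in \<open>auto simp: smooth_vectors_def smooth_on_def intro!: sub Ck_on_add\<close>)
  show *: "c *\<^sub>C x \<in> smooth_vectors D R" if "x \<in> smooth_vectors D R" for c x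
    by (rule cong[of "\<lambda>g. c *\<^sub>C grp_op R g x"])
      (use that scale in \<open>auto simp: smooth_vectors_def smooth_on_def intro!: sub Ck_on_bounded_linear_comp[OF bounded_linear_scaleC]\<close>)
  have "grp_op R g 0 = 0" if "g \<in> hc_N0 D" for g
    using scale[OF that sub(2) sub(2), of 0] by simp
  thus "0 \<in> smooth_vectors D R"
    by (intro cong[of "\<lambda>g. 0"]) (auto simp: Ck_on_const sub)
qed

lemmas smooth_sub = csubspaceD[OF csubspace_smooth]

text \<open>Smoothness is preserved because right multiplication is an affine map in exponential
  coordinates.\<close>

lemma smooth_grp:
  assumes w: "w \<in> hc_even D" and v: "v \<in> smooth_vectors D R"
  shows "grp_op R (w, t) v \<in> smooth_vectors D R"
proof -
  define L where "L = (\<lambda>g :: 'v \<times> real. g + (0, hc_form D (fst g) w / 2))"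
  have "linear L" unfolding L_def
    by (rule linearI) (auto simp: hc_form_simps add_divide_distrib algebra_simps)
  hence L: "bounded_linear L" by (simp add: linear_conv_bounded_linear)
  have "Ck_on k (hc_N0 D) (\<lambda>g. grp_op R g (grp_op R (w, t) v))" for k
  proof (rule Ck_on_cong)
    show "Ck_on k (hc_N0 D) (\<lambda>g. grp_op R (L g + (w, t)) v)"
      by (rule Ck_on_affine[OF L, of _ "hc_N0 D"])
        (use v w in \<open>auto simp: smooth_vectors_def smooth_on_def N0_iff L_def sub_even\<close>)
    show "grp_op R (L g + (w, t)) v = grp_op R g (grp_op R (w, t) v)" if "g \<in> hc_N0 D" for g
      using grp_mult[OF R, of "fst g" w v "snd g" t] that w smooth_in[OF v]
      by (cases g) (simp add: N0_iff L_def algebra_simps)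
  qed
  thus ?thesis using grp_in[OF R w smooth_in[OF v]] by (simp add: smooth_vectors_def smooth_on_def)
qed

lemma rho_smooth: "X \<in> hc_odd D \<Longrightarrow> v \<in> smooth_vectors D R \<Longrightarrow> rho R X v \<in> smooth_vectors D R"
  and rho_clinear: "X \<in> hc_odd D \<Longrightarrow> clinear_on (smooth_vectors D R) (rho R X)"
  and rho_add_left: "X \<in> hc_odd D \<Longrightarrow> Y \<in> hc_odd D \<Longrightarrow> v \<in> smooth_vectors D R \<Longrightarrow> rho R (X + Y) v = rho R X v + rho R Y v"
  and rho_scaleR_left: "X \<in> hc_odd D \<Longrightarrow> v \<in> smooth_vectors D R \<Longrightarrow> rho R (r *\<^sub>R X) v = r *\<^sub>R rho R X v"
  and rho_even: "X \<in> hc_odd D \<Longrightarrow> v \<in> smooth_vectors D R \<Longrightarrow> v \<in> even_part R \<Longrightarrow> rho R X v \<in> odd_part R"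
  and rho_odd: "X \<in> hc_odd D \<Longrightarrow> v \<in> smooth_vectors D R \<Longrightarrow> v \<in> odd_part R \<Longrightarrow> rho R X v \<in> even_part R"
  and rho_sym: "X \<in> hc_odd D \<Longrightarrow> v \<in> smooth_vectors D R \<Longrightarrow> v' \<in> smooth_vectors D R \<Longrightarrow>
    cinner (rho R X v) v' = cinner v (rho R X v')"
proof -
  have n1: "(X, 0) \<in> hc_n1 D" if "X \<in> hc_odd D" for X using that by (simp add: hc_n1_def)
  note u = unitary[OF R, unfolded unitary_rep_def, THEN conjunct2, THEN conjunct2]
  note u1 = u[THEN conjunct1, rule_format, OF n1] and u' = u[THEN conjunct2]
  note u2 = u'[THEN conjunct1, rule_format, OF n1 n1] and u'' = u'[THEN conjunct2]
  note u3 = u''[THEN conjunct1, rule_format, OF n1] and u''' = u''[THEN conjunct2]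
  note u4 = u'''[THEN conjunct1, rule_format, OF n1] and u5 = u'''[THEN conjunct2, THEN conjunct1, rule_format, OF n1]
  show "rho R X v \<in> smooth_vectors D R" if "X \<in> hc_odd D" "v \<in> smooth_vectors D R"
    using u1[OF that(1)] that(2) unfolding rho_def by blast
  show "clinear_on (smooth_vectors D R) (rho R X)" if "X \<in> hc_odd D"
    using u1[OF that] unfolding rho_def by blast
  show "rho R (X + Y) v = rho R X v + rho R Y v" if "X \<in> hc_odd D" "Y \<in> hc_odd D" "v \<in> smooth_vectors D R"
  proof -
    have "odd_op R ((X, 0) + (Y, 0)) v = odd_op R (X, 0) v + odd_op R (Y, 0) v"
      using u2[OF that] .
    thus ?thesis by (simp add: rho_def)
  qed
  show "rho R (r *\<^sub>R X) v = r *\<^sub>R rho R X v" if "X \<in> hc_odd D" "v \<in> smooth_vectors D R"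
  proof -
    have "odd_op R (r *\<^sub>R (X, 0)) v = r *\<^sub>R odd_op R (X, 0) v"
      using u3[OF that] .
    thus ?thesis by (simp add: rho_def)
  qed
  show "rho R X v \<in> odd_part R" if "X \<in> hc_odd D" "v \<in> smooth_vectors D R" "v \<in> even_part R"
    using u4[OF that(1)] that(2,3) unfolding rho_def by blast
  show "rho R X v \<in> even_part R" if "X \<in> hc_odd D" "v \<in> smooth_vectors D R" "v \<in> odd_part R"
    using u4[OF that(1)] that(2,3) unfolding rho_def by blast
  show "cinner (rho R X v) v' = cinner v (rho R X v')"
    if "X \<in> hc_odd D" "v \<in> smooth_vectors D R" "v' \<in> smooth_vectors D R"
    using u5[OF that] unfolding rho_def .
qed

lemmas rho_add = clinear_onD(1)[OF rho_clinear] and rho_scaleC = clinear_onD(2)[OF rho_clinear]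

text \<open>The bracket of two odd elements is central, where the infinitesimal action is the scalar
  given by the central character.\<close>

lemma rho_anticommute:
  assumes "X \<in> hc_odd D" "Y \<in> hc_odd D" "v \<in> smooth_vectors D R"
  shows "rho R X (rho R Y v) + rho R Y (rho R X v) = of_real (lam * hc_form D X Y) *\<^sub>C v"
proof -
  have "(X, 0) \<in> hc_n1 D" "(Y, 0) \<in> hc_n1 D" using assms by (auto simp: hc_n1_def)
  hence "rho R X (rho R Y v) + rho R Y (rho R X v) = (- \<i>) *\<^sub>C inf_action R (hc_bracket D (X, 0) (Y, 0)) v"
    using unitary[OF R, unfolded unitary_rep_def, THEN conjunct2, THEN conjunct2, THEN conjunct2, THEN conjunct2,
        THEN conjunct2, THEN conjunct2, THEN conjunct2, THEN conjunct1, rule_format, OF _ _ assms(3)]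
    unfolding rho_def by blast
  thus ?thesis using inf_action_centre[OF grp_centre[OF R smooth_in[OF assms(3)]]] by (simp add: hc_bracket_def scaleC_scaleC)
qed

text \<open>The form does not pair the even with the odd part, so the group acts trivially on the
  odd part and equivariance becomes commutation.\<close>

lemma rho_grp:
  assumes X: "X \<in> hc_odd D" and w: "w \<in> hc_even D" and v: "v \<in> smooth_vectors D R"
  shows "rho R X (grp_op R (w, t) v) = grp_op R (w, t) (rho R X v)"
proof -
  have n1: "(X, 0) \<in> hc_n1 D" and g: "(w, t) \<in> hc_N0 D" using X w by (auto simp: hc_n1_def N0_iff)
  have "odd_op R (hc_act D (w, t) (X, 0)) (grp_op R (w, t) v) =
      grp_op R (w, t) (odd_op R (X, 0) (grp_op R (hc_inv (w, t)) (grp_op R (w, t) v)))"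
    using unitary[OF R, unfolded unitary_rep_def, THEN conjunct2, THEN conjunct2, THEN conjunct2, THEN conjunct2,
        THEN conjunct2, THEN conjunct2, THEN conjunct2, THEN conjunct2, rule_format, OF g n1 smooth_grp[OF w v]] .
  moreover have "hc_act D (w, t) (X, 0) = (X, 0)" using hcD(5)[OF w X] by (simp add: hc_act_def hc_bracket_def)
  moreover have "hc_form D w w = 0"
    using hc w unfolding heisenberg_clifford_def by (metis add.inverse_inverse equal_neg_zero)
  hence "grp_op R (hc_inv (w, t)) (grp_op R (w, t) v) = v"
    using grp_mult[OF R _ w smooth_in[OF v], of "- w" "- t" t] w grp_centre[OF R smooth_in[OF v], of 0]
    by (simp add: hc_inv_def sub_even hc_form_simps)
  ultimately show ?thesis by (simp add: rho_def)
qed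

text \<open>Symmetry turns the scalar square into a norm identity. Both the boundedness of
  \<open>rho\<close> and the sign condition on the form come from it.\<close>

lemma rho_norm:
  assumes X: "X \<in> hc_odd D" and v: "v \<in> smooth_vectors D R"
  shows "(norm (rho R X v))\<^sup>2 = (lam * hc_form D X X / 2) * (norm v)\<^sup>2"
proof -
  have "2 * complex_of_real ((norm (rho R X v))\<^sup>2) = cinner (rho R X (rho R X v) + rho R X (rho R X v)) v"
    unfolding cinner_self[symmetric] using rho_sym[OF X rho_smooth[OF X v] v] by (simp add: cinner_add_left)
  also have "\<dots> = of_real ((lam * hc_form D X X) * (norm v)\<^sup>2)"
    unfolding rho_anticommute[OF X X v] by (simp add: cinner_scaleC_left cinner_self)
  finally have "complex_of_real (2 * (norm (rho R X v))\<^sup>2) = of_real ((lam * hc_form D X X) * (norm v)\<^sup>2)" by simp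
  hence "2 * (norm (rho R X v))\<^sup>2 = (lam * hc_form D X X) * (norm v)\<^sup>2" by (simp only: of_real_eq_iff)
  thus ?thesis by simp
qed

text \<open>The norm identity is evaluated at a vacuum, a nonzero vector known to be smooth.\<close>

lemma form_nonneg:
  assumes "rep_space R \<noteq> {0}" and X: "X \<in> hc_odd D"
  shows "lam * hc_form D X X \<ge> 0"
proof -
  obtain x where "x \<noteq> 0" "vac R x"
    by (rule vac_exists[OF R rep_closed[OF R] rep_csub[OF R] subset_refl assms(1)]) (auto intro: wop_in[OF R])
  hence "0 \<le> (lam * hc_form D X X / 2) * (norm x)\<^sup>2" "(norm x)\<^sup>2 > 0"
    by (simp_all only: rho_norm[OF X vac_smooth, symmetric]) auto
  thus ?thesis by (simp add: zero_le_mult_iff)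
qed

text \<open>\<open>rho\<close> commutes with the Weyl operators, is symmetric and has a scalar
  square, so it multiplies all diagonal coefficients by the same number.\<close>

lemma vac_rho:
  assumes x: "vac R x" and X: "X \<in> hc_odd D"
  shows "vac R (rho R X x)"
  unfolding vac_def[OF R]
proof (intro conjI ballI)
  have xs: "x \<in> smooth_vectors D R" by (rule vac_smooth[OF x])
  show "rho R X x \<in> rep_space R" by (intro smooth_in rho_smooth X xs)
  fix w assume w: "w \<in> hc_even D"
  have sq: "rho R X (rho R X x) = of_real (lam * hc_form D X X / 2) *\<^sub>C x"
  proof -
    have "rho R X (rho R X x) = (1 / 2) *\<^sub>C (rho R X (rho R X x) + rho R X (rho R X x))"
      by (simp add: scaleC_add_right scaleC_add_left[symmetric])
    thus ?thesis unfolding rho_anticommute[OF X X xs] by (simp add: scaleC_scaleC)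
  qed
  have "cinner (wop R w (rho R X x)) (rho R X x) = cinner (wop R w x) (rho R X (rho R X x))"
    using rho_grp[OF X w xs, of 0] rho_sym[OF X smooth_grp[OF w xs] rho_smooth[OF X xs], of 0] by (simp add: wop_def)
  also have "\<dots> = of_real (exp (- qf w)) * cinner x (rho R X (rho R X x))"
    using x w unfolding sq vac_def[OF R] by (simp add: cinner_scaleC_right)
  also have "cinner x (rho R X (rho R X x)) = cinner (rho R X x) (rho R X x)"
    using rho_sym[OF X xs rho_smooth[OF X xs]] by simp
  finally show "cinner (wop R w (rho R X x)) (rho R X x) = of_real (exp (- qf w)) * cinner (rho R X x) (rho R X x)" .
qed

end

end

section \<open>Clifford generators\<close>

definition toggle :: "'a \<Rightarrow> 'a set \<Rightarrow> 'a set"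
  where "toggle l A = (if l \<in> A then A - {l} else insert l A)"

text \<open>The sign from moving the Clifford generator \<open>l\<close> to its place in the increasing product over \<open>A\<close>.\<close>

definition order_sign :: "nat \<Rightarrow> nat set \<Rightarrow> complex"
  where "order_sign l A = (- 1) ^ card {i \<in> A. i < l}"

text \<open>The generators \<open>2 l\<close> and \<open>2 l + 1\<close> both toggle \<open>l\<close>; they differ by the eigenvalue of
  \<open>i u(2 l) u(2 l + 1)\<close>.\<close>

definition clifford_coeff :: "nat \<Rightarrow> nat set \<Rightarrow> complex"
  where "clifford_coeff i A =
    (if even i then 1 else if i div 2 \<in> A then \<i> else - \<i>) * order_sign (i div 2) A"

lemma sorted_list_of_set_insert_least:
  fixes a :: nat
  assumes "finite B" "\<And>b. b \<in> B \<Longrightarrow> a < b"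
  shows "sorted_list_of_set (insert a B) = a # sorted_list_of_set B"
proof -
  have "sorted_list_of_set (set (a # sorted_list_of_set B)) = a # sorted_list_of_set B"
    by (rule sorted_list_of_set.idem_if_sorted_distinct) (use assms in \<open>auto intro: less_imp_le\<close>)
  thus ?thesis using assms by simp
qed

text \<open>The value 2 is chosen so that the operators of the basis vectors have square one;
  \<open>lam / 2 * hc_form D X (u i)\<close> are then the coordinates of \<open>X\<close> in an
  orthonormal basis.\<close>

locale hc_frame = weyl_frame D chi lam n emb co
  for D :: "'v::euclidean_space hc_data" and chi lam n emb co +
  fixes m :: nat and u :: "nat \<Rightarrow> 'v"
  assumes u_in: "\<And>i. i < m \<Longrightarrow> u i \<in> hc_odd D"
    and u_orth: "\<And>i j. i < m \<Longrightarrow> j < m \<Longrightarrow> lam * hc_form D (u i) (u j) = (if i = j then 2 else 0)"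
    and u_expand: "\<And>X. X \<in> hc_odd D \<Longrightarrow> X = (\<Sum>i<m. (lam / 2 * hc_form D X (u i)) *\<^sub>R u i)"
begin

text \<open>A letter stands for a pair of generators with indices \<open>2 * l\<close> and
  \<open>2 * l + 1\<close>; for odd \<open>m\<close> the last letter has only the first of
  them.\<close>

definition letters :: "nat set"
  where "letters = {l. 2 * l < m}"

lemma finite_letters: "finite letters"
  unfolding letters_def by (rule finite_subset[of _ "{..<m}"]) auto

text \<open>The least letter is inserted last, as in the increasing product of generators, where it
  is applied last.\<close>

lemma letters_induct [consumes 1, case_names empty insert]:
  assumes "A \<subseteq> letters" "P {}"
    "\<And>a A. a \<in> letters \<Longrightarrow> A \<subseteq> letters \<Longrightarrow> (\<And>b. b \<in> A \<Longrightarrow> a < b) \<Longrightarrow> P A \<Longrightarrow> P (insert a A)"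
  shows "P A"
proof -
  have "finite A" using assms(1) finite_letters finite_subset by blast
  thus ?thesis using assms(1)
    by (induction A rule: finite_linorder_min_induct) (use assms(2,3) in auto)
qed

context
  fixes R :: "('v, 'h::complex_hilbert) hc_rep"
  assumes R: "is_rep R"
begin

abbreviation gen :: "nat \<Rightarrow> 'h \<Rightarrow> 'h"
  where "gen i \<equiv> rho R (u i)"

abbreviation smooth :: "'h set"
  where "smooth \<equiv> smooth_vectors D R"

lemmas gen_smooth = rho_smooth[OF R u_in]
lemmas gen_add = rho_add[OF R u_in] and gen_scaleC = rho_scaleC[OF R u_in]
lemmas smooth_sub' = smooth_sub[OF R]

section \<open>Clifford relations, chiralities and pure vacua\<close>

lemma gen_uminus: "i < m \<Longrightarrow> v \<in> smooth \<Longrightarrow> gen i (- v) = - gen i v"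
  using gen_scaleC[of i v "- 1"] by simp

lemma gen_gen: "i < m \<Longrightarrow> v \<in> smooth \<Longrightarrow> gen i (gen i v) = v"
proof -
  assume *: "i < m" "v \<in> smooth"
  have "gen i (gen i v) = (1 / 2) *\<^sub>C (gen i (gen i v) + gen i (gen i v))"
    by (simp add: scaleC_add_right scaleC_add_left[symmetric])
  thus ?thesis unfolding rho_anticommute[OF R u_in[OF *(1)] u_in[OF *(1)] *(2)]
    using * by (simp add: u_orth scaleC_scaleC)
qed

lemma gen_anticommute: "i < m \<Longrightarrow> j < m \<Longrightarrow> i \<noteq> j \<Longrightarrow> v \<in> smooth \<Longrightarrow> gen i (gen j v) = - gen j (gen i v)"
  using rho_anticommute[OF R u_in u_in, of i j v] by (simp add: u_orth add_eq_0_iff2)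

text \<open>The product of two anticommuting symmetric involutions is antisymmetric with square -1;
  the factor \<open>\<i>\<close> makes it a symmetric involution.\<close>

definition chirality :: "nat \<Rightarrow> 'h \<Rightarrow> 'h"
  where "chirality l v = \<i> *\<^sub>C gen (2 * l) (gen (Suc (2 * l)) v)"

lemma chirality_add: "Suc (2 * l) < m \<Longrightarrow> v \<in> smooth \<Longrightarrow> v' \<in> smooth \<Longrightarrow> chirality l (v + v') = chirality l v + chirality l v'"
  by (simp add: chirality_def gen_add gen_smooth scaleC_add_right)

lemma chirality_scaleC: "Suc (2 * l) < m \<Longrightarrow> v \<in> smooth \<Longrightarrow> chirality l (c *\<^sub>C v) = c *\<^sub>C chirality l v"
  by (simp add: chirality_def gen_scaleC gen_smooth scaleC_scaleC mult.commute)

lemma chirality_gen: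
  assumes "Suc (2 * l) < m" "i < m" "v \<in> smooth"
  shows "chirality l (gen i v) = (if i div 2 = l then - gen i (chirality l v) else gen i (chirality l v))"
proof (cases "i div 2 = l")
  case False
  hence "i \<noteq> 2 * l" "i \<noteq> Suc (2 * l)" by auto
  thus ?thesis using assms False
    by (simp add: chirality_def gen_anticommute[of "Suc (2 * l)" i] gen_anticommute[of "2 * l" i] gen_smooth gen_uminus
        gen_scaleC smooth_sub')
next
  case True
  hence "i = 2 * l \<or> i = Suc (2 * l)" by linarith
  thus ?thesis
  proof
    assume i: "i = 2 * l"
    have "gen (2 * l) (gen (Suc (2 * l)) (gen (2 * l) v)) = - gen (2 * l) (gen (2 * l) (gen (Suc (2 * l)) v))"
      using assms by (simp add: gen_anticommute[of "Suc (2 * l)" "2 * l" v] gen_smooth gen_uminus)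
    thus ?thesis using assms True unfolding i by (simp add: chirality_def gen_scaleC gen_smooth)
  next
    assume i: "i = Suc (2 * l)"
    have "gen (Suc (2 * l)) (gen (2 * l) (gen (Suc (2 * l)) v)) = - gen (2 * l) (gen (Suc (2 * l)) (gen (Suc (2 * l)) v))"
      using assms by (simp add: gen_anticommute[of "Suc (2 * l)" "2 * l" "gen (Suc (2 * l)) v"] gen_smooth)
    thus ?thesis using assms True unfolding i by (simp add: chirality_def gen_scaleC gen_smooth)
  qed
qed

lemma chirality_chirality: "Suc (2 * l) < m \<Longrightarrow> v \<in> smooth \<Longrightarrow> chirality l (chirality l v) = v"
proof -
  assume *: "Suc (2 * l) < m" "v \<in> smooth"
  let ?a = "gen (2 * l)" and ?b = "gen (Suc (2 * l))"
  have "chirality l (chirality l v) = - ?a (?b (?a (?b v)))"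
    using * by (simp add: chirality_def gen_scaleC gen_smooth scaleC_scaleC)
  also have "?b (?a (?b v)) = - ?a (?b (?b v))"
    using * by (simp add: gen_anticommute[of "Suc (2 * l)" "2 * l" "?b v"] gen_smooth)
  finally show ?thesis using * by (simp add: gen_gen gen_uminus gen_smooth)
qed

lemma chirality_sym:
  assumes "Suc (2 * l) < m" "v \<in> smooth" "v' \<in> smooth"
  shows "cinner (chirality l v) v' = cinner v (chirality l v')"
proof -
  have "cinner (chirality l v) v' = \<i> * cinner v (gen (Suc (2 * l)) (gen (2 * l) v'))"
    using assms by (simp add: chirality_def cinner_scaleC_left rho_sym[OF R u_in] gen_smooth)
  also have "gen (Suc (2 * l)) (gen (2 * l) v') = - gen (2 * l) (gen (Suc (2 * l)) v')"
    using assms by (intro gen_anticommute) auto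
  finally show ?thesis by (simp add: chirality_def cinner_scaleC_right)
qed

lemma chirality_grp:
  assumes "Suc (2 * l) < m" "w \<in> hc_even D" "v \<in> smooth"
  shows "chirality l (grp_op R (w, t) v) = grp_op R (w, t) (chirality l v)"
  using assms clinear_onD(2)[OF grp_facts(1)[OF R assms(2)]]
  by (simp add: chirality_def rho_grp[OF R u_in] gen_smooth smooth_in[OF R])

text \<open>The analogue of a lowest weight vector: a vacuum that is also a simultaneous eigenvector
  of the chiralities. Homogeneity takes over the role of a chirality for an unpaired
  generator.\<close>

definition pure_vac :: "'h \<Rightarrow> bool"
  where "pure_vac x \<longleftrightarrow> vac R x \<and> (x \<in> even_part R \<or> x \<in> odd_part R) \<and> (\<forall>l. Suc (2 * l) < m \<longrightarrow> chirality l x = x)"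

lemma gen_parity:
  assumes "i < m" "v \<in> smooth"
  shows "v \<in> even_part R \<Longrightarrow> gen i v \<in> odd_part R" "v \<in> odd_part R \<Longrightarrow> gen i v \<in> even_part R"
  using rho_even[OF R u_in] rho_odd[OF R u_in] assms by auto

lemma part_sub: "csubspace (even_part R)" "csubspace (odd_part R)" "closed (even_part R)" "closed (odd_part R)"
  "x \<in> even_part R \<Longrightarrow> y \<in> odd_part R \<Longrightarrow> cinner x y = 0"
  "y \<in> odd_part R \<Longrightarrow> x \<in> even_part R \<Longrightarrow> cinner y x = 0"
proof -
  note g = graded[OF R, unfolded graded_hilbert_def]
  show "csubspace (even_part R)" "csubspace (odd_part R)" "closed (even_part R)" "closed (odd_part R)" using g by blast+
  show o: "cinner x y = 0" if "x \<in> even_part R" "y \<in> odd_part R" for x y using g that by blast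
  show "cinner y x = 0" if "y \<in> odd_part R" "x \<in> even_part R"
    using o[OF that(2,1)] cinner_commute[of y x] by simp
qed

text \<open>Each chirality is a symmetric involution commuting with the Weyl operators: either its projection
  \<open>x + chirality k x\<close> onto the eigenvalue 1 is nonzero, or a generator flips the eigenvalue from -1 to 1.\<close>

lemma pure_vac_exists:
  assumes K: "graded_invariant_subspace D R K" "closed K" "K \<subseteq> rep_space R" "K \<noteq> {0}"
  obtains x where "x \<in> K" "x \<noteq> 0" "pure_vac x"
proof -
  have Ks: "csubspace K" and Ksplit: "K = {x + y | x y. x \<in> K \<inter> even_part R \<and> y \<in> K \<inter> odd_part R}"
    and Kgrp: "\<And>g. g \<in> hc_N0 D \<Longrightarrow> grp_op R g ` K \<subseteq> K"
    and Kodd: "\<And>X. X \<in> hc_n1 D \<Longrightarrow> odd_op R X ` (K \<inter> smooth) \<subseteq> K"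
    using K(1) unfolding graded_invariant_subspace_def by blast+
  note sK = csubspaceD[OF Ks]
  have Kgen: "gen i v \<in> K" if "i < m" "v \<in> K" "v \<in> smooth" for i v
    using Kodd[of "(u i, 0)"] u_in[OF that(1)] that by (auto simp: hc_n1_def rho_def)
  \<comment> \<open>Since \<open>K\<close> is graded, it meets the even or the odd part
    nontrivially, and that intersection is itself closed and invariant under the Weyl
    operators.\<close>
  have start: "\<exists>x\<in>K. x \<noteq> 0 \<and> vac R x \<and> (x \<in> even_part R \<or> x \<in> odd_part R)"
  proof -
    have ex: "\<exists>x\<in>K. x \<noteq> 0 \<and> vac R x \<and> x \<in> P"
      if P: "closed P" "csubspace P" "K \<inter> P \<noteq> {0}" and inv: "\<And>w v. w \<in> hc_even D \<Longrightarrow> v \<in> P \<Longrightarrow> wop R w v \<in> P" for P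
    proof -
      have inv': "wop R w v \<in> K \<inter> P" if "w \<in> hc_even D" "v \<in> K \<inter> P" for w v
        using Kgrp[of "(w, 0)"] inv that by (auto simp: wop_def N0_iff)
      obtain x where "x \<in> K \<inter> P" "x \<noteq> 0" "vac R x"
        by (rule vac_exists[OF R closed_Int[OF K(2) P(1)] csubspace_Int[OF Ks P(2)] _ P(3) inv']) (use K(3) in auto)
      thus ?thesis by blast
    qed
    have "K \<inter> even_part R \<noteq> {0} \<or> K \<inter> odd_part R \<noteq> {0}"
    proof (rule ccontr)
      assume "\<not> ?thesis"
      hence "K = {0}" by (subst Ksplit) auto
      thus False using K(4) by blast
    qed
    thus ?thesis
    proof
      assume "K \<inter> even_part R \<noteq> {0}"
      from ex[OF part_sub(3,1) this] show ?thesis using grp_facts(2)[OF R] by (auto simp: wop_def)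
    next
      assume "K \<inter> odd_part R \<noteq> {0}"
      from ex[OF part_sub(4,2) this] show ?thesis using grp_facts(3)[OF R] by (auto simp: wop_def)
    qed
  qed
  have "\<exists>x\<in>K. x \<noteq> 0 \<and> vac R x \<and> (x \<in> even_part R \<or> x \<in> odd_part R) \<and> (\<forall>l<k. Suc (2 * l) < m \<longrightarrow> chirality l x = x)" for k
  proof (induction k)
    case 0
    thus ?case using start by auto
  next
    case (Suc k)
    then obtain x where x: "x \<in> K" "x \<noteq> 0" "vac R x" "x \<in> even_part R \<or> x \<in> odd_part R"
      "\<And>l. l < k \<Longrightarrow> Suc (2 * l) < m \<Longrightarrow> chirality l x = x" by blast
    have xs: "x \<in> smooth" by (rule vac_smooth[OF R x(3)])
    show ?case
    proof (cases "Suc (2 * k) < m")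
      case False
      thus ?thesis using x by (intro bexI[of _ x]) (auto simp: less_Suc_eq)
    next
      case k: True
      have ck: "chirality k x \<in> K" "chirality k x \<in> smooth"
        using k x xs unfolding chirality_def by (auto intro!: sK(5) Kgen gen_smooth smooth_sub')
      have other: "chirality l (gen i y) = gen i (chirality l y)" if "l < k" "Suc (2 * l) < m" "i div 2 = k" "i < m" "y \<in> smooth" for l i y
        using chirality_gen[OF that(2,4,5)] that by auto
      show ?thesis
      proof (cases "x + chirality k x = 0")
        case False
        have "vac R (x + chirality k x)" unfolding chirality_def
          using k x by (intro vac_add[OF R] vac_scaleC[OF R] vac_rho[OF R] u_in) auto
        moreover have "x + chirality k x \<in> even_part R \<or> x + chirality k x \<in> odd_part R"
          using x(4)
        proof
          assume "x \<in> even_part R"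
          hence "chirality k x \<in> even_part R" unfolding chirality_def
            using k xs by (intro csubspaceD(5)[OF part_sub(1)] gen_parity gen_smooth) auto
          thus ?thesis using \<open>x \<in> even_part R\<close> csubspaceD(3)[OF part_sub(1)] by blast
        next
          assume "x \<in> odd_part R"
          hence "chirality k x \<in> odd_part R" unfolding chirality_def
            using k xs by (intro csubspaceD(5)[OF part_sub(2)] gen_parity gen_smooth) auto
          thus ?thesis using \<open>x \<in> odd_part R\<close> csubspaceD(3)[OF part_sub(2)] by blast
        qed
        moreover have "chirality l (x + chirality k x) = x + chirality k x" if l: "l < Suc k" "Suc (2 * l) < m" for l
        proof (cases "l = k")
          case True
          thus ?thesis using k xs ck by (simp add: chirality_add chirality_chirality add.commute)
        next
          case False
          hence lk: "l < k" using l by simp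
          have "chirality l (chirality k x) = chirality k (chirality l x)"
            unfolding chirality_def[of k] using other[OF lk l(2)] k xs l
            by (simp add: chirality_scaleC gen_smooth)
          thus ?thesis using l xs ck x(5)[OF lk l(2)] by (simp add: chirality_add)
        qed
        ultimately show ?thesis using False x ck by (intro bexI[of _ "x + chirality k x"]) (auto intro: sK)
      next
        case True
        hence neg: "chirality k x = - x" by (simp add: add_eq_0_iff)
        let ?y = "gen (2 * k) x"
        have "?y \<noteq> 0"
        proof
          assume "?y = 0"
          hence "gen (2 * k) ?y = 0" using gen_scaleC[of "2 * k" x 0] k xs by simp
          thus False using gen_gen[of "2 * k" x] k xs x(2) by simp
        qed
        moreover have "chirality l ?y = ?y" if l: "l < Suc k" "Suc (2 * l) < m" for l
        proof (cases "l = k")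
          case True
          thus ?thesis using chirality_gen[of k "2 * k" x] k xs neg by (simp add: gen_uminus)
        next
          case False
          thus ?thesis using other[of l "2 * k" x] l k xs x(5)[of l] by simp
        qed
        moreover have "vac R ?y" by (rule vac_rho[OF R x(3) u_in]) (use k in simp)
        ultimately show ?thesis using k x xs
          by (intro bexI[of _ ?y]) (auto intro: Kgen gen_parity)
      qed
    qed
  qed
  from this[of m] obtain x where "x \<in> K" "x \<noteq> 0" "vac R x" "x \<in> even_part R \<or> x \<in> odd_part R"
    "\<forall>l<m. Suc (2 * l) < m \<longrightarrow> chirality l x = x" by blast
  thus thesis using that[of x] by (auto simp: pure_vac_def)
qed

text \<open>Generators with even index suffice: those with odd index differ from them by a
  chirality, which acts on these vectors by a sign.\<close>

definition spinor :: "'h \<Rightarrow> nat set \<Rightarrow> 'h"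
  where "spinor x A = foldr (\<lambda>l. gen (2 * l)) (sorted_list_of_set A) x"

lemma spinor_empty [simp]: "spinor x {} = x"
  by (simp add: spinor_def)

lemma spinor_insert: "finite A \<Longrightarrow> (\<And>b. b \<in> A \<Longrightarrow> a < b) \<Longrightarrow> spinor x (insert a A) = gen (2 * a) (spinor x A)"
  unfolding spinor_def by (subst sorted_list_of_set_insert_least) auto

lemma spinor_vac: "vac R x \<Longrightarrow> A \<subseteq> letters \<Longrightarrow> vac R (spinor x A)"
proof -
  assume x: "vac R x" and A: "A \<subseteq> letters"
  show "vac R (spinor x A)"
    using A
  proof (induction A rule: letters_induct)
    case (insert a A)
    thus ?case using finite_subset[OF _ finite_letters]
      by (simp add: spinor_insert) (intro vac_rho[OF R] u_in, auto simp: letters_def)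
  qed (use x in simp)
qed

end

end

text \<open>\<open>F\<close> is compared with its composition with the projection onto
  \<open>K\<close>; both agree on \<open>B\<close>, hence on every vector of \<open>S\<close> in the
  closed span. Again \<open>S\<close> may fail to be closed.\<close>

lemma image_ccspan:
  fixes F :: "'a::complex_hilbert \<Rightarrow> 'b::complex_hilbert"
  assumes S: "csubspace S" "B \<subseteq> S"
    and F: "clinear_on S F" "\<And>x. x \<in> S \<Longrightarrow> norm (F x) \<le> C * norm x"
    and K: "closed K" "csubspace K" "\<And>b. b \<in> B \<Longrightarrow> F b \<in> K" and x: "x \<in> S" "x \<in> ccspan B"
  shows "F x \<in> K"
proof -
  obtain p where p: "bounded_linear p" "\<And>c x. p (c *\<^sub>C x) = c *\<^sub>C p x" "\<And>x. p x \<in> K" "\<And>x. x \<in> K \<Longrightarrow> p x = x"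
    by (rule orthogonal_projection[OF K(1,2)]) auto
  obtain M where M: "M \<ge> 0" "\<And>x. norm (p x) \<le> norm x * M" using bounded_linear.nonneg_bounded[OF p(1)] by blast
  have "F x = p (F x)"
  proof (rule eq_on_total[OF S F _ _ _ x, where C' = "C * M"])
    show "clinear_on S (\<lambda>x. p (F x))"
      using F(1) p(2) linear_add[OF bounded_linear.linear[OF p(1)]] by (auto simp: clinear_on_def)
    show "norm (p (F y)) \<le> C * M * norm y" if "y \<in> S" for y
      using order_trans[OF M(2) mult_right_mono[OF F(2)[OF that] M(1)]] by (simp add: mult_ac)
  qed (use K p in auto)
  thus ?thesis using p(3) by metis
qed

lemma toggle_simps: "toggle l {} = {l}" "l \<noteq> a \<Longrightarrow> toggle l (insert a A) = insert a (toggle l A)"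
  "a \<notin> A \<Longrightarrow> toggle a (insert a A) = A" "a \<notin> A \<Longrightarrow> toggle a A = insert a A"
  by (auto simp: toggle_def)

lemma toggle_subset: "l \<in> L \<Longrightarrow> A \<subseteq> L \<Longrightarrow> toggle l A \<subseteq> L"
  by (auto simp: toggle_def)

section \<open>Action of the generators on spinors and the total family\<close>

context hc_frame
begin

definition fam_index :: "(('v \<times> real) \<times> nat set) set"
  where "fam_index = hc_N0 D \<times> Pow letters"

lemma half_letters: "i < m \<Longrightarrow> i div 2 \<in> letters"
  by (auto simp: letters_def)

context
  fixes R :: "('v, 'h::complex_hilbert) hc_rep"
  assumes R: "is_rep R"
begin

lemma pure_vacD: "pure_vac R x \<Longrightarrow> vac R x" "pure_vac R x \<Longrightarrow> x \<in> even_part R \<or> x \<in> odd_part R"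
  "pure_vac R x \<Longrightarrow> Suc (2 * l) < m \<Longrightarrow> chirality R l x = x"
  by (auto simp: pure_vac_def[OF R])

lemma spinor_smooth: "vac R x \<Longrightarrow> A \<subseteq> letters \<Longrightarrow> spinor R x A \<in> smooth R"
  by (rule vac_smooth[OF R spinor_vac[OF R]])

lemma spinor_insert': "A \<subseteq> letters \<Longrightarrow> (\<And>b. b \<in> A \<Longrightarrow> a < b) \<Longrightarrow> spinor R x (insert a A) = gen R (2 * a) (spinor R x A)"
  using spinor_insert[OF R] finite_subset[OF _ finite_letters] by blast

lemma spinor_norm:
  assumes x: "vac R x" and A: "A \<subseteq> letters"
  shows "cinner (spinor R x A) (spinor R x A) = cinner x x"
  using A
proof (induction A rule: letters_induct)
  case empty
  show ?case by (simp add: spinor_empty[OF R])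
next
  case (insert a A)
  hence a: "2 * a < m" by (simp add: letters_def)
  have s: "spinor R x A \<in> smooth R" using insert by (intro spinor_smooth x)
  show ?case using insert a s
    by (simp add: spinor_insert' rho_sym[OF R u_in] gen_smooth[OF R] gen_gen[OF R])
qed

text \<open>Stripping the least letter \<open>a\<close> leaves three cases: a smaller generator is
  prepended, an equal one cancels, and a larger one anticommutes past \<open>a\<close>, contributing
  one of the signs counted by \<open>order_sign\<close>.\<close>

lemma gen_spinor_even:
  assumes x: "vac R x" and l: "l \<in> letters" and A: "A \<subseteq> letters"
  shows "gen R (2 * l) (spinor R x A) = order_sign l A *\<^sub>C spinor R x (toggle l A)"
  using A
proof (induction A rule: letters_induct)
  case empty
  show ?case using spinor_insert'[of "{}" l x] by (simp add: toggle_simps order_sign_def spinor_empty[OF R])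
next
  case (insert a A)
  have am: "2 * a < m" "2 * l < m" using insert l by (auto simp: letters_def)
  have s: "spinor R x A \<in> smooth R" using insert by (intro spinor_smooth x)
  have fin: "finite A" using finite_subset[OF insert(2) finite_letters] .
  consider "l < a" | "l = a" | "a < l" by linarith
  thus ?case
  proof cases
    case 1
    have lt: "l < b" if "b \<in> insert a A" for b using that 1 insert(3)[of b] by auto
    hence "{i \<in> insert a A. i < l} = {}" using less_asym by blast
    hence "order_sign l (insert a A) = 1" unfolding order_sign_def by (simp only: card.empty power_0)
    moreover have "l \<notin> insert a A" using lt by blast
    moreover have "insert a A \<subseteq> letters" using insert by auto
    ultimately show ?thesis using spinor_insert'[of "insert a A" l x] lt by (simp add: toggle_simps)
  next
    case 2
    have "{i \<in> insert a A. i < a} = {}" using insert(3) by force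
    hence "order_sign a (insert a A) = 1" unfolding order_sign_def by (simp only: card.empty power_0)
    moreover have "a \<notin> A" using insert(3) by blast
    moreover have "spinor R x (insert a A) = gen R (2 * a) (spinor R x A)"
      by (rule spinor_insert'[OF insert(2)]) (rule insert(3))
    hence "gen R (2 * a) (spinor R x (insert a A)) = spinor R x A" by (simp only: gen_gen[OF R am(1) s])
    ultimately show ?thesis unfolding 2 by (simp add: toggle_simps(3))
  next
    case 3
    have "a \<notin> A" using insert(3) by blast
    moreover have "{i \<in> insert a A. i < l} = insert a {i \<in> A. i < l}" using 3 by auto
    ultimately have sgn: "order_sign l (insert a A) = - order_sign l A" using fin by (simp add: order_sign_def)
    have tog: "toggle l A \<subseteq> letters" "\<And>b. b \<in> toggle l A \<Longrightarrow> a < b"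
      using insert l 3 by (auto simp: toggle_def split: if_splits)
    have "gen R (2 * l) (spinor R x (insert a A)) = - gen R (2 * a) (gen R (2 * l) (spinor R x A))"
      using insert am s 3 by (simp add: spinor_insert' gen_anticommute[OF R, of "2 * l" "2 * a"])
    also have "\<dots> = - (order_sign l A *\<^sub>C gen R (2 * a) (spinor R x (toggle l A)))"
      using insert am tog by (simp add: gen_scaleC[OF R] spinor_smooth x)
    finally show ?thesis using 3 tog by (simp add: sgn toggle_simps spinor_insert')
  qed
qed

text \<open>Among the factors of a spinor only the generator \<open>2 * l\<close> anticommutes with
  chirality \<open>l\<close>, and it is present exactly for \<open>l\<close> in
  \<open>A\<close>.\<close>

lemma chirality_spinor:
  assumes x: "pure_vac R x" and l: "Suc (2 * l) < m" and A: "A \<subseteq> letters"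
  shows "chirality R l (spinor R x A) = (if l \<in> A then - spinor R x A else spinor R x A)"
  using A
proof (induction A rule: letters_induct)
  case empty
  show ?case using x l by (simp add: spinor_empty[OF R] pure_vacD)
next
  case (insert a A)
  hence a: "2 * a < m" by (simp add: letters_def)
  have s: "spinor R x A \<in> smooth R" using insert by (intro spinor_smooth pure_vacD x)
  have "a \<notin> A" using insert(3) by blast
  thus ?case using insert a s chirality_gen[OF R l a s]
    by (auto simp: spinor_insert' gen_uminus[OF R])
qed

text \<open>The generator \<open>2 * l + 1\<close> equals \<open>- \<i>\<close> times the generator
  \<open>2 * l\<close> after chirality \<open>l\<close>, which reduces odd indices to even
  ones.\<close>

lemma gen_spinor:
  assumes x: "pure_vac R x" and i: "i < m" and A: "A \<subseteq> letters"
  shows "gen R i (spinor R x A) = clifford_coeff i A *\<^sub>C spinor R x (toggle (i div 2) A)"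
proof (cases "even i")
  case True
  then obtain l where "i = 2 * l" by blast
  thus ?thesis using gen_spinor_even[OF pure_vacD(1)[OF x] half_letters[OF i] A] by (simp add: clifford_coeff_def)
next
  case False
  then obtain l where l: "i = Suc (2 * l)" by (metis oddE Suc_eq_plus1)
  have lm: "Suc (2 * l) < m" "2 * l < m" using i l by auto
  have s: "spinor R x A \<in> smooth R" using A by (intro spinor_smooth pure_vacD x)
  have "gen R (2 * l) (chirality R l (spinor R x A)) = \<i> *\<^sub>C gen R i (spinor R x A)"
    using lm s by (simp add: chirality_def[OF R] gen_scaleC[OF R] gen_smooth[OF R] gen_gen[OF R] l)
  hence "gen R i (spinor R x A) = (- \<i>) *\<^sub>C gen R (2 * l) (chirality R l (spinor R x A))"
    by (simp add: scaleC_scaleC)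
  also have "\<dots> = ((if l \<in> A then \<i> else - \<i>)) *\<^sub>C gen R (2 * l) (spinor R x A)"
    using lm s by (simp add: chirality_spinor[OF x lm(1) A] gen_uminus[OF R])
  also have "\<dots> = clifford_coeff i A *\<^sub>C spinor R x (toggle (i div 2) A)"
    using gen_spinor_even[OF pure_vacD(1)[OF x] half_letters[OF i] A] l by (simp add: clifford_coeff_def scaleC_scaleC)
  finally show ?thesis .
qed

lemma spinor_parity:
  assumes x: "vac R x" and A: "A \<subseteq> letters"
  shows "(x \<in> even_part R \<longrightarrow> spinor R x A \<in> (if even (card A) then even_part R else odd_part R)) \<and>
    (x \<in> odd_part R \<longrightarrow> spinor R x A \<in> (if even (card A) then odd_part R else even_part R))"
  using A
proof (induction A rule: letters_induct)
  case (insert a A)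
  hence a: "2 * a < m" by (simp add: letters_def)
  have s: "spinor R x A \<in> smooth R" using insert by (intro spinor_smooth x)
  have "a \<notin> A" "finite A" using insert(3) finite_subset[OF insert(2) finite_letters] by blast+
  thus ?case using insert a s gen_parity[OF R a s] by (auto simp: spinor_insert')
qed (simp add: spinor_empty[OF R])

text \<open>Group elements commute with the generators, so both kinds of operators act on this
  family by moving its index, up to a scalar.\<close>

definition fam :: "'h \<Rightarrow> ('v \<times> real) \<times> nat set \<Rightarrow> 'h"
  where "fam x = (\<lambda>(g, A). grp_op R g (spinor R x A))"

lemma fam_smooth: "vac R x \<Longrightarrow> p \<in> fam_index \<Longrightarrow> fam x p \<in> smooth R"
  unfolding fam_def fam_index_def N0_iff
  by (cases p) (auto simp: N0_iff intro!: smooth_grp[OF R, of _ _ "snd (fst p)"] spinor_smooth intro: smooth_grp[OF R])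

lemma fam_part:
  assumes x: "pure_vac R x" and p: "p \<in> fam_index"
  shows "fam x p \<in> even_part R \<or> fam x p \<in> odd_part R"
proof -
  obtain w t A where p': "p = ((w, t), A)" "w \<in> hc_even D" "A \<subseteq> letters"
    using p by (cases p) (auto simp: fam_index_def N0_iff)
  have "spinor R x A \<in> even_part R \<or> spinor R x A \<in> odd_part R"
    using spinor_parity[OF pure_vacD(1)[OF x] p'(3)] pure_vacD(2)[OF x] by (auto split: if_splits)
  thus ?thesis using grp_facts(2,3)[OF R p'(2)] by (auto simp: fam_def p')
qed

text \<open>Spinors of different letter sets are separated by a chirality if they differ at a paired letter,
  and by the grading if they differ only at the unpaired last one.\<close>

lemma fam_gram:
  assumes x: "pure_vac R x" and p: "(g, A) \<in> fam_index" "(h, B) \<in> fam_index"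
  shows "cinner (fam x (g, A)) (fam x (h, B)) = (if A = B then cinner (phi g) (phi h) * cinner x x else 0)"
proof -
  obtain w t w' t' where g: "g = (w, t)" "h = (w', t')" by (meson surj_pair)
  have w: "w \<in> hc_even D" "w' \<in> hc_even D" and A: "A \<subseteq> letters" "B \<subseteq> letters"
    using p by (auto simp: fam_index_def N0_iff g)
  note vx = pure_vacD(1)[OF x]
  show ?thesis
  proof (cases "A = B")
    case True
    thus ?thesis
      using vac_grp_kernel[OF R spinor_vac[OF R vx A(1)] w, of t t'] by (simp add: fam_def g spinor_norm[OF vx A(2)])
  next
    case False
    have sA: "grp_op R (w, t) (spinor R x A) \<in> smooth R" and sB: "grp_op R (w', t') (spinor R x B) \<in> smooth R"
      using w A by (auto intro!: smooth_grp[OF R] spinor_smooth vx)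
    have "cinner (fam x (g, A)) (fam x (h, B)) = 0"
    proof (cases "\<exists>l. Suc (2 * l) < m \<and> (l \<in> A) \<noteq> (l \<in> B)")
      case True
      then obtain l where l: "Suc (2 * l) < m" "(l \<in> A) \<noteq> (l \<in> B)" by blast
      have ch: "chirality R l (grp_op R (v, s) (spinor R x C)) =
          (if l \<in> C then - grp_op R (v, s) (spinor R x C) else grp_op R (v, s) (spinor R x C))"
        if "v \<in> hc_even D" "C \<subseteq> letters" for v s C
        using chirality_grp[OF R l(1) that(1) spinor_smooth[OF vx that(2)], of s] chirality_spinor[OF x l(1) that(2)]
          clinear_onD(2)[OF grp_facts(1)[OF R that(1)] smooth_in[OF R spinor_smooth[OF vx that(2)]], of s "- 1"] by simp
      have "cinner (chirality R l (fam x (g, A))) (fam x (h, B)) = cinner (fam x (g, A)) (chirality R l (fam x (h, B)))"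
        unfolding fam_def g prod.case by (rule chirality_sym[OF R l(1) sA sB])
      thus ?thesis using l(2) ch[OF w(1) A(1)] ch[OF w(2) A(2)] unfolding fam_def g prod.case
        by (cases "l \<in> A") auto
    next
      case False
      hence agree: "l \<in> A \<longleftrightarrow> l \<in> B" if "Suc (2 * l) < m" for l using that by blast
      obtain l where l: "l \<in> letters" "(l \<in> A) \<noteq> (l \<in> B)" using \<open>A \<noteq> B\<close> A by blast
      have only: "i = l" if "i \<in> letters" "(i \<in> A) \<noteq> (i \<in> B)" for i
      proof -
        have "\<not> Suc (2 * i) < m" "\<not> Suc (2 * l) < m" "2 * i < m" "2 * l < m"
          using agree that l by (auto simp: letters_def)
        thus ?thesis by linarith
      qed
      have fin: "finite A" "finite B" using A finite_subset[OF _ finite_letters] by blast+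
      have "even (card A) \<noteq> even (card B)"
      proof (cases "l \<in> A")
        case True
        hence "A = insert l B" "l \<notin> B" using only A l(2) by blast+
        thus ?thesis using fin by simp
      next
        case False
        hence "B = insert l A" "l \<notin> A" using only A l(2) by blast+
        thus ?thesis using fin by simp
      qed
      hence "(spinor R x A \<in> even_part R \<and> spinor R x B \<in> odd_part R) \<or>
          (spinor R x A \<in> odd_part R \<and> spinor R x B \<in> even_part R)"
        using spinor_parity[OF vx A(1)] spinor_parity[OF vx A(2)] pure_vacD(2)[OF x] by (auto split: if_splits)
      thus ?thesis using grp_facts(2,3)[OF R] w part_sub(5,6)[OF R] unfolding fam_def g prod.case by blast
    qed
    thus ?thesis using False by simp
  qed
qed

lemma fam_grp:
  assumes x: "vac R x" and p: "(g, A) \<in> fam_index" and h: "h \<in> hc_N0 D"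
  shows "grp_op R h (fam x (g, A)) = fam x (hc_mult D h g, A)"
  using grp_mult[OF R, of "fst h" "fst g" "spinor R x A" "snd h" "snd g"] p h
    smooth_in[OF R spinor_smooth[OF x, of A]]
  by (cases g, cases h) (auto simp: fam_def fam_index_def N0_iff hc_mult_def hc_bracket_def)

lemma fam_gen:
  assumes x: "pure_vac R x" and p: "(g, A) \<in> fam_index" and i: "i < m"
  shows "gen R i (fam x (g, A)) = clifford_coeff i A *\<^sub>C fam x (g, toggle (i div 2) A)"
proof -
  obtain w t where g: "g = (w, t)" by (meson surj_pair)
  have w: "w \<in> hc_even D" and A: "A \<subseteq> letters" using p by (auto simp: fam_index_def N0_iff g)
  have A': "toggle (i div 2) A \<subseteq> letters" using half_letters[OF i] A by (rule toggle_subset)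
  note vx = pure_vacD(1)[OF x]
  show ?thesis
    using rho_grp[OF R u_in[OF i] w spinor_smooth[OF vx A], of t] gen_spinor[OF x i A]
      clinear_onD(2)[OF grp_facts(1)[OF R w] smooth_in[OF R spinor_smooth[OF vx A']]]
    by (simp add: fam_def g)
qed

lemma rho_expand:
  assumes X: "X \<in> hc_odd D" and v: "v \<in> smooth R"
  shows "rho R X v = (\<Sum>i<m. (lam / 2 * hc_form D X (u i)) *\<^sub>R gen R i v)"
proof -
  have "(\<Sum>i<k. c i *\<^sub>R u i) \<in> hc_odd D \<and> rho R (\<Sum>i<k. c i *\<^sub>R u i) v = (\<Sum>i<k. c i *\<^sub>R gen R i v)"
    if "k \<le> m" for k and c :: "nat \<Rightarrow> real"
    using that
  proof (induction k)
    case 0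
    thus ?case using rho_scaleR_left[OF R X v, of 0] subspace_0[OF hcD(2)] by simp
  next
    case (Suc k)
    hence "c k *\<^sub>R u k \<in> hc_odd D" using u_in subspace_mul[OF hcD(2)] by simp
    thus ?case using Suc v subspace_add[OF hcD(2)]
      by (simp add: rho_add_left[OF R] rho_scaleR_left[OF R u_in])
  qed
  from this[of m "\<lambda>i. lam / 2 * hc_form D X (u i)"] show ?thesis using u_expand[OF X] by simp
qed

lemma rho_bound:
  assumes X: "X \<in> hc_odd D" and v: "v \<in> smooth R"
  shows "norm (rho R X v) \<le> sqrt \<bar>lam * hc_form D X X / 2\<bar> * norm v"
proof -
  have "(norm (rho R X v))\<^sup>2 \<le> (sqrt \<bar>lam * hc_form D X X / 2\<bar> * norm v)\<^sup>2"
    unfolding rho_norm[OF R X v] by (simp add: power_mult_distrib mult_right_mono)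
  thus ?thesis by (rule power2_le_imp_le) simp
qed

lemma rho_fam_in:
  assumes x: "pure_vac R x" and p: "p \<in> fam_index" and X: "X \<in> hc_odd D"
  shows "rho R X (fam x p) \<in> ccspan (fam x ` fam_index)"
proof -
  obtain g A where p': "p = (g, A)" by fastforce
  have "gen R i (fam x p) \<in> ccspan (fam x ` fam_index)" if i: "i < m" for i
  proof -
    have "(g, toggle (i div 2) A) \<in> fam_index"
      using p toggle_subset[OF half_letters[OF i]] by (auto simp: p' fam_index_def)
    thus ?thesis using fam_gen[OF x p[unfolded p'] i] unfolding p'
      by (simp add: csubspaceD(5)[OF csubspace_ccspan] ccspan_base)
  qed
  thus ?thesis unfolding rho_expand[OF X fam_smooth[OF pure_vacD(1)[OF x] p]]
    by (intro subspace_sum[OF csubspaceD(1)[OF csubspace_ccspan]] csubspaceD(7)[OF csubspace_ccspan]) auto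
qed

lemma fam_span_sub: "vac R x \<Longrightarrow> ccspan (fam x ` fam_index) \<subseteq> rep_space R"
  by (rule ccspan_minimal) (auto intro: smooth_in[OF R] fam_smooth rep_csub[OF R] rep_closed[OF R])

lemma fam_span_split:
  assumes x: "pure_vac R x"
  shows "ccspan (fam x ` fam_index) = {v + w |v w. v \<in> ccspan (fam x ` fam_index) \<inter> even_part R \<and>
      w \<in> ccspan (fam x ` fam_index) \<inter> odd_part R}" (is "?K = ?S")
proof
  show "?S \<subseteq> ?K" using csubspaceD(3)[OF csubspace_ccspan] by blast
  have "csubspace ?S" by (intro csubspace_sum csubspace_Int csubspace_ccspan part_sub[OF R])
  moreover have "closed ?S"
    by (rule orthogonal_sum_closed) (auto intro: csubspace_Int csubspace_ccspan part_sub[OF R] closed_Int closed_ccspan)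
  moreover have "fam x ` fam_index \<subseteq> ?S"
  proof clarify
    fix g A assume p: "(g, A) \<in> fam_index"
    have "fam x (g, A) \<in> ?K" using p by (intro ccspan_base imageI)
    moreover have "0 \<in> ?K" "0 \<in> even_part R" "0 \<in> odd_part R"
      using csubspaceD(2) csubspace_ccspan part_sub(1,2)[OF R] by blast+
    ultimately show "\<exists>v w. fam x (g, A) = v + w \<and> v \<in> ?K \<inter> even_part R \<and> w \<in> ?K \<inter> odd_part R"
      using fam_part[OF x p] by (metis Int_iff add.left_neutral add.right_neutral)
  qed
  ultimately show "?K \<subseteq> ?S" by (intro ccspan_minimal)
qed

lemma norm_grp: "w \<in> hc_even D \<Longrightarrow> v \<in> rep_space R \<Longrightarrow> norm (grp_op R (w, t) v) = norm v"
  using grp_facts(4)[OF R, of w v v t] by (simp only: cinner_self_eq_iff_norm_eq[symmetric])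

text \<open>Group operators are isometric and odd operators are bounded on smooth vectors, so
  invariance need only be seen on the family itself.\<close>

lemma fam_span_invariant:
  assumes x: "pure_vac R x"
  shows "graded_invariant_subspace D R (ccspan (fam x ` fam_index))" (is "graded_invariant_subspace D R ?K")
  unfolding graded_invariant_subspace_def
proof (intro conjI ballI)
  note vx = pure_vacD(1)[OF x]
  show "csubspace ?K" by (rule csubspace_ccspan)
  show "?K = {v + w |v w. v \<in> ?K \<inter> even_part R \<and> w \<in> ?K \<inter> odd_part R}" by (rule fam_span_split[OF x])
  have sub: "fam x ` fam_index \<subseteq> rep_space R" "fam x ` fam_index \<subseteq> smooth R"
    using fam_smooth[OF vx] smooth_in[OF R] by auto
  show "grp_op R h ` ?K \<subseteq> ?K" if h: "h \<in> hc_N0 D" for h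
  proof
    fix v assume "v \<in> grp_op R h ` ?K"
    then obtain y where y: "y \<in> ?K" "v = grp_op R h y" by blast
    obtain w t where h': "h = (w, t)" "w \<in> hc_even D" using h by (cases h) (auto simp: N0_iff)
    show "v \<in> ?K" unfolding y(2)
    proof (rule image_ccspan[OF rep_csub[OF R] sub(1) _ _ closed_ccspan csubspace_ccspan _ _ y(1), where C = 1])
      show "clinear_on (rep_space R) (grp_op R h)" using grp_facts(1)[OF R h'(2)] h' by simp
      show "norm (grp_op R h z) \<le> 1 * norm z" if "z \<in> rep_space R" for z using norm_grp h' that by simp
      show "y \<in> rep_space R" using y fam_span_sub[OF vx] by blast
      fix b assume "b \<in> fam x ` fam_index"
      then obtain g A where b: "b = fam x (g, A)" "(g, A) \<in> fam_index" by auto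
      hence "(hc_mult D h g, A) \<in> fam_index"
        using h' by (auto simp: fam_index_def N0_iff hc_mult_def hc_bracket_def sub_even)
      thus "grp_op R h b \<in> ?K" unfolding b(1) fam_grp[OF vx b(2) h] by (intro ccspan_base imageI)
    qed
  qed
  show "odd_op R X ` (?K \<inter> smooth R) \<subseteq> ?K" if "X \<in> hc_n1 D" for X
  proof
    have X: "fst X \<in> hc_odd D" and odd: "odd_op R X = rho R (fst X)" using that by (auto simp: hc_n1_def rho_def)
    fix v assume "v \<in> odd_op R X ` (?K \<inter> smooth R)"
    then obtain y where y: "y \<in> ?K" "y \<in> smooth R" "v = rho R (fst X) y" unfolding odd by blast
    show "v \<in> ?K" unfolding y(3)
      by (rule image_ccspan[OF csubspace_smooth[OF R] sub(2) rho_clinear[OF R X] rho_bound[OF X] closed_ccspan csubspace_ccspan _ y(2,1)])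
        (use rho_fam_in[OF x _ X] in auto)
  qed
qed

end

end

section \<open>Uniqueness\<close>

context hc_frame
begin

lemma fam_parity:
  fixes R :: "('v, 'h::complex_hilbert) hc_rep"
  assumes R: "is_rep R" and x: "vac R x" "x \<in> even_part R" and p: "(g, A) \<in> fam_index"
  shows "fam R x (g, A) \<in> (if even (card A) then even_part R else odd_part R)"
proof -
  obtain w t where g: "g = (w, t)" by (meson surj_pair)
  have w: "w \<in> hc_even D" and A: "A \<subseteq> letters" using p by (auto simp: fam_index_def N0_iff g)
  show ?thesis using spinor_parity[OF R x(1) A] x(2) grp_facts(2,3)[OF R w]
    by (auto simp: fam_def[OF R] g)
qed

lemma rep_space_invariant:
  fixes R :: "('v, 'h::complex_hilbert) hc_rep"
  assumes R: "is_rep R"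
  shows "graded_invariant_subspace D R (rep_space R)"
  unfolding graded_invariant_subspace_def
proof (intro conjI ballI)
  show "csubspace (rep_space R)" by (rule rep_csub[OF R])
  show "rep_space R = {x + y |x y. x \<in> rep_space R \<inter> even_part R \<and> y \<in> rep_space R \<inter> odd_part R}"
    using even_sub[OF R] odd_sub[OF R] unfolding rep_space_def by blast
  show "grp_op R g ` rep_space R \<subseteq> rep_space R" if "g \<in> hc_N0 D" for g
    using grp_in[OF R, of "fst g" _ "snd g"] that by (auto simp: N0_iff)
  show "odd_op R X ` (rep_space R \<inter> smooth_vectors D R) \<subseteq> rep_space R" if "X \<in> hc_n1 D" for X
    using smooth_in[OF R rho_smooth[OF R, of "fst X"]] that by (auto simp: hc_n1_def rho_def)
qed

lemma irreducible_fam_span: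
  fixes R :: "('v, 'h::complex_hilbert) hc_rep"
  assumes R: "is_rep R" and irr: "irreducible_unitary_rep D R" and x: "pure_vac R x" "x \<noteq> 0"
  shows "ccspan (fam R x ` fam_index) = rep_space R"
proof -
  note vx = pure_vacD(1)[OF R x(1)]
  have "(0, {}) \<in> fam_index" by (simp add: fam_index_def N0_iff sub_even)
  moreover have "fam R x (0, {}) = x"
    using grp_centre[OF R vac_in[OF R vx], of 0] by (simp add: fam_def[OF R] spinor_empty[OF R] zero_prod_def)
  ultimately have "x \<in> ccspan (fam R x ` fam_index)" by (intro ccspan_base) (metis imageI)
  hence "ccspan (fam R x ` fam_index) \<noteq> {0}" using x(2) by blast
  thus ?thesis using irr fam_span_invariant[OF R x(1)] closed_ccspan
    unfolding irreducible_unitary_rep_def by blast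
qed

lemma pure_vac_scaleC:
  fixes R :: "('v, 'h::complex_hilbert) hc_rep"
  assumes R: "is_rep R" and x: "pure_vac R x"
  shows "pure_vac R (c *\<^sub>C x)"
  using x vac_smooth[OF R pure_vacD(1)[OF R x]] csubspaceD(5)[OF part_sub(1)[OF R]] csubspaceD(5)[OF part_sub(2)[OF R]]
  by (auto simp: pure_vac_def[OF R] chirality_scaleC[OF R] intro: vac_scaleC[OF R])

text \<open>Unit pure vacua have families with equal Gram matrices, and irreducibility makes both
  families total; the isometry matching them is the intertwiner. Since both vacua are even, it
  respects the grading.\<close>

lemma equivalent_if_even_vacua:
  fixes R :: "('v, 'h::complex_hilbert) hc_rep" and R' :: "('v, 'k::complex_hilbert) hc_rep"
  assumes R: "is_rep R" "irreducible_unitary_rep D R" and x0: "pure_vac R x0" "x0 \<noteq> 0" "x0 \<in> even_part R"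
    and R': "is_rep R'" "irreducible_unitary_rep D R'" and x0': "pure_vac R' x0'" "x0' \<noteq> 0" "x0' \<in> even_part R'"
  shows "unitarily_equivalent D R R'"
proof -
  \<comment> \<open>The Gram matrices depend on the vacuum through its norm, so both vacua are
    normalised.\<close>
  define x where "x = of_real (1 / norm x0) *\<^sub>C x0"
  define x' where "x' = of_real (1 / norm x0') *\<^sub>C x0'"
  have x: "pure_vac R x" "x \<noteq> 0" "x \<in> even_part R" and nx: "norm x = 1"
    using x0 by (auto simp: x_def norm_scaleC norm_divide intro!: pure_vac_scaleC[OF R(1)] csubspaceD(5)[OF part_sub(1)[OF R(1)]]
        simp flip: norm_eq_zero[of "_ *\<^sub>C _"])
  have x': "pure_vac R' x'" "x' \<noteq> 0" "x' \<in> even_part R'" and nx': "norm x' = 1"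
    using x0' by (auto simp: x'_def norm_scaleC norm_divide intro!: pure_vac_scaleC[OF R'(1)] csubspaceD(5)[OF part_sub(1)[OF R'(1)]]
        simp flip: norm_eq_zero[of "_ *\<^sub>C _"])
  note vx = pure_vacD(1)[OF R(1) x(1)] and vx' = pure_vacD(1)[OF R'(1) x'(1)]
  let ?f = "fam R x" and ?f' = "fam R' x'" and ?I = fam_index
  note span = irreducible_fam_span[OF R x(1,2)] and span' = irreducible_fam_span[OF R' x'(1,2)]
  have gram: "cinner (?f p) (?f q) = cinner (?f' p) (?f' q)" if "p \<in> ?I" "q \<in> ?I" for p q
    using fam_gram[OF R(1) x(1), of "fst p" "snd p" "fst q" "snd q"] fam_gram[OF R'(1) x'(1), of "fst p" "snd p" "fst q" "snd q"] that
    by (simp add: cinner_self nx nx')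
  obtain T where T: "bounded_linear T" "\<And>c v. T (c *\<^sub>C v) = c *\<^sub>C T v" "\<And>p. p \<in> ?I \<Longrightarrow> T (?f p) = ?f' p"
    "\<And>v. v \<in> rep_space R \<Longrightarrow> norm (T v) = norm v"
    "\<And>v w. v \<in> rep_space R \<Longrightarrow> w \<in> rep_space R \<Longrightarrow> cinner (T v) (T w) = cinner v w"
    "T ` rep_space R = rep_space R'"
    by (rule gram_isometry[of ?I ?f ?f', OF gram, unfolded span span']) auto
  have Tadd: "T (v + w) = T v + T w" for v w by (rule linear_add[OF bounded_linear.linear[OF T(1)]])
  have T_in: "T v \<in> rep_space R'" if "v \<in> rep_space R" for v using T(6) that by blast
  have f_in: "?f ` ?I \<subseteq> rep_space R" "?f ` ?I \<subseteq> smooth_vectors D R"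
    using fam_smooth[OF R(1) vx] smooth_in[OF R(1)] by auto
  \<comment> \<open>The component of \<open>T v\<close> of the wrong parity is orthogonal to the
    family: to members of the right parity by the grading, and to the remaining ones because both
    \<open>T v\<close> and its other component are orthogonal to them.\<close>
  have parity: "T v \<in> (if e then even_part R' else odd_part R')"
    if v: "v \<in> (if e then even_part R else odd_part R)" for v e
  proof -
    have vS: "v \<in> rep_space R" using v even_sub[OF R(1)] odd_sub[OF R(1)] by (auto split: if_splits)
    then obtain y z where yz: "T v = y + z" "y \<in> even_part R'" "z \<in> odd_part R'"
      using T_in unfolding rep_space_def by blast
    have yzS: "y \<in> rep_space R'" "z \<in> rep_space R'" using yz even_sub[OF R'(1)] odd_sub[OF R'(1)] by auto
    let ?z = "if e then z else y"
    have "?z = 0"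
    proof (rule eq_if_cinner_eq_on_total[where B = "?f' ` ?I"])
      show "?z \<in> ccspan (?f' ` ?I)" "0 \<in> ccspan (?f' ` ?I)"
        using yzS csubspaceD(2)[OF rep_csub[OF R'(1)]] unfolding span' by auto
      fix b assume "b \<in> ?f' ` ?I"
      then obtain g A where p: "(g, A) \<in> ?I" "b = ?f' (g, A)" by auto
      have b: "b = T (?f (g, A))" using T(3)[OF p(1)] p(2) by simp
      have fS: "?f (g, A) \<in> rep_space R" using f_in p(1) by blast
      show "cinner b ?z = cinner b 0"
      proof (cases "even (card A) = e")
        case True
        thus ?thesis using fam_parity[OF R'(1) vx' x'(3) p(1)] yz part_sub(5,6)[OF R'(1)] p(2) by auto
      next
        case False
        have "cinner b (T v) = cinner (?f (g, A)) v" unfolding b by (rule T(5)[OF fS vS])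
        also have "\<dots> = 0"
          using False fam_parity[OF R(1) vx x(3) p(1)] v part_sub(5,6)[OF R(1)] by (auto split: if_splits)
        finally have "cinner b y + cinner b z = 0" unfolding yz(1) by (simp add: cinner_add_right)
        moreover have "cinner b (if e then y else z) = 0"
          using False fam_parity[OF R'(1) vx' x'(3) p(1)] yz part_sub(5,6)[OF R'(1)] p(2) by (auto split: if_splits)
        ultimately show ?thesis by (cases e) auto
      qed
    qed
    thus ?thesis using yz by (cases e) auto
  qed
  have grp: "T (grp_op R h v) = grp_op R' h (T v)" if h: "h \<in> hc_N0 D" and v: "v \<in> rep_space R" for h v
  proof -
    obtain w t where h': "h = (w, t)" "w \<in> hc_even D" using h by (cases h) (auto simp: N0_iff)
    note lin = clinear_onD[OF grp_facts(1)[OF R(1) h'(2)]] and lin' = clinear_onD[OF grp_facts(1)[OF R'(1) h'(2)]]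
    show ?thesis
    proof (rule eq_on_total[OF rep_csub[OF R(1)] f_in(1), where C = 1 and C' = 1])
      show "clinear_on (rep_space R) (\<lambda>v. T (grp_op R h v))"
        by (auto simp: clinear_on_def h' lin Tadd T(2))
      show "clinear_on (rep_space R) (\<lambda>v. grp_op R' h (T v))"
        by (auto simp: clinear_on_def h' lin' Tadd T(2) T_in)
      show "norm (T (grp_op R h v)) \<le> 1 * norm v" if "v \<in> rep_space R" for v
        using that by (simp add: h' T(4) grp_in[OF R(1) h'(2)] norm_grp[OF R(1) h'(2)])
      show "norm (grp_op R' h (T v)) \<le> 1 * norm v" if "v \<in> rep_space R" for v
        using that by (simp add: h' T(4) T_in norm_grp[OF R'(1) h'(2)])
      show "v \<in> ccspan (?f ` ?I)" using v span by simp
      fix b assume "b \<in> ?f ` ?I"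
      then obtain g A where p: "(g, A) \<in> ?I" "b = ?f (g, A)" by auto
      have "(hc_mult D h g, A) \<in> ?I"
        using h' p by (auto simp: fam_index_def N0_iff hc_mult_def hc_bracket_def sub_even)
      thus "T (grp_op R h b) = grp_op R' h (T b)"
        using p fam_grp[OF R(1) vx p(1) h] fam_grp[OF R'(1) vx' p(1) h] T(3) by simp
    qed (rule v)
  qed
  \<comment> \<open>The intertwining relation exhibits the orbit map of \<open>T v\<close> as a
    bounded linear image of that of \<open>v\<close>.\<close>
  have T_smooth: "T v \<in> smooth_vectors D R'" if v: "v \<in> smooth_vectors D R" for v
  proof -
    have "Ck_on k (hc_N0 D) (\<lambda>g. grp_op R' g (T v))" for k
      by (rule Ck_on_cong[OF grp[OF _ smooth_in[OF R(1) v]] Ck_on_bounded_linear_comp[OF T(1)]])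
        (use v in \<open>auto simp: smooth_vectors_def smooth_on_def\<close>)
    thus ?thesis using T_in[OF smooth_in[OF R(1) v]] by (simp add: smooth_vectors_def smooth_on_def)
  qed
  have odd: "T (odd_op R X v) = odd_op R' X (T v)" if X1: "X \<in> hc_n1 D" and v: "v \<in> smooth_vectors D R" for X v
  proof -
    obtain Y where X: "X = (Y, 0)" "Y \<in> hc_odd D" using X1 by (auto simp: hc_n1_def)
    note lin = clinear_onD[OF rho_clinear[OF R(1) X(2)]] and lin' = clinear_onD[OF rho_clinear[OF R'(1) X(2)]]
    let ?C = "sqrt \<bar>lam * hc_form D Y Y / 2\<bar>"
    have "T (rho R Y v) = rho R' Y (T v)"
    proof (rule eq_on_total[OF csubspace_smooth[OF R(1)] f_in(2), where C = ?C and C' = ?C])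
      show "clinear_on (smooth_vectors D R) (\<lambda>v. T (rho R Y v))"
        by (auto simp: clinear_on_def lin Tadd T(2))
      show "clinear_on (smooth_vectors D R) (\<lambda>v. rho R' Y (T v))"
        by (auto simp: clinear_on_def lin' Tadd T(2) T_smooth)
      show "norm (T (rho R Y v)) \<le> ?C * norm v" if "v \<in> smooth_vectors D R" for v
        using rho_bound[OF R(1) X(2) that] by (simp add: T(4) smooth_in[OF R(1) rho_smooth[OF R(1) X(2) that]])
      show "norm (rho R' Y (T v)) \<le> ?C * norm v" if "v \<in> smooth_vectors D R" for v
        using rho_bound[OF R'(1) X(2) T_smooth[OF that]] by (simp add: T(4) smooth_in[OF R(1) that])
      show "v \<in> ccspan (?f ` ?I)" using smooth_in[OF R(1) v] span by simp
      fix b assume "b \<in> ?f ` ?I"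
      then obtain g A where p: "(g, A) \<in> ?I" "b = ?f (g, A)" by auto
      have "T (rho R (u i) b) = rho R' (u i) (T b)" if i: "i < m" for i
      proof -
        have "(g, toggle (i div 2) A) \<in> ?I"
          using p(1) toggle_subset[OF half_letters[OF i]] by (auto simp: fam_index_def)
        thus ?thesis using p fam_gen[OF R(1) x(1) p(1) i] fam_gen[OF R'(1) x'(1) p(1) i] T(2,3) by simp
      qed
      moreover have b: "b \<in> smooth_vectors D R" using p f_in by blast
      ultimately show "T (rho R Y b) = rho R' Y (T b)"
        unfolding rho_expand[OF R(1) X(2) b] rho_expand[OF R'(1) X(2) T_smooth[OF b]]
        by (simp add: linear_sum[OF bounded_linear.linear[OF T(1)]] linear_scale[OF bounded_linear.linear[OF T(1)]])
    qed (rule v)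
    thus ?thesis by (simp add: X rho_def)
  qed
  show ?thesis
    unfolding unitarily_equivalent_def
  proof (intro exI[of _ T] conjI ballI)
    show "clinear_on (rep_space R) T" by (auto simp: clinear_on_def Tadd T(2))
    show "T ` even_part R \<subseteq> even_part R'" using parity[of _ True] by auto
    show "T ` odd_part R \<subseteq> odd_part R'" using parity[of _ False] by auto
  qed (use T grp odd in auto)
qed

end

section \<open>Parity change\<close>

lemma parity_change_simps [simp]:
  "even_part (parity_change R) = odd_part R" "odd_part (parity_change R) = even_part R"
  "grp_op (parity_change R) = grp_op R" "odd_op (parity_change R) = odd_op R"
  by (simp_all add: parity_change_def)

lemma rep_space_parity_change [simp]: "rep_space (parity_change R) = rep_space R"
  unfolding rep_space_def parity_change_simps using add.commute by blast

lemma smooth_vectors_parity_change [simp]: "smooth_vectors D (parity_change R) = smooth_vectors D R"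
  by (simp add: smooth_vectors_def)

lemma unitary_rep_parity_change:
  assumes "unitary_rep D R" shows "unitary_rep D (parity_change R)"
proof -
  have inf: "inf_action (parity_change R) = inf_action R" by (simp add: inf_action_def fun_eq_iff)
  have "graded_hilbert R" using assms by (simp add: unitary_rep_def)
  hence "graded_hilbert (parity_change R)"
    unfolding graded_hilbert_def parity_change_simps by (metis cinner_commute complex_cnj_zero)
  moreover have "even_unitary_group_rep D (parity_change R)"
    using assms unfolding unitary_rep_def even_unitary_group_rep_def by simp
  ultimately show ?thesis using assms unfolding unitary_rep_def inf by simp
qed

lemma irreducible_parity_change:
  assumes "irreducible_unitary_rep D R" shows "irreducible_unitary_rep D (parity_change R)"
proof -
  have "graded_invariant_subspace D R K" if "graded_invariant_subspace D (parity_change R) K" for K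
  proof -
    have "{x + y |x y. x \<in> K \<inter> odd_part R \<and> y \<in> K \<inter> even_part R} = {x + y |x y. x \<in> K \<inter> even_part R \<and> y \<in> K \<inter> odd_part R}"
      using add.commute by blast
    thus ?thesis using that unfolding graded_invariant_subspace_def by simp
  qed
  thus ?thesis using assms unitary_rep_parity_change unfolding irreducible_unitary_rep_def by auto
qed

lemma equivalent_parity_change:
  "unitarily_equivalent D (parity_change R) R' \<longleftrightarrow> unitarily_equivalent D R (parity_change R')"
  unfolding unitarily_equivalent_def by (auto simp: conj_commute)

context hc_frame
begin

lemma is_rep_parity_change: "is_rep R \<Longrightarrow> is_rep (parity_change R)"
  using unitary_rep_parity_change[of D R] by (auto simp: is_rep_def has_central_character_def)

lemma pure_vac_parity_change:
  fixes R :: "('v, 'h::complex_hilbert) hc_rep"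
  assumes R: "is_rep R" and x: "pure_vac R x"
  shows "pure_vac (parity_change R) x"
proof -
  have "wop (parity_change R) = wop R" "rho (parity_change R) = rho R" by (simp_all add: wop_def rho_def fun_eq_iff)
  thus ?thesis using x
    by (auto simp: pure_vac_def[OF R] pure_vac_def[OF is_rep_parity_change[OF R]] vac_def[OF R]
        vac_def[OF is_rep_parity_change[OF R]] chirality_def[OF R] chirality_def[OF is_rep_parity_change[OF R]])
qed

text \<open>A pure vacuum is homogeneous, and an odd one becomes even after parity change.\<close>

lemma even_vacuum_up_to_parity:
  fixes R :: "('v, 'h::complex_hilbert) hc_rep"
  assumes R: "is_rep R" "irreducible_unitary_rep D R"
  obtains S x where "S = R \<or> S = parity_change R" "is_rep S" "irreducible_unitary_rep D S"
    "pure_vac S x" "x \<noteq> 0" "x \<in> even_part S"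
proof -
  obtain x where x: "x \<noteq> 0" "pure_vac R x"
    by (rule pure_vac_exists[OF R(1) rep_space_invariant[OF R(1)] rep_closed[OF R(1)] subset_refl])
      (use R(2) in \<open>auto simp: irreducible_unitary_rep_def\<close>)
  from pure_vacD(2)[OF R(1) x(2)] show thesis
  proof
    assume "x \<in> even_part R"
    thus thesis using that[of R x] R x by blast
  next
    assume "x \<in> odd_part R"
    thus thesis using that[of "parity_change R" x] is_rep_parity_change[OF R(1)] irreducible_parity_change[OF R(2)]
        pure_vac_parity_change[OF R(1) x(2)] x(1) by simp
  qed
qed

text \<open>Changing the parity of both representations amounts to changing neither, and a change of
  \<open>R\<close> alone can be moved to \<open>R'\<close>, so four cases collapse to two.\<close>

lemma uniqueness:
  fixes R :: "('v, 'h::complex_hilbert) hc_rep" and R' :: "('v, 'k::complex_hilbert) hc_rep"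
  assumes R: "is_rep R" "irreducible_unitary_rep D R" and R': "is_rep R'" "irreducible_unitary_rep D R'"
  shows "unitarily_equivalent D R R' \<or> unitarily_equivalent D R (parity_change R')"
proof -
  obtain S x where S: "S = R \<or> S = parity_change R" "is_rep S" "irreducible_unitary_rep D S"
    "pure_vac S x" "x \<noteq> 0" "x \<in> even_part S" by (rule even_vacuum_up_to_parity[OF R])
  obtain S' x' where S': "S' = R' \<or> S' = parity_change R'" "is_rep S'" "irreducible_unitary_rep D S'"
    "pure_vac S' x'" "x' \<noteq> 0" "x' \<in> even_part S'" by (rule even_vacuum_up_to_parity[OF R'])
  have "unitarily_equivalent D S S'" by (rule equivalent_if_even_vacua[OF S(2-6) S'(2-6)])
  moreover have "parity_change (parity_change R') = R'" by (simp add: parity_change_def)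
  ultimately show ?thesis using S(1) S'(1) equivalent_parity_change[of D R] by metis
qed

end

section \<open>The model representation\<close>

lemma csubspace_UNIV: "csubspace UNIV"
  by (simp add: csubspace_def)

lemma cmod_order_sign [simp]: "cmod (order_sign l A) = 1"
  by (simp add: order_sign_def norm_power)

lemma order_sign_square [simp]: "order_sign l A * order_sign l A = 1"
  by (simp add: order_sign_def power_add[symmetric] mult_2[symmetric] power_mult)

lemma cmod_clifford_coeff [simp]: "cmod (clifford_coeff i A) = 1"
  by (simp add: clifford_coeff_def norm_mult)

lemma order_sign_toggle:
  assumes "finite A"
  shows "order_sign l (toggle k A) = (if k < l then - order_sign l A else order_sign l A)"
proof (cases "k < l")
  case True
  show ?thesis
  proof (cases "k \<in> A")
    case k: True
    have "{i \<in> A. i < l} = insert k {i \<in> A - {k}. i < l}" using k True by auto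
    thus ?thesis using k True assms by (simp add: order_sign_def toggle_def)
  next
    case k: False
    have "{i \<in> insert k A. i < l} = insert k {i \<in> A. i < l}" using True by auto
    thus ?thesis using k True assms by (simp add: order_sign_def toggle_def)
  qed
next
  case False
  hence "{i \<in> toggle k A. i < l} = {i \<in> A. i < l}" by (auto simp: toggle_def)
  thus ?thesis using False by (simp add: order_sign_def)
qed

lemma toggle_toggle [simp]: "toggle l (toggle l A) = A"
  by (auto simp: toggle_def)

lemma toggle_commute: "toggle l (toggle k A) = toggle k (toggle l A)"
  by (auto simp: toggle_def)

lemma in_toggle: "l \<in> toggle k A \<longleftrightarrow> (l \<in> A) \<noteq> (l = k)"
  by (auto simp: toggle_def)

lemma even_card_toggle: "finite A \<Longrightarrow> even (card (toggle l A)) \<longleftrightarrow> odd (card A)"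
  by (auto simp: toggle_def card_Diff_singleton card_gt_0_iff)

lemma clifford_coeff_square:
  assumes "finite A" shows "clifford_coeff i A * clifford_coeff i (toggle (i div 2) A) = 1"
proof -
  have "clifford_coeff i A * clifford_coeff i (toggle (i div 2) A) =
    (if even i then 1 else if i div 2 \<in> A then \<i> else - \<i>) * (if even i then 1 else if i div 2 \<in> A then - \<i> else \<i>) *
    (order_sign (i div 2) A * order_sign (i div 2) A)"
    by (simp add: clifford_coeff_def order_sign_toggle[OF assms] in_toggle)
  thus ?thesis by simp
qed

lemma clifford_coeff_anticommute:
  assumes "finite A" "i \<noteq> j"
  shows "clifford_coeff j A * clifford_coeff i (toggle (j div 2) A) = - (clifford_coeff i A * clifford_coeff j (toggle (i div 2) A))"
proof (cases "i div 2 = j div 2")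
  case True
  hence "even i \<noteq> even j" using assms(2) by (metis div_mod_decomp even_iff_mod_2_eq_zero odd_iff_mod_2_eq_one)
  thus ?thesis using True by (auto simp: clifford_coeff_def order_sign_toggle[OF assms(1)] in_toggle)
next
  case False
  thus ?thesis by (auto simp: clifford_coeff_def order_sign_toggle[OF assms(1)] in_toggle)
qed

context hc_frame
begin

text \<open>The phases from the Baker-Campbell-Hausdorff term cancel those of the Hermitian form.
  This invariance lets left translation of indices extend to an isometry of the model.\<close>

lemma phi_mult:
  assumes "h \<in> hc_N0 D" "g \<in> hc_N0 D" "g' \<in> hc_N0 D"
  shows "cinner (phi (hc_mult D h g)) (phi (hc_mult D h g')) = cinner (phi g) (phi g')"
proof -
  obtain v s w t w' t' where g: "h = (v, s)" "g = (w, t)" "g' = (w', t')" by (meson surj_pair)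
  have e: "v \<in> hc_even D" "w \<in> hc_even D" "w' \<in> hc_even D" using assms by (auto simp: N0_iff g)
  have form: "lam * hc_form D a b = 2 * Im (herm a b)" if "a \<in> hc_even D" "b \<in> hc_even D" for a b
    using symp[OF that] by (simp add: herm_def)
  have q: "qf (a + b) = qf a + qf b + Re (herm a b)" for a b
    using qf_diff[of a "- b"] by (simp add: herm_simps qf_def co_simps)
  have hvv: "herm v v = of_real (2 * qf v)"
    unfolding qf_def herm_def by (simp add: complex_norm_square[symmetric] del: of_real_power)
  have arg: "lam * ((s + t + hc_form D v w / 2) - (s + t' + hc_form D v w' / 2)) =
      lam * (t - t') + (Im (herm v w) - Im (herm v w'))"
    using form[OF e(1,2)] form[OF e(1,3)] by (simp add: algebra_simps)
  have herm: "herm (v + w) (v + w') - of_real (qf (v + w)) - of_real (qf (v + w')) =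
     \<i> * of_real (Im (herm v w') - Im (herm v w)) + (herm w w' - of_real (qf w) - of_real (qf w'))"
    unfolding herm_simps q hvv cnj_herm[of v w, symmetric] by (simp add: complex_eq_iff)
  have mult: "hc_mult D (v, s) (a, r) = (v + a, s + r + hc_form D v a / 2)" for a r
    by (simp add: hc_mult_def hc_bracket_def)
  show ?thesis
    unfolding g mult cinner_phi arg herm exp_add cis_conv_exp[symmetric] mult.assoc[symmetric] cis_mult by simp
qed

text \<open>Coherent states carry the Weyl operators, the second factor carries the spinors;
  \<open>set_encode\<close> is injective on finite sets, so different letter sets give orthogonal
  vectors.\<close>

definition model_vec :: "('v \<times> real) \<times> nat set \<Rightarrow> ell2"
  where "model_vec = (\<lambda>(g, A). ell2_tensor (phi g) (ell2_basis (set_encode A)))"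

definition model_space :: "ell2 set"
  where "model_space = ccspan (model_vec ` fam_index)"

lemma fam_index_finite: "(g, A) \<in> fam_index \<Longrightarrow> finite A"
  using finite_subset[OF _ finite_letters] by (auto simp: fam_index_def)

lemma cinner_model_vec:
  assumes "(g, A) \<in> fam_index" "(h, B) \<in> fam_index"
  shows "cinner (model_vec (g, A)) (model_vec (h, B)) = (if A = B then cinner (phi g) (phi h) else 0)"
  using fam_index_finite[OF assms(1)] fam_index_finite[OF assms(2)]
  by (simp add: model_vec_def cinner_tensor set_encode_eq)

lemma model_vec_in: "p \<in> fam_index \<Longrightarrow> model_vec p \<in> model_space"
  unfolding model_space_def by (intro ccspan_base imageI)

lemmas model_sub = csubspaceD[OF csubspace_ccspan[of "model_vec ` fam_index", folded model_space_def]]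
lemmas model_csub = csubspace_ccspan[of "model_vec ` fam_index", folded model_space_def]
lemmas model_closed = closed_ccspan[of "model_vec ` fam_index", folded model_space_def]

text \<open>An operator of the model prescribed by its values \<open>s\<close> on the total family,
  with everything needed about it bundled for a choice by \<open>SOME\<close>.\<close>

definition model_op :: "(('v \<times> real) \<times> nat set \<Rightarrow> ell2) \<Rightarrow> (ell2 \<Rightarrow> ell2) \<Rightarrow> bool"
  where "model_op s T \<longleftrightarrow> bounded_linear T \<and> (\<forall>c x. T (c *\<^sub>C x) = c *\<^sub>C T x) \<and>
    (\<forall>p\<in>fam_index. T (model_vec p) = s p) \<and> T ` model_space \<subseteq> model_space \<and>
    (\<forall>x\<in>model_space. \<forall>y\<in>model_space. cinner (T x) (T y) = cinner x y)"

lemma model_op_exists: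
  assumes "\<And>p q. p \<in> fam_index \<Longrightarrow> q \<in> fam_index \<Longrightarrow> cinner (model_vec p) (model_vec q) = cinner (s p) (s q)"
    and "\<And>p. p \<in> fam_index \<Longrightarrow> s p \<in> model_space"
  shows "\<exists>T. model_op s T"
proof -
  obtain T where T: "bounded_linear T" "\<And>c v. T (c *\<^sub>C v) = c *\<^sub>C T v" "\<And>p. p \<in> fam_index \<Longrightarrow> T (model_vec p) = s p"
    "\<And>v w. v \<in> model_space \<Longrightarrow> w \<in> model_space \<Longrightarrow> cinner (T v) (T w) = cinner v w"
    "T ` model_space = ccspan (s ` fam_index)"
    by (rule gram_isometry[of fam_index model_vec s, OF assms(1), folded model_space_def]) auto
  have "ccspan (s ` fam_index) \<subseteq> model_space"
    using assms(2) by (intro ccspan_minimal model_csub model_closed) auto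
  hence "model_op s T" unfolding model_op_def using T by (intro conjI allI ballI) auto
  thus ?thesis by (intro exI[of "model_op s" T])
qed

text \<open>This and \<open>gen_shift\<close> turn \<open>fam_grp\<close> and
  \<open>fam_gen\<close>, the formulas forced in every representation, into definitions.\<close>

definition grp_shift :: "'v \<times> real \<Rightarrow> ('v \<times> real) \<times> nat set \<Rightarrow> ell2"
  where "grp_shift h = (\<lambda>(g, A). model_vec (hc_mult D h g, A))"

definition gen_shift :: "nat \<Rightarrow> ('v \<times> real) \<times> nat set \<Rightarrow> ell2"
  where "gen_shift i = (\<lambda>(g, A). clifford_coeff i A *\<^sub>C model_vec (g, toggle (i div 2) A))"

definition model_grp :: "'v \<times> real \<Rightarrow> ell2 \<Rightarrow> ell2"
  where "model_grp h = (SOME T. model_op (grp_shift h) T)"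

definition model_gen :: "nat \<Rightarrow> ell2 \<Rightarrow> ell2"
  where "model_gen i = (SOME T. model_op (gen_shift i) T)"

lemma fam_index_mult: "h \<in> hc_N0 D \<Longrightarrow> (g, A) \<in> fam_index \<Longrightarrow> (hc_mult D h g, A) \<in> fam_index"
  by (auto simp: fam_index_def N0_iff hc_mult_def hc_bracket_def sub_even)

lemma fam_index_toggle: "i < m \<Longrightarrow> (g, A) \<in> fam_index \<Longrightarrow> (g, toggle (i div 2) A) \<in> fam_index"
  using toggle_subset[OF half_letters] by (auto simp: fam_index_def)

lemma model_grp: "h \<in> hc_N0 D \<Longrightarrow> model_op (grp_shift h) (model_grp h)"
proof -
  assume h: "h \<in> hc_N0 D"
  have "\<exists>T. model_op (grp_shift h) T"
  proof (rule model_op_exists)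
    fix p q assume pq: "p \<in> fam_index" "q \<in> fam_index"
    obtain g A k B where p: "p = (g, A)" "q = (k, B)" by (meson surj_pair)
    show "cinner (model_vec p) (model_vec q) = cinner (grp_shift h p) (grp_shift h q)"
      using pq fam_index_mult[OF h] phi_mult[OF h, of g k]
      by (auto simp: p grp_shift_def cinner_model_vec) (auto simp: fam_index_def)
  next
    fix p assume "p \<in> fam_index"
    thus "grp_shift h p \<in> model_space"
      using fam_index_mult[OF h] by (auto simp: grp_shift_def split: prod.split intro!: model_vec_in)
  qed
  thus ?thesis unfolding model_grp_def by (rule someI_ex)
qed

lemma model_gen: "i < m \<Longrightarrow> model_op (gen_shift i) (model_gen i)"
proof -
  assume i: "i < m"
  have "\<exists>T. model_op (gen_shift i) T"
  proof (rule model_op_exists)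
    fix p q assume pq: "p \<in> fam_index" "q \<in> fam_index"
    obtain g A k B where p: "p = (g, A)" "q = (k, B)" by (meson surj_pair)
    have "clifford_coeff i B * cnj (clifford_coeff i B) = 1"
      unfolding complex_norm_square[symmetric] by simp
    moreover have "toggle (i div 2) A = toggle (i div 2) B \<longleftrightarrow> A = B" by (metis toggle_toggle)
    ultimately show "cinner (model_vec p) (model_vec q) = cinner (gen_shift i p) (gen_shift i q)"
      using pq fam_index_toggle[OF i]
      by (auto simp: p gen_shift_def cinner_model_vec cinner_scaleC_left cinner_scaleC_right mult.assoc[symmetric] mult.commute)
  next
    fix p assume "p \<in> fam_index"
    thus "gen_shift i p \<in> model_space"
      using fam_index_toggle[OF i] by (auto simp: gen_shift_def split: prod.split intro!: model_sub model_vec_in)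
  qed
  thus ?thesis unfolding model_gen_def by (rule someI_ex)
qed

lemma model_opD:
  assumes "model_op s T"
  shows "bounded_linear T" "T (c *\<^sub>C x) = c *\<^sub>C T x" "p \<in> fam_index \<Longrightarrow> T (model_vec p) = s p"
    "x \<in> model_space \<Longrightarrow> T x \<in> model_space"
    "x \<in> model_space \<Longrightarrow> y \<in> model_space \<Longrightarrow> cinner (T x) (T y) = cinner x y"
    "T (x + y) = T x + T y" "T (x - y) = T x - T y" "T (r *\<^sub>R x) = r *\<^sub>R T x" "clinear_on S T"
proof -
  have T: "bounded_linear T" and c: "\<And>c x. T (c *\<^sub>C x) = c *\<^sub>C T x" using assms by (simp_all add: model_op_def)
  note lin = bounded_linear.linear[OF T]
  show "bounded_linear T" "T (c *\<^sub>C x) = c *\<^sub>C T x" "T (x + y) = T x + T y" "T (x - y) = T x - T y" "T (r *\<^sub>R x) = r *\<^sub>R T x"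
    by (simp_all add: T c linear_add[OF lin] linear_diff[OF lin] linear_scale[OF lin])
  show "clinear_on S T" by (simp add: clinear_on_def c linear_add[OF lin])
qed (use assms in \<open>auto simp: model_op_def\<close>)

lemma model_op_norm: "model_op s T \<Longrightarrow> x \<in> model_space \<Longrightarrow> norm (T x) = norm x"
  using model_opD(5)[of s T x x] by (simp only: cinner_self_eq_iff_norm_eq[symmetric])

text \<open>Relations between operators of the model are thereby reduced to computations with
  indices and coefficients.\<close>

lemma model_eq:
  assumes S: "bounded_linear S" "\<And>c x. S (c *\<^sub>C x) = c *\<^sub>C S x" and T: "bounded_linear T" "\<And>c x. T (c *\<^sub>C x) = c *\<^sub>C T x"
    and eq: "\<And>p. p \<in> fam_index \<Longrightarrow> S (model_vec p) = T (model_vec p)" and x: "x \<in> model_space"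
  shows "S x = (T x :: ell2)"
proof -
  obtain C where C: "\<And>x. norm (S x) \<le> norm x * C" using bounded_linear.bounded[OF S(1)] by blast
  obtain C' where C': "\<And>x. norm (T x) \<le> norm x * C'" using bounded_linear.bounded[OF T(1)] by blast
  show ?thesis
    by (rule eq_on_total[of UNIV "model_vec ` fam_index" S C T C'])
      (use S T C C' eq x linear_add[OF bounded_linear.linear[OF S(1)]] linear_add[OF bounded_linear.linear[OF T(1)]] in
        \<open>auto simp: clinear_on_def mult.commute model_space_def csubspace_def\<close>)
qed

lemma model_grp_vec: "h \<in> hc_N0 D \<Longrightarrow> (g, A) \<in> fam_index \<Longrightarrow> model_grp h (model_vec (g, A)) = model_vec (hc_mult D h g, A)"
  using model_opD(3)[OF model_grp] by (simp add: grp_shift_def)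

lemma model_gen_vec: "i < m \<Longrightarrow> (g, A) \<in> fam_index \<Longrightarrow>
    model_gen i (model_vec (g, A)) = clifford_coeff i A *\<^sub>C model_vec (g, toggle (i div 2) A)"
  using model_opD(3)[OF model_gen] by (simp add: gen_shift_def)

lemma bounded_linear_comp2: "model_op s S \<Longrightarrow> model_op t T \<Longrightarrow> bounded_linear (\<lambda>x. S (T x))"
  by (intro bounded_linear_compose[of S T] model_opD(1))

lemma model_grp_mult:
  assumes "g \<in> hc_N0 D" "h \<in> hc_N0 D" "x \<in> model_space"
  shows "model_grp (hc_mult D g h) x = model_grp g (model_grp h x)"
proof (rule model_eq[OF _ _ _ _ _ assms(3)])
  have gh: "hc_mult D g h \<in> hc_N0 D" using hc_group_laws(1)[OF hc assms(1,2)] assms by blast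
  show "bounded_linear (model_grp (hc_mult D g h))" "model_grp (hc_mult D g h) (c *\<^sub>C x) = c *\<^sub>C model_grp (hc_mult D g h) x" for c x
    using model_opD(1,2)[OF model_grp[OF gh]] by auto
  show "bounded_linear (\<lambda>x. model_grp g (model_grp h x))" by (rule bounded_linear_comp2[OF model_grp[OF assms(1)] model_grp[OF assms(2)]])
  show "model_grp g (model_grp h (c *\<^sub>C x)) = c *\<^sub>C model_grp g (model_grp h x)" for c x
    using assms by (simp add: model_opD(2)[OF model_grp])
  fix p assume p: "p \<in> fam_index"
  obtain k A where p': "p = (k, A)" by fastforce
  have "hc_mult D (hc_mult D g h) k = hc_mult D g (hc_mult D h k)"
    using hc_group_laws(4)[OF hc assms(1,2)] p by (simp add: p' fam_index_def)
  thus "model_grp (hc_mult D g h) (model_vec p) = model_grp g (model_grp h (model_vec p))"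
    using p assms gh fam_index_mult unfolding p' by (simp add: model_grp_vec)
qed

lemma model_grp_centre:
  assumes "x \<in> model_space" shows "model_grp (0, t) x = cis (lam * t) *\<^sub>C x"
proof (rule model_eq[where T = "scaleC (cis (lam * t))", OF _ _ _ _ _ assms])
  have N: "(0, t) \<in> hc_N0 D" by (simp add: N0_iff sub_even)
  show "bounded_linear (model_grp (0, t))" "model_grp (0, t) (c *\<^sub>C x) = c *\<^sub>C model_grp (0, t) x" for c x
    using model_opD(1,2)[OF model_grp[OF N]] by auto
  show "bounded_linear (scaleC (cis (lam * t)) :: ell2 \<Rightarrow> ell2)" by (rule bounded_linear_scaleC)
  show "cis (lam * t) *\<^sub>C (c *\<^sub>C x) = c *\<^sub>C (cis (lam * t) *\<^sub>C x)" for c and x :: ell2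
    by (simp add: scaleC_scaleC mult.commute)
  fix p assume p: "p \<in> fam_index"
  obtain w s A where p': "p = ((w, s), A)" by (metis surj_pair)
  have "phi (w, t + s) = cis (lam * t) *\<^sub>C phi (w, s)"
    by (simp add: phi_def scaleC_scaleC cis_conv_exp exp_add[symmetric] algebra_simps)
  hence "ell2_tensor (phi (w, t + s)) y = cis (lam * t) *\<^sub>C ell2_tensor (phi (w, s)) y" for y
    by (intro ell2_eqI) (simp add: ell2_coord_tensor mult.assoc)
  moreover have "hc_mult D (0, t) (w, s) = (w, t + s)" by (simp add: hc_mult_def hc_bracket_def hc_form_simps)
  ultimately show "model_grp (0, t) (model_vec p) = cis (lam * t) *\<^sub>C model_vec p"
    using model_grp_vec[OF N p[unfolded p']] by (simp add: p' model_vec_def)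
qed

lemma model_gen_grp:
  assumes "i < m" "h \<in> hc_N0 D" "x \<in> model_space"
  shows "model_gen i (model_grp h x) = model_grp h (model_gen i x)"
proof (rule model_eq[OF _ _ _ _ _ assms(3)])
  note G = model_grp[OF assms(2)] and C = model_gen[OF assms(1)]
  show "bounded_linear (\<lambda>x. model_gen i (model_grp h x))" "bounded_linear (\<lambda>x. model_grp h (model_gen i x))"
    by (intro bounded_linear_comp2[OF G C] bounded_linear_comp2[OF C G])+
  show "model_gen i (model_grp h (c *\<^sub>C x)) = c *\<^sub>C model_gen i (model_grp h x)"
    "model_grp h (model_gen i (c *\<^sub>C x)) = c *\<^sub>C model_grp h (model_gen i x)" for c x
    by (simp_all add: model_opD(2)[OF G] model_opD(2)[OF C])
  fix p assume p: "p \<in> fam_index"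
  obtain k A where p': "p = (k, A)" by fastforce
  show "model_gen i (model_grp h (model_vec p)) = model_grp h (model_gen i (model_vec p))"
    using p assms fam_index_mult[OF assms(2)] fam_index_toggle[OF assms(1)] unfolding p'
    by (simp add: model_grp_vec model_gen_vec model_opD(2)[OF G])
qed

lemma model_gen_gen:
  assumes "i < m" "j < m" "x \<in> model_space"
  shows "model_gen i (model_gen j x) + model_gen j (model_gen i x) = (if i = j then 2 *\<^sub>R x else 0)"
proof -
  note C = model_gen[OF assms(1)] and C' = model_gen[OF assms(2)]
  have "model_gen i (model_gen j x) + model_gen j (model_gen i x) = of_real (if i = j then 2 else 0) *\<^sub>C x"
  proof (rule model_eq[OF _ _ _ _ _ assms(3)])
    show "bounded_linear (\<lambda>x. model_gen i (model_gen j x) + model_gen j (model_gen i x))"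
      by (intro bounded_linear_add bounded_linear_comp2[OF C C'] bounded_linear_comp2[OF C' C])
    show "bounded_linear (scaleC (of_real (if i = j then 2 else 0)) :: ell2 \<Rightarrow> ell2)" by (rule bounded_linear_scaleC)
    show "model_gen i (model_gen j (c *\<^sub>C x)) + model_gen j (model_gen i (c *\<^sub>C x)) =
        c *\<^sub>C (model_gen i (model_gen j x) + model_gen j (model_gen i x))" for c x
      by (simp add: model_opD(2)[OF C] model_opD(2)[OF C'] scaleC_add_right)
    show "of_real (if i = j then 2 else 0) *\<^sub>C (c *\<^sub>C x) = c *\<^sub>C (of_real (if i = j then 2 else 0) *\<^sub>C x)" for c and x :: ell2
      by (simp add: scaleC_scaleC mult.commute)
    fix p assume p: "p \<in> fam_index"
    obtain g A where p': "p = (g, A)" by fastforce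
    note fin = fam_index_finite[OF p[unfolded p']]
    have ij: "model_gen i (model_gen j (model_vec p)) =
        (clifford_coeff j A * clifford_coeff i (toggle (j div 2) A)) *\<^sub>C model_vec (g, toggle (i div 2) (toggle (j div 2) A))"
      using p assms fam_index_toggle[OF assms(2)] unfolding p'
      by (simp add: model_gen_vec model_opD(2)[OF C] scaleC_scaleC)
    have ji: "model_gen j (model_gen i (model_vec p)) =
        (clifford_coeff i A * clifford_coeff j (toggle (i div 2) A)) *\<^sub>C model_vec (g, toggle (i div 2) (toggle (j div 2) A))"
      using p assms fam_index_toggle[OF assms(1)] unfolding p'
      by (simp add: model_gen_vec model_opD(2)[OF C'] scaleC_scaleC toggle_commute)
    show "model_gen i (model_gen j (model_vec p)) + model_gen j (model_gen i (model_vec p)) =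
        of_real (if i = j then 2 else 0) *\<^sub>C model_vec p"
    proof (cases "i = j")
      case True
      have "2 *\<^sub>C y = y + y" for y :: ell2 using scaleC_add_left[of 1 1 y] by simp
      thus ?thesis using True ij clifford_coeff_square[OF fin, of i] by (simp add: p')
    next
      case False
      thus ?thesis unfolding ij ji clifford_coeff_anticommute[OF fin False] by simp
    qed
  qed
  thus ?thesis by (auto simp: scaleC_of_real)
qed

lemma model_gen_involution: "i < m \<Longrightarrow> x \<in> model_space \<Longrightarrow> model_gen i (model_gen i x) = x"
  using model_gen_gen[of i i x] by (simp add: scaleR_2[symmetric])

lemma model_gen_sym:
  assumes "i < m" "x \<in> model_space" "y \<in> model_space"
  shows "cinner (model_gen i x) y = cinner x (model_gen i y)"
  using model_opD(5)[OF model_gen[OF assms(1)] assms(2) model_opD(4)[OF model_gen[OF assms(1)] assms(3)]]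
    model_gen_involution[OF assms(1,3)] by simp

definition model_rep :: "('v, ell2) hc_rep"
  where "model_rep = \<lparr>
    even_part = ccspan (model_vec ` {(g, A) \<in> fam_index. even (card A)}),
    odd_part = ccspan (model_vec ` {(g, A) \<in> fam_index. odd (card A)}),
    grp_op = model_grp,
    odd_op = (\<lambda>X v. \<Sum>i<m. (lam / 2 * hc_form D (fst X) (u i)) *\<^sub>R model_gen i v)\<rparr>"

lemma model_rep_simps:
  "even_part model_rep = ccspan (model_vec ` {(g, A) \<in> fam_index. even (card A)})"
  "odd_part model_rep = ccspan (model_vec ` {(g, A) \<in> fam_index. odd (card A)})"
  "grp_op model_rep = model_grp"
  "odd_op model_rep X v = (\<Sum>i<m. (lam / 2 * hc_form D (fst X) (u i)) *\<^sub>R model_gen i v)"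
  by (simp_all add: model_rep_def)

lemma model_graded: "graded_hilbert model_rep"
proof -
  have "cinner x y = 0" if x: "x \<in> even_part model_rep" and y: "y \<in> odd_part model_rep" for x y
  proof -
    have 1: "cinner a b = 0" if "a \<in> model_vec ` {(g, A) \<in> fam_index. even (card A)}"
      "b \<in> model_vec ` {(g, A) \<in> fam_index. odd (card A)}" for a b
      using that by (auto simp: cinner_model_vec)
    have 2: "cinner a x = 0" if "a \<in> model_vec ` {(g, A) \<in> fam_index. odd (card A)}" for a
    proof -
      have "cinner x a = cinner x 0"
        by (rule cinner_eq_on_ccspan[OF _ x[unfolded model_rep_simps]]) (use 1 that in auto)
      thus ?thesis using cinner_commute[of a x] by simp
    qed
    have "cinner y x = cinner y 0"
      by (rule cinner_eq_on_ccspan[OF _ y[unfolded model_rep_simps]]) (use 2 in auto)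
    thus ?thesis using cinner_commute[of x y] by simp
  qed
  thus ?thesis unfolding graded_hilbert_def by (simp add: model_rep_simps csubspace_ccspan closed_ccspan)
qed

lemma model_parts: "even_part model_rep \<subseteq> model_space" "odd_part model_rep \<subseteq> model_space"
  unfolding model_rep_simps model_space_def by (intro ccspan_mono; auto)+

lemma model_rep_space: "rep_space model_rep = model_space"
proof
  show "rep_space model_rep \<subseteq> model_space"
    unfolding rep_space_def using model_parts model_sub(3) by blast
  show "model_space \<subseteq> rep_space model_rep"
    unfolding model_space_def
  proof (intro ccspan_minimal rep_space_props(1,2)[OF model_graded])
    show "model_vec ` fam_index \<subseteq> rep_space model_rep"
    proof clarify
      fix g A assume p: "(g, A) \<in> fam_index"
      have "model_vec (g, A) \<in> even_part model_rep \<or> model_vec (g, A) \<in> odd_part model_rep"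
        using p unfolding model_rep_simps by (cases "even (card A)") (auto intro!: ccspan_base)
      thus "model_vec (g, A) \<in> rep_space model_rep" using rep_space_props(3,4)[OF model_graded] by blast
    qed
  qed
qed

lemma model_op_ccspan:
  assumes T: "model_op s T" and B: "\<And>p. p \<in> P \<Longrightarrow> T (model_vec p) \<in> ccspan Q" and x: "x \<in> ccspan (model_vec ` P)"
  shows "T x \<in> ccspan Q"
proof -
  obtain C where C: "\<And>x. norm (T x) \<le> norm x * C" using bounded_linear.bounded[OF model_opD(1)[OF T]] by blast
  show ?thesis
    by (rule image_ccspan[of UNIV "model_vec ` P" T C])
      (use C B x model_opD(9)[OF T] closed_ccspan csubspace_ccspan csubspace_UNIV in \<open>auto simp: mult.commute\<close>)
qed

lemma continuous_model_vec: "continuous_on S (\<lambda>g. model_vec (hc_mult D g k, A))"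
proof -
  have "linear (\<lambda>g :: 'v \<times> real. (0 :: 'v, hc_form D (fst g) (fst k)))"
    by (rule linearI) (auto simp: hc_form_simps)
  hence "continuous_on S (\<lambda>g. hc_mult D g k)"
    unfolding hc_mult_def hc_bracket_def by (intro continuous_intros linear_continuous_on) (simp add: linear_conv_bounded_linear)
  hence "continuous_on S (\<lambda>g. phi (hc_mult D g k))"
    using continuous_on_compose2[OF Ck_on_continuous[OF Ck_on_phi[of 0 UNIV]]] by blast
  thus ?thesis unfolding model_vec_def prod.case
    by (rule bounded_bilinear.continuous_on[OF bounded_bilinear_tensor _ continuous_on_const])
qed

text \<open>Vectors with continuous orbit maps form a closed subspace: the operators are isometric,
  so convergent vectors have uniformly convergent orbit maps. For the total family continuity is
  that of \<open>phi\<close>.\<close>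

lemma model_grp_continuous:
  assumes x: "x \<in> model_space"
  shows "continuous_on (hc_N0 D) (\<lambda>g. model_grp g x)"
proof -
  define Z where "Z = {v \<in> model_space. continuous_on (hc_N0 D) (\<lambda>g. model_grp g v)}"
  have cong: "v \<in> Z" if "continuous_on (hc_N0 D) f" "\<And>g. g \<in> hc_N0 D \<Longrightarrow> f g = model_grp g v" "v \<in> model_space" for f v
    using that continuous_on_cong[of "hc_N0 D" "hc_N0 D" f] by (auto simp: Z_def)
  have "model_space \<subseteq> Z"
    unfolding model_space_def
  proof (rule ccspan_minimal)
    show "model_vec ` fam_index \<subseteq> Z"
    proof clarify
      fix g A assume p: "(g, A) \<in> fam_index"
      show "model_vec (g, A) \<in> Z"
        by (rule cong[OF continuous_model_vec[of _ g A]]) (use p in \<open>auto simp: model_grp_vec intro: model_vec_in\<close>)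
    qed
    show "csubspace Z"
    proof (rule csubspaceI)
      have "model_grp g 0 = 0" if "g \<in> hc_N0 D" for g using model_opD(2)[OF model_grp[OF that], of 0 0] by simp
      thus "0 \<in> Z" by (intro cong[of "\<lambda>_. 0"]) (auto simp: model_sub)
      show "v + w \<in> Z" if "v \<in> Z" "w \<in> Z" for v w
        by (rule cong[of "\<lambda>g. model_grp g v + model_grp g w"])
          (use that in \<open>auto simp: Z_def model_opD(6)[OF model_grp] intro!: continuous_intros model_sub\<close>)
      show "c *\<^sub>C v \<in> Z" if "v \<in> Z" for c v
        by (rule cong[of "\<lambda>g. c *\<^sub>C model_grp g v"])
          (use that in \<open>auto simp: Z_def model_opD(2)[OF model_grp] intro!: continuous_on_scaleC continuous_intros model_sub\<close>)
    qed
    show "closed Z"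
      unfolding closed_sequential_limits
    proof (intro allI impI)
      fix f v assume "(\<forall>n. f n \<in> Z) \<and> f \<longlonglongrightarrow> v"
      hence f: "\<And>n. f n \<in> Z" "f \<longlonglongrightarrow> v" by auto
      have fS: "f n \<in> model_space" for n using f(1) by (simp add: Z_def)
      have vS: "v \<in> model_space" by (rule closed_sequentially[OF model_closed fS f(2)])
      have "continuous_on (hc_N0 D) (\<lambda>g. model_grp g v)"
      proof (rule uniform_limit_theorem)
        show "\<forall>\<^sub>F n in sequentially. continuous_on (hc_N0 D) (\<lambda>g. model_grp g (f n))"
          using f(1) by (simp add: Z_def)
        show "uniform_limit (hc_N0 D) (\<lambda>n g. model_grp g (f n)) (\<lambda>g. model_grp g v) sequentially"
        proof (rule uniform_limitI)
          fix e :: real assume "e > 0"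
          hence "\<forall>\<^sub>F n in sequentially. dist (f n) v < e" using f(2) by (rule tendstoD[rotated])
          thus "\<forall>\<^sub>F n in sequentially. \<forall>g\<in>hc_N0 D. dist (model_grp g (f n)) (model_grp g v) < e"
          proof eventually_elim
            case (elim n)
            have "dist (model_grp g (f n)) (model_grp g v) = dist (f n) v" if "g \<in> hc_N0 D" for g
              using model_op_norm[OF model_grp[OF that] model_sub(4)[OF fS vS]]
              by (simp add: dist_norm model_opD(7)[OF model_grp[OF that]])
            thus ?case using elim by simp
          qed
        qed
      qed simp
      thus "v \<in> Z" using vS by (simp add: Z_def)
    qed
  qed
  thus ?thesis using x by (auto simp: Z_def)
qed

lemma model_group_rep: "even_unitary_group_rep D model_rep"
  unfolding even_unitary_group_rep_def model_rep_space
proof (intro conjI ballI)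
  fix g assume g: "g \<in> hc_N0 D"
  note G = model_grp[OF g]
  show "clinear_on model_space (grp_op model_rep g)" using model_opD(9)[OF G] by (simp add: model_rep_simps)
  have part: "model_grp g ` ccspan (model_vec ` {(g, A) \<in> fam_index. P A}) \<subseteq> ccspan (model_vec ` {(g, A) \<in> fam_index. P A})" for P
  proof (rule image_subsetI, rule model_op_ccspan[OF G, rotated], assumption)
    fix p assume "p \<in> {(g, A) \<in> fam_index. P A}"
    then obtain k A where p: "p = (k, A)" "(k, A) \<in> fam_index" "P A" by auto
    thus "model_grp g (model_vec p) \<in> ccspan (model_vec ` {(g, A) \<in> fam_index. P A})"
      using fam_index_mult[OF g p(2)] g by (auto simp: model_grp_vec intro: ccspan_base[OF imageI])
  qed
  show "grp_op model_rep g ` even_part model_rep \<subseteq> even_part model_rep"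
    "grp_op model_rep g ` odd_part model_rep \<subseteq> odd_part model_rep"
    unfolding model_rep_simps by (rule part)+
  show "cinner (grp_op model_rep g v) (grp_op model_rep g w) = cinner v w" if "v \<in> model_space" "w \<in> model_space" for v w
    using model_opD(5)[OF G that] by (simp add: model_rep_simps)
next
  show "grp_op model_rep hc_one v = v" if "v \<in> model_space" for v
    using model_grp_centre[OF that, of 0] by (simp add: model_rep_simps hc_one_def zero_prod_def)
next
  fix g h v assume "g \<in> hc_N0 D" "h \<in> hc_N0 D" "v \<in> model_space"
  thus "grp_op model_rep (hc_mult D g h) v = grp_op model_rep g (grp_op model_rep h v)"
    by (simp add: model_rep_simps model_grp_mult)
next
  fix v assume "v \<in> model_space"
  thus "continuous_on (hc_N0 D) (\<lambda>g. grp_op model_rep g v)" by (simp add: model_rep_simps model_grp_continuous)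
qed

end

section \<open>The odd operators of the model\<close>

context hc_frame
begin

abbreviation odd_coeff :: "'v \<times> real \<Rightarrow> nat \<Rightarrow> real"
  where "odd_coeff X i \<equiv> lam / 2 * hc_form D (fst X) (u i)"

abbreviation model_odd :: "'v \<times> real \<Rightarrow> ell2 \<Rightarrow> ell2"
  where "model_odd X v \<equiv> (\<Sum>i<m. odd_coeff X i *\<^sub>R model_gen i v)"

lemma model_odd_bounded_linear: "bounded_linear (model_odd X)"
  by (intro bounded_linear_sum bounded_linear_scaleR_const model_opD(1)[OF model_gen]
      bounded_linear_compose[OF bounded_linear_scaleR_right]) auto

lemma model_odd_scaleC: "model_odd X (c *\<^sub>C v) = c *\<^sub>C model_odd X v"
  unfolding linear_sum[OF bounded_linear.linear[OF bounded_linear_scaleC]]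
  by (rule sum.cong) (auto simp: model_opD(2)[OF model_gen] scaleR_eq_scaleC scaleC_scaleC mult.commute)

lemma model_odd_in: "v \<in> model_space \<Longrightarrow> model_odd X v \<in> model_space"
  by (intro subspace_sum[OF model_sub(1)] model_sub(7) model_opD(4)[OF model_gen]) auto

lemma model_odd_grp:
  assumes "h \<in> hc_N0 D" "v \<in> model_space"
  shows "model_grp h (model_odd X v) = model_odd X (model_grp h v)"
  using assms model_opD(1)[OF model_grp[OF assms(1)]]
  by (simp add: linear_sum[OF bounded_linear.linear] linear_scale[OF bounded_linear.linear] model_gen_grp)

lemma odd_form_expand:
  assumes "X \<in> hc_n1 D" "Y \<in> hc_n1 D"
  shows "lam * hc_form D (fst X) (fst Y) = (\<Sum>i<m. 2 * (odd_coeff X i * odd_coeff Y i))"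
proof -
  have X: "fst X \<in> hc_odd D" and Y: "fst Y \<in> hc_odd D" using assms by (auto simp: hc_n1_def)
  have lin: "linear (\<lambda>Z. hc_form D Z (fst Y))" using hcD(4) by (simp add: bilinear_def)
  have "hc_form D (fst X) (fst Y) = hc_form D (\<Sum>i<m. odd_coeff X i *\<^sub>R u i) (fst Y)"
    using u_expand[OF X] by simp
  also have "\<dots> = (\<Sum>i<m. odd_coeff X i * hc_form D (u i) (fst Y))"
    by (simp add: linear_sum[OF lin] linear_scale[OF lin])
  finally show ?thesis
    using hcD(7)[OF u_in Y] by (simp add: sum_distrib_left mult_ac)
qed

lemma model_odd_anticommute:
  assumes X: "X \<in> hc_n1 D" "Y \<in> hc_n1 D" and v: "v \<in> model_space"
  shows "model_odd X (model_odd Y v) + model_odd Y (model_odd X v) = (lam * hc_form D (fst X) (fst Y)) *\<^sub>R v"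
proof -
  have expand: "model_odd X (model_odd Y v) = (\<Sum>i<m. \<Sum>j<m. (odd_coeff X i * odd_coeff Y j) *\<^sub>R model_gen i (model_gen j v))" for X Y
    using model_opD(1)[OF model_gen]
    by (simp add: linear_sum[OF bounded_linear.linear] linear_scale[OF bounded_linear.linear] scaleR_sum_right)
  have "model_odd Y (model_odd X v) = (\<Sum>i<m. \<Sum>j<m. (odd_coeff X i * odd_coeff Y j) *\<^sub>R model_gen j (model_gen i v))"
    unfolding expand by (subst sum.swap) (simp add: mult.commute)
  hence "model_odd X (model_odd Y v) + model_odd Y (model_odd X v) =
      (\<Sum>i<m. \<Sum>j<m. (odd_coeff X i * odd_coeff Y j) *\<^sub>R (model_gen i (model_gen j v) + model_gen j (model_gen i v)))"
    unfolding expand[of X Y] by (simp only: sum.distrib[symmetric] scaleR_add_right[symmetric])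
  also have "\<dots> = (\<Sum>i<m. \<Sum>j<m. if j = i then (2 * (odd_coeff X i * odd_coeff Y i)) *\<^sub>R v else 0)"
    by (intro sum.cong refl) (use v in \<open>auto simp: model_gen_gen\<close>)
  also have "\<dots> = (\<Sum>i<m. 2 * (odd_coeff X i * odd_coeff Y i)) *\<^sub>R v"
    by (simp add: scaleR_sum_left)
  finally show ?thesis by (simp only: odd_form_expand[OF X])
qed

lemma model_odd_sym:
  assumes "v \<in> model_space" "w \<in> model_space"
  shows "cinner (model_odd X v) w = cinner v (model_odd X w)"
proof -
  have "cinner (model_odd X v) w = (\<Sum>i<m. of_real (odd_coeff X i) * cinner (model_gen i v) w)"
    by (simp add: cinner_sum_left scaleR_eq_scaleC cinner_scaleC_left)
  also have "\<dots> = (\<Sum>i<m. of_real (odd_coeff X i) * cnj (cinner (model_gen i w) v))"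
    by (intro sum.cong refl) (use assms model_gen_sym cinner_commute in \<open>metis lessThan_iff\<close>)
  also have "\<dots> = cnj (cinner (model_odd X w) v)"
    by (simp add: cinner_sum_left scaleR_eq_scaleC cinner_scaleC_left)
  also have "\<dots> = cinner v (model_odd X w)" by (rule cinner_commute[symmetric])
  finally show ?thesis .
qed

lemma model_odd_parity:
  "v \<in> even_part model_rep \<Longrightarrow> model_odd X v \<in> odd_part model_rep"
  "v \<in> odd_part model_rep \<Longrightarrow> model_odd X v \<in> even_part model_rep"
proof -
  have gen: "model_gen i w \<in> ccspan (model_vec ` {(g, A) \<in> fam_index. Q A})"
    if "i < m" "w \<in> ccspan (model_vec ` {(g, A) \<in> fam_index. P A})" "\<And>A l. finite A \<Longrightarrow> P A \<Longrightarrow> Q (toggle l A)"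
    for i w P Q
  proof (rule model_op_ccspan[OF model_gen[OF that(1)] _ that(2)])
    fix p assume "p \<in> {(g, A) \<in> fam_index. P A}"
    then obtain g A where p: "p = (g, A)" "(g, A) \<in> fam_index" "P A" by auto
    hence "(g, toggle (i div 2) A) \<in> {(g, A) \<in> fam_index. Q A}"
      using fam_index_toggle[OF that(1) p(2)] that(3) fam_index_finite by auto
    thus "model_gen i (model_vec p) \<in> ccspan (model_vec ` {(g, A) \<in> fam_index. Q A})"
      unfolding p(1) model_gen_vec[OF that(1) p(2)] by (intro csubspaceD(5)[OF csubspace_ccspan] ccspan_base imageI)
  qed
  show "model_odd X v \<in> odd_part model_rep" if "v \<in> even_part model_rep"
    using that unfolding model_rep_simps
    by (intro subspace_sum[OF csubspaceD(1)[OF csubspace_ccspan]] csubspaceD(7)[OF csubspace_ccspan] gen)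
      (auto simp: even_card_toggle)
  show "model_odd X v \<in> even_part model_rep" if "v \<in> odd_part model_rep"
    using that unfolding model_rep_simps
    by (intro subspace_sum[OF csubspaceD(1)[OF csubspace_ccspan]] csubspaceD(7)[OF csubspace_ccspan] gen)
      (auto simp: even_card_toggle)
qed

lemma model_unitary: "unitary_rep D model_rep"
proof -
  have in_space: "v \<in> model_space" if "v \<in> smooth_vectors D model_rep" for v
    using that by (simp add: smooth_vectors_def model_rep_space)
  have odd_op: "odd_op model_rep X = model_odd X" for X by (simp add: fun_eq_iff model_rep_simps)
  \<comment> \<open>A bounded operator commuting with the group carries smooth orbit maps to smooth
    orbit maps.\<close>
  have smooth: "model_odd X v \<in> smooth_vectors D model_rep" if v: "v \<in> smooth_vectors D model_rep" for X v
  proof -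
    have "Ck_on k (hc_N0 D) (\<lambda>g. model_grp g (model_odd X v))" for k
    proof (rule Ck_on_cong[OF _ Ck_on_bounded_linear_comp[OF model_odd_bounded_linear[of X]]])
      show "model_odd X (model_grp g v) = model_grp g (model_odd X v)" if "g \<in> hc_N0 D" for g
        by (rule model_odd_grp[OF that in_space[OF v], symmetric])
      show "Ck_on k (hc_N0 D) (\<lambda>g. model_grp g v)"
        using v by (simp add: smooth_vectors_def smooth_on_def model_rep_simps(3))
    qed
    thus ?thesis using model_odd_in[OF in_space[OF v]]
      by (simp add: smooth_vectors_def smooth_on_def model_rep_space model_rep_simps(3))
  qed
  have add: "model_odd X (v + w) = model_odd X v + model_odd X w" for X v w
    by (rule linear_add[OF bounded_linear.linear[OF model_odd_bounded_linear]])
  show ?thesis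
    unfolding unitary_rep_def odd_op
  proof (intro conjI model_graded model_group_rep ballI allI)
    fix X assume X: "X \<in> hc_n1 D"
    show "model_odd X ` smooth_vectors D model_rep \<subseteq> smooth_vectors D model_rep" using smooth by blast
    show "clinear_on (smooth_vectors D model_rep) (model_odd X)"
      unfolding clinear_on_def using add model_odd_scaleC by blast
    show "model_odd X ` (smooth_vectors D model_rep \<inter> even_part model_rep) \<subseteq> odd_part model_rep"
      "model_odd X ` (smooth_vectors D model_rep \<inter> odd_part model_rep) \<subseteq> even_part model_rep"
      using model_odd_parity by blast+
    fix v assume v: "v \<in> smooth_vectors D model_rep"
    show "model_odd (r *\<^sub>R X) v = r *\<^sub>R model_odd X v" for r
      by (simp add: hc_form_simps scaleR_sum_right mult_ac)
    show "cinner (model_odd X v) w = cinner v (model_odd X w)" if "w \<in> smooth_vectors D model_rep" for w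
      by (rule model_odd_sym[OF in_space[OF v] in_space[OF that]])
    show "model_odd (hc_act D g X) v = grp_op model_rep g (model_odd X (grp_op model_rep (hc_inv g) v))"
      if g: "g \<in> hc_N0 D" for g
    proof -
      have "hc_act D g X = X" using hcD(5)[of "fst g" "fst X"] g X by (cases X) (auto simp: N0_iff hc_n1_def hc_act_def hc_bracket_def)
      moreover have "hc_inv g \<in> hc_N0 D" using g by (simp add: N0_iff hc_inv_def sub_even)
      moreover have "model_grp g (model_grp (hc_inv g) v) = v"
      proof -
        have "hc_form D (fst g) (fst g) = 0"
          using hc g unfolding heisenberg_clifford_def N0_iff by (metis add.inverse_inverse equal_neg_zero)
        hence "hc_mult D g (hc_inv g) = (0, 0)" by (simp add: hc_mult_def hc_bracket_def hc_inv_def hc_form_simps zero_prod_def)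
        thus ?thesis using model_grp_mult[OF g calculation(2) in_space[OF v]] model_grp_centre[OF in_space[OF v], of 0] by simp
      qed
      moreover have "model_grp (hc_inv g) v \<in> model_space"
        using model_opD(4)[OF model_grp[OF calculation(2)] in_space[OF v]] .
      ultimately show ?thesis using model_odd_grp[OF g] by (simp add: model_rep_simps(3))
    qed
    fix Y assume Y: "Y \<in> hc_n1 D"
    show "model_odd (X + Y) v = model_odd X v + model_odd Y v"
      by (simp add: hc_form_simps distrib_left scaleR_add_left sum.distrib)
    have "inf_action model_rep (0, b) v = (\<i> * of_real (lam * b)) *\<^sub>C v" for b
      by (rule inf_action_centre) (simp add: model_rep_simps(3) model_grp_centre[OF in_space[OF v]])
    thus "model_odd X (model_odd Y v) + model_odd Y (model_odd X v) = (- \<i>) *\<^sub>C inf_action model_rep (hc_bracket D X Y) v"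
      unfolding model_odd_anticommute[OF X Y in_space[OF v]]
      by (simp add: hc_bracket_def scaleC_scaleC scaleR_eq_scaleC)
  qed
qed

lemma model_is_rep: "is_rep model_rep"
proof -
  have "has_central_character model_rep chi"
    unfolding has_central_character_def hc_centre_def hc_exp_def model_rep_space
    by (auto simp: model_rep_simps model_grp_centre chi)
  thus ?thesis using model_unitary by (simp add: is_rep_def)
qed

section \<open>Pure vacua and irreducibility of the model\<close>

definition model_vacuum :: ell2
  where "model_vacuum = model_vec ((0, 0), {})"

lemma vacuum_index: "((0, 0), {}) \<in> fam_index"
  by (simp add: fam_index_def N0_iff sub_even)

lemma index_zero: "A \<subseteq> letters \<Longrightarrow> ((0, 0), A) \<in> fam_index"
  by (simp add: fam_index_def N0_iff sub_even)

lemma rho_model_rep: "i < m \<Longrightarrow> v \<in> model_space \<Longrightarrow> rho model_rep (u i) v = model_gen i v"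
proof -
  assume i: "i < m" and v: "v \<in> model_space"
  have "rho model_rep (u i) v = (\<Sum>j<m. if j = i then model_gen i v else 0)"
    unfolding rho_def model_rep_simps by (intro sum.cong refl) (use i u_orth[of i] in auto)
  thus ?thesis using i by simp
qed

lemma norm_model_vacuum: "cinner model_vacuum model_vacuum = 1"
  using cinner_model_vec[OF vacuum_index vacuum_index]
  by (simp add: model_vacuum_def cinner_phi herm_def qf_def co_simps)

lemma model_pure_vac: "pure_vac model_rep model_vacuum"
  unfolding pure_vac_def[OF model_is_rep]
proof (intro conjI allI impI)
  have in_space: "model_vacuum \<in> model_space" unfolding model_vacuum_def by (rule model_vec_in[OF vacuum_index])
  show "vac model_rep model_vacuum"
    unfolding vac_def[OF model_is_rep] model_rep_space
  proof (intro conjI ballI in_space)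
    fix w assume w: "w \<in> hc_even D"
    have "wop model_rep w model_vacuum = model_vec ((w, 0), {})"
      using model_grp_vec[OF _ vacuum_index, of "(w, 0)"] w
      by (simp add: wop_def model_rep_simps model_vacuum_def N0_iff hc_mult_def hc_bracket_def hc_form_simps)
    moreover have "((w, 0), {}) \<in> fam_index" using w by (simp add: fam_index_def N0_iff)
    ultimately have "cinner (wop model_rep w model_vacuum) model_vacuum = cinner (phi (w, 0)) (phi (0, 0))"
      by (simp add: model_vacuum_def cinner_model_vec vacuum_index)
    also have "\<dots> = of_real (exp (- qf w))"
      by (simp add: cinner_phi herm_def qf_def co_simps exp_of_real[symmetric])
    finally show "cinner (wop model_rep w model_vacuum) model_vacuum = of_real (exp (- qf w)) * cinner model_vacuum model_vacuum"
      by (simp add: norm_model_vacuum)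
  qed
  have "model_vacuum \<in> even_part model_rep"
    unfolding model_vacuum_def model_rep_simps by (intro ccspan_base imageI) (use vacuum_index in auto)
  thus "model_vacuum \<in> even_part model_rep \<or> model_vacuum \<in> odd_part model_rep" ..
  fix l assume l: "Suc (2 * l) < m"
  have l': "l \<in> letters" "2 * l < m" using l by (auto simp: letters_def)
  \<comment> \<open>The generator with odd index gives \<open>- \<i>\<close> times the vector of
    letter \<open>l\<close>, the one with even index leads back to the vacuum, and the factor
    \<open>\<i>\<close> of the chirality cancels the scalar.\<close>
  have "rho model_rep (u (Suc (2 * l))) model_vacuum = (- \<i>) *\<^sub>C model_vec ((0, 0), {l})"
    using l in_space vacuum_index
    by (simp add: rho_model_rep model_gen_vec model_vacuum_def clifford_coeff_def order_sign_def toggle_simps)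
  moreover have "{i \<in> {l}. i < l} = {}" by auto
  hence os: "order_sign l {l} = 1" unfolding order_sign_def by (simp only: card.empty power_0)
  have "rho model_rep (u (2 * l)) ((- \<i>) *\<^sub>C model_vec ((0, 0), {l})) = (- \<i>) *\<^sub>C model_vacuum"
    using l' index_zero[of "{l}"] model_vec_in[OF index_zero[of "{l}"]] model_sub(5)[OF model_vec_in[OF index_zero[of "{l}"]], of "- \<i>"]
    by (simp add: rho_model_rep model_opD(2)[OF model_gen] model_opD(2)[OF model_gen, of _ "- \<i>"] model_gen_vec model_vacuum_def clifford_coeff_def os toggle_simps
       del: scaleC_minus_left)
  ultimately show "chirality model_rep l model_vacuum = model_vacuum"
    by (simp only: chirality_def[OF model_is_rep]) (simp add: scaleC_scaleC)
qed

lemma model_spinor: "A \<subseteq> letters \<Longrightarrow> spinor model_rep model_vacuum A = model_vec ((0, 0), A)"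
proof (induction A rule: letters_induct)
  case empty
  show ?case by (simp add: spinor_empty[OF model_is_rep] model_vacuum_def)
next
  case (insert a A)
  have a: "2 * a < m" using insert by (simp add: letters_def)
  have "spinor model_rep model_vacuum (insert a A) = rho model_rep (u (2 * a)) (spinor model_rep model_vacuum A)"
    by (rule spinor_insert'[OF model_is_rep insert(2)]) (rule insert(3))
  also have "\<dots> = model_gen (2 * a) (model_vec ((0, 0), A))"
    using insert(4) rho_model_rep[OF a model_vec_in[OF index_zero[OF insert(2)]]] by simp
  also have "\<dots> = clifford_coeff (2 * a) A *\<^sub>C model_vec ((0, 0), toggle a A)"
    using model_gen_vec[OF a index_zero[OF insert(2)]] by simp
  also have "clifford_coeff (2 * a) A = 1"
  proof -
    have "{i \<in> A. i < a} = {}" using insert(3) by force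
    hence "order_sign a A = 1" unfolding order_sign_def by (simp only: card.empty power_0)
    thus ?thesis by (simp add: clifford_coeff_def)
  qed
  also have "toggle a A = insert a A" using insert(3) by (intro toggle_simps) blast
  finally show ?case by simp
qed

text \<open>The vectors on which the model was built are the family of its own vacuum, so the
  results on general representations apply to them.\<close>

lemma model_fam: "(g, A) \<in> fam_index \<Longrightarrow> fam model_rep model_vacuum (g, A) = model_vec (g, A)"
proof -
  assume p: "(g, A) \<in> fam_index"
  hence A: "A \<subseteq> letters" and g: "g \<in> hc_N0 D" by (auto simp: fam_index_def)
  have "hc_mult D g (0, 0) = g" by (simp add: hc_mult_def hc_bracket_def hc_form_simps flip: zero_prod_def)
  thus ?thesis
    using model_grp_vec[OF g index_zero[OF A]] by (simp add: fam_def[OF model_is_rep] model_spinor[OF A] model_rep_simps)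
qed

text \<open>The pure vacua of the model are the multiples of \<open>model_vacuum\<close>, possibly moved by an
  unpaired last generator.\<close>

lemma pure_vac_orthogonal:
  assumes x: "pure_vac model_rep x" and p: "(g, A) \<in> fam_index" and l: "Suc (2 * l) < m" "l \<in> A"
  shows "cinner (model_vec (g, A)) x = 0"
proof -
  obtain w t where g: "g = (w, t)" by (meson surj_pair)
  have w: "w \<in> hc_even D" and A: "A \<subseteq> letters" using p by (auto simp: fam_index_def N0_iff g)
  note R = model_is_rep
  note vx = pure_vacD(1)[OF R x] and v0 = pure_vacD(1)[OF R model_pure_vac]
  have s: "spinor model_rep model_vacuum A \<in> smooth_vectors D model_rep" by (rule spinor_smooth[OF R v0 A])
  have "chirality model_rep l (fam model_rep model_vacuum (g, A)) = - fam model_rep model_vacuum (g, A)"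
    using chirality_grp[OF R l(1) w s, of t] chirality_spinor[OF R model_pure_vac l(1) A] l(2)
      clinear_onD(2)[OF grp_facts(1)[OF R w] smooth_in[OF R s], of t "- 1"]
    by (simp add: fam_def[OF R] g)
  hence "- cinner (fam model_rep model_vacuum (g, A)) x = cinner (fam model_rep model_vacuum (g, A)) x"
    using chirality_sym[OF R l(1) fam_smooth[OF R v0 p] vac_smooth[OF R vx]] pure_vacD(3)[OF R x l(1)] by simp
  thus ?thesis using model_fam[OF p] by simp
qed

text \<open>Coefficients against the total family are compared. A letter set with a paired letter is
  excluded by its chirality, the unpaired letter alone by the grading, and for the empty set
  \<open>vac_pair\<close> gives proportional coefficients.\<close>

lemma even_pure_vac:
  assumes x: "pure_vac model_rep x" "x \<in> even_part model_rep"
  shows "x = cinner x model_vacuum *\<^sub>C model_vacuum"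
proof (rule eq_if_cinner_eq_on_total[where B = "model_vec ` fam_index"])
  note R = model_is_rep
  note vx = pure_vacD(1)[OF R x(1)] and v0 = pure_vacD(1)[OF R model_pure_vac]
  have xS: "x \<in> model_space" using vac_in[OF R vx] model_rep_space by simp
  have vS: "model_vacuum \<in> model_space" using vac_in[OF R v0] model_rep_space by simp
  show "x \<in> ccspan (model_vec ` fam_index)" "cinner x model_vacuum *\<^sub>C model_vacuum \<in> ccspan (model_vec ` fam_index)"
    using xS model_sub(5)[OF vS] unfolding model_space_def by auto
  fix b assume "b \<in> model_vec ` fam_index"
  then obtain w t A where p: "((w, t), A) \<in> fam_index" and b: "b = model_vec ((w, t), A)" by auto
  have w: "w \<in> hc_even D" and A: "A \<subseteq> letters" using p by (auto simp: fam_index_def N0_iff)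
  show "cinner b x = cinner b (cinner x model_vacuum *\<^sub>C model_vacuum)"
  proof (cases "A = {}")
    case True
    have bw: "b = cis (lam * t) *\<^sub>C wop model_rep w model_vacuum"
      using model_fam[OF p] grp_wop[OF R w vac_in[OF R v0], of t] True
      by (simp add: b fam_def[OF R] spinor_empty[OF R])
    have "cinner (wop model_rep w model_vacuum) x = of_real (exp (- qf w)) * cinner model_vacuum x"
      "cinner (wop model_rep w model_vacuum) model_vacuum = of_real (exp (- qf w)) * cinner model_vacuum model_vacuum"
      by (rule vac_pair[OF R v0 vx w], rule vac_pair[OF R v0 v0 w])
    thus ?thesis unfolding bw
      by (simp add: cinner_scaleC_left cinner_scaleC_right norm_model_vacuum cinner_commute[of model_vacuum x])
  next
    case False
    have "cinner b model_vacuum = 0"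
      using False unfolding b model_vacuum_def cinner_model_vec[OF p vacuum_index] by simp
    moreover have "cinner b x = 0"
    proof (cases "\<exists>l\<in>A. Suc (2 * l) < m")
      case True
      thus ?thesis using pure_vac_orthogonal[OF x(1) p] b by blast
    next
      case noPair: False
      obtain l where l: "l \<in> A" using False by blast
      have only: "A = {l}"
      proof -
        have "i = l" if "i \<in> A" for i
        proof -
          have "\<not> Suc (2 * i) < m" "\<not> Suc (2 * l) < m" "2 * i < m" "2 * l < m"
            using noPair that l A by (auto simp: letters_def)
          thus ?thesis by linarith
        qed
        thus ?thesis using l by blast
      qed
      have "b \<in> odd_part model_rep"
        unfolding b model_rep_simps by (intro ccspan_base imageI) (use p only in auto)
      thus ?thesis using part_sub(6)[OF R] x(2) by blast
    qed
    ultimately show ?thesis by (simp add: cinner_scaleC_right)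
  qed
qed

text \<open>Without an unpaired letter the chiralities handle every nonempty letter set and the
  grading the empty one, so nothing is left.\<close>

lemma odd_pure_vac_zero:
  assumes x: "pure_vac model_rep x" "x \<in> odd_part model_rep" and paired: "\<And>l. l \<in> letters \<Longrightarrow> Suc (2 * l) < m"
  shows "x = 0"
proof (rule eq_if_cinner_eq_on_total[where B = "model_vec ` fam_index"])
  note R = model_is_rep
  show "x \<in> ccspan (model_vec ` fam_index)" "0 \<in> ccspan (model_vec ` fam_index)"
    using vac_in[OF R pure_vacD(1)[OF R x(1)]] model_rep_space model_sub(2) unfolding model_space_def by auto
  fix b assume "b \<in> model_vec ` fam_index"
  then obtain g A where p: "(g, A) \<in> fam_index" and b: "b = model_vec (g, A)" by auto
  show "cinner b x = cinner b 0"
  proof (cases "A = {}")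
    case True
    hence "b \<in> even_part model_rep"
      unfolding b model_rep_simps by (intro ccspan_base imageI) (use p in auto)
    thus ?thesis using part_sub(5)[OF R] x(2) by simp
  next
    case False
    then obtain l where "l \<in> A" by blast
    moreover have "l \<in> letters" using p calculation by (auto simp: fam_index_def)
    ultimately show ?thesis using pure_vac_orthogonal[OF x(1) p paired] b by simp
  qed
qed

text \<open>A nonzero closed invariant subspace contains a pure vacuum. If it is odd, an unpaired
  generator exists and makes it even while preserving the chiralities; then it is a multiple of
  \<open>model_vacuum\<close>, which generates the whole family.\<close>

lemma model_irreducible: "irreducible_unitary_rep D model_rep"
  unfolding irreducible_unitary_rep_def
proof (intro conjI model_unitary allI impI)
  note R = model_is_rep
  have nz: "model_vacuum \<noteq> 0" using norm_model_vacuum by auto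
  have vS: "model_vacuum \<in> rep_space model_rep" by (rule vac_in[OF R pure_vacD(1)[OF R model_pure_vac]])
  thus "rep_space model_rep \<noteq> {0}" using nz by blast
  fix K assume K: "graded_invariant_subspace D model_rep K \<and> closed K"
  have Ks: "csubspace K" and Ksplit: "K = {x + y | x y. x \<in> K \<inter> even_part model_rep \<and> y \<in> K \<inter> odd_part model_rep}"
    and Kgrp: "\<And>g. g \<in> hc_N0 D \<Longrightarrow> grp_op model_rep g ` K \<subseteq> K"
    and Kodd: "\<And>X. X \<in> hc_n1 D \<Longrightarrow> odd_op model_rep X ` (K \<inter> smooth_vectors D model_rep) \<subseteq> K"
    using K unfolding graded_invariant_subspace_def by blast+
  have Ksub: "K \<subseteq> rep_space model_rep"
    by (subst Ksplit) (auto simp: rep_space_def)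
  have Kgen: "rho model_rep (u i) v \<in> K" if "i < m" "v \<in> K" "v \<in> smooth_vectors D model_rep" for i v
    using Kodd[of "(u i, 0)"] u_in[OF that(1)] that by (auto simp: hc_n1_def rho_def)
  show "K = {0} \<or> K = rep_space model_rep"
  proof (rule disjCI)
    assume ne: "K \<noteq> rep_space model_rep"
    show "K = {0}"
    proof (rule ccontr)
      assume "K \<noteq> {0}"
      then obtain x where x: "x \<in> K" "x \<noteq> 0" "pure_vac model_rep x"
        using pure_vac_exists[OF R conjunct1[OF K] conjunct2[OF K] Ksub] by blast
      have "\<exists>y\<in>K. y \<noteq> 0 \<and> pure_vac model_rep y \<and> y \<in> even_part model_rep"
        using pure_vacD(2)[OF R x(3)]
      proof
        assume odd: "x \<in> odd_part model_rep"
        then obtain l where l: "l \<in> letters" "\<not> Suc (2 * l) < m" using odd_pure_vac_zero[OF x(3)] x(2) by blast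
        have lm: "2 * l < m" using l by (simp add: letters_def)
        have xs: "x \<in> smooth_vectors D model_rep" by (rule vac_smooth[OF R pure_vacD(1)[OF R x(3)]])
        let ?y = "rho model_rep (u (2 * l)) x"
        have even: "?y \<in> even_part model_rep" using gen_parity(2)[OF R lm xs odd] .
        have "chirality model_rep k ?y = ?y" if k: "Suc (2 * k) < m" for k
        proof -
          have "k \<noteq> l" using k l by blast
          thus ?thesis using chirality_gen[OF R k lm xs] pure_vacD(3)[OF R x(3) k] by simp
        qed
        hence "pure_vac model_rep ?y"
          unfolding pure_vac_def[OF R] using even vac_rho[OF R pure_vacD(1)[OF R x(3)] u_in[OF lm]] by blast
        moreover have "?y \<noteq> 0"
        proof
          assume 0: "?y = 0"
          have "rho model_rep (u (2 * l)) ?y = x" by (rule gen_gen[OF R lm xs])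
          moreover have "rho model_rep (u (2 * l)) 0 = 0"
            using gen_scaleC[OF R lm xs, of 0] by simp
          ultimately show False using x(2) unfolding 0 by simp
        qed
        ultimately show ?thesis using even Kgen[OF lm x(1) xs] by blast
      qed (use x in blast)
      then obtain y where y: "y \<in> K" "y \<noteq> 0" "pure_vac model_rep y" "y \<in> even_part model_rep" by blast
      let ?c = "cinner y model_vacuum"
      have yc: "y = ?c *\<^sub>C model_vacuum" by (rule even_pure_vac[OF y(3,4)])
      hence "?c \<noteq> 0" using y(2) by auto
      hence "model_vacuum = (1 / ?c) *\<^sub>C y" by (subst yc) (simp add: scaleC_scaleC)
      hence vK: "model_vacuum \<in> K" using csubspaceD(5)[OF Ks y(1)] by metis
      have sK: "spinor model_rep model_vacuum A \<in> K" if "A \<subseteq> letters" for A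
        using that
      proof (induction A rule: letters_induct)
        case empty
        show ?case using vK by (simp add: spinor_empty[OF R])
      next
        case (insert a A)
        have a: "2 * a < m" using insert by (simp add: letters_def)
        have "spinor model_rep model_vacuum (insert a A) = rho model_rep (u (2 * a)) (spinor model_rep model_vacuum A)"
          by (rule spinor_insert'[OF R insert(2)]) (rule insert(3))
        thus ?case using Kgen[OF a insert(4) spinor_smooth[OF R pure_vacD(1)[OF R model_pure_vac] insert(2)]] by simp
      qed
      have "model_vec ` fam_index \<subseteq> K"
      proof clarify
        fix g A assume p: "(g, A) \<in> fam_index"
        hence "g \<in> hc_N0 D" "A \<subseteq> letters" by (auto simp: fam_index_def)
        hence "grp_op model_rep g (spinor model_rep model_vacuum A) \<in> K" using Kgrp sK by blast
        thus "model_vec (g, A) \<in> K" using model_fam[OF p] by (simp add: fam_def[OF R])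
      qed
      hence "model_space \<subseteq> K" unfolding model_space_def using Ks K by (intro ccspan_minimal) auto
      thus False using ne Ksub model_rep_space by blast
    qed
  qed
qed

end

section \<open>Existence of coordinates and the theorem\<close>

lemma bilinear_scaled: "bilinear f \<Longrightarrow> bilinear (\<lambda>x y. c * f x y :: real)"
  by (simp add: bilinear_def linear_iff distrib_left mult.left_commute)

lemma weyl_frame_exists:
  assumes hc: "heisenberg_clifford D" and chi: "\<And>t. chi (0, t) = cis (lam * t)" and lam: "lam \<noteq> 0"
  obtains n emb co where "weyl_frame D chi lam n emb co"
proof -
  \<comment> \<open>The factor absorbs \<open>lam\<close>, of either sign, into the form. The minus
    sign compensates that in the coordinates \<open>co\<close> below \<open>w v v'\<close> is minus
    the sum of the \<open>Im (co j v * cnj (co j v'))\<close>.\<close>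
  define w where "w = (\<lambda>v v'. (- lam / 2) * hc_form D v v')"
  have sub: "subspace (hc_even D)" "subspace (hc_odd D)" and bil: "bilinear (hc_form D)"
    and nondeg: "\<And>P. P \<in> hc_space D \<Longrightarrow> (\<And>Q. Q \<in> hc_space D \<Longrightarrow> hc_form D P Q = 0) \<Longrightarrow> P = 0"
    and mixed: "\<And>P Q. P \<in> hc_even D \<Longrightarrow> Q \<in> hc_odd D \<Longrightarrow> hc_form D P Q = 0"
    and alt: "\<And>P Q. P \<in> hc_even D \<Longrightarrow> Q \<in> hc_even D \<Longrightarrow> hc_form D P Q = - hc_form D Q P"
    using hc unfolding heisenberg_clifford_def by blast+
  have w_bil: "bilinear w"
    unfolding w_def by (rule bilinear_scaled[OF bil])
  have w_alt: "w P Q = - w Q P" if "P \<in> hc_even D" "Q \<in> hc_even D" for P Q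
    using alt[OF that] by (simp add: w_def)
  have w_nondeg: "P = 0" if P: "P \<in> hc_even D" and 0: "\<And>Q. Q \<in> hc_even D \<Longrightarrow> w P Q = 0" for P
  proof (rule nondeg)
    show "P \<in> hc_space D" using P subspace_0[OF sub(2)] unfolding hc_space_def by force
    fix Q assume "Q \<in> hc_space D"
    then obtain Q0 Q1 where "Q = Q0 + Q1" "Q0 \<in> hc_even D" "Q1 \<in> hc_odd D" unfolding hc_space_def by blast
    thus "hc_form D P Q = 0" using 0[of Q0] mixed[OF P] lam by (simp add: bilinear_radd[OF bil] w_def)
  qed
  obtain n :: nat and E F where EF: "\<And>j. j < n \<Longrightarrow> E j \<in> hc_even D" "\<And>j. j < n \<Longrightarrow> F j \<in> hc_even D"
    "\<And>i j. i < n \<Longrightarrow> j < n \<Longrightarrow> w (E i) (F j) = (if i = j then 1 else 0)"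
    "\<And>i j. i < n \<Longrightarrow> j < n \<Longrightarrow> w (E i) (E j) = 0"
    "\<And>i j. i < n \<Longrightarrow> j < n \<Longrightarrow> w (F i) (F j) = 0"
    "\<And>v. v \<in> hc_even D \<Longrightarrow> v = (\<Sum>j<n. w v (F j) *\<^sub>R E j + w (E j) v *\<^sub>R F j)"
    by (rule symplectic_basis[OF sub(1) w_bil w_alt w_nondeg]) auto
  define emb where "emb = (\<lambda>j c. Re c *\<^sub>R E j + Im c *\<^sub>R F j)"
  define co where "co = (\<lambda>j v. Complex (w v (F j)) (w (E j) v))"
  note form = bilinear_ladd[OF w_bil] bilinear_radd[OF w_bil] bilinear_lmul[OF w_bil] bilinear_rmul[OF w_bil]
  have "weyl_frame D chi lam n emb co"
  proof (rule weyl_frame.intro)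
    show "emb j c \<in> hc_even D" if "j < n" for j c
      using EF(1,2)[OF that] sub(1) by (simp add: emb_def subspace_add subspace_mul)
    show "bounded_linear (emb j)" for j
      unfolding linear_conv_bounded_linear[symmetric] by (rule linearI) (simp_all add: emb_def algebra_simps)
    show "bounded_linear (co j)" for j
      unfolding linear_conv_bounded_linear[symmetric] by (rule linearI) (simp_all add: co_def form complex_eq_iff)
    show "co i (emb j c) = (if i = j then c else 0)" if "i < n" "j < n" for i j c
      using that EF(3-5) w_alt[OF EF(2)[OF that(2)] EF(1)[OF that(1)]]
      by (simp add: co_def emb_def form complex_eq_iff)
    show "v = (\<Sum>j<n. emb j (co j v))" if "v \<in> hc_even D" for v
      using EF(6)[OF that] by (simp add: emb_def co_def)
    show "lam * hc_form D v v' = 2 * (\<Sum>j<n. Im (co j v * cnj (co j v')))"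
      if v: "v \<in> hc_even D" "v' \<in> hc_even D" for v v'
    proof -
      have lin: "linear (w v)" using w_bil by (simp add: bilinear_def)
      have "w v v' = w v (\<Sum>j<n. w v' (F j) *\<^sub>R E j + w (E j) v' *\<^sub>R F j)" using EF(6)[OF v(2)] by simp
      also have "\<dots> = (\<Sum>j<n. w v' (F j) * w v (E j) + w (E j) v' * w v (F j))"
        by (simp add: linear_sum[OF lin] linear_add[OF lin] linear_scale[OF lin])
      also have "\<dots> = (\<Sum>j<n. - Im (co j v * cnj (co j v')))"
        by (rule sum.cong) (use w_alt[OF v(1) EF(1)] in \<open>auto simp: co_def\<close>)
      finally have "- w v v' = (\<Sum>j<n. Im (co j v * cnj (co j v')))" by (simp only: sum_negf minus_minus)
      thus ?thesis by (simp add: w_def)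
    qed
  qed (use hc chi in auto)
  thus thesis by (rule that)
qed

lemma hc_frame_exists:
  assumes hc: "heisenberg_clifford D" and chi: "\<And>t. chi (0, t) = cis (lam * t)" and lam: "lam \<noteq> 0"
    and pos: "\<And>X. X \<in> hc_odd D \<Longrightarrow> X \<noteq> 0 \<Longrightarrow> lam * hc_form D X X > 0"
  obtains n emb co m u where "hc_frame D chi lam n emb co m u"
proof -
  obtain n emb co where frame: "weyl_frame D chi lam n emb co" by (rule weyl_frame_exists[OF hc chi lam])
  \<comment> \<open>Half of \<open>lam\<close> times the form, so that an orthonormal basis takes
    the value 2 required of \<open>u\<close>. Only the product with \<open>lam\<close> has to be
    positive, which includes negative definite forms.\<close>
  define b where "b = (\<lambda>X Y. (lam / 2) * hc_form D X Y)"
  have sub: "subspace (hc_odd D)" and bil: "bilinear (hc_form D)"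
    and sym: "\<And>P Q. P \<in> hc_odd D \<Longrightarrow> Q \<in> hc_odd D \<Longrightarrow> hc_form D P Q = hc_form D Q P"
    using hc unfolding heisenberg_clifford_def by blast+
  have b_bil: "bilinear b"
    unfolding b_def by (rule bilinear_scaled[OF bil])
  obtain m :: nat and u where u: "\<And>j. j < m \<Longrightarrow> u j \<in> hc_odd D"
    "\<And>i j. i < m \<Longrightarrow> j < m \<Longrightarrow> b (u i) (u j) = (if i = j then 1 else 0)"
    "\<And>v. v \<in> hc_odd D \<Longrightarrow> v = (\<Sum>j<m. b v (u j) *\<^sub>R u j)"
  proof (rule orthonormal_basis_of_form[OF sub b_bil])
    show "b x y = b y x" if "x \<in> hc_odd D" "y \<in> hc_odd D" for x y using sym[OF that] by (simp add: b_def)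
    show "b x x > 0" if "x \<in> hc_odd D" "x \<noteq> 0" for x using pos[OF that] by (simp add: b_def)
  qed auto
  have "hc_frame D chi lam n emb co m u"
  proof (intro hc_frame.intro frame hc_frame_axioms.intro)
    show "lam * hc_form D (u i) (u j) = (if i = j then 2 else 0)" if "i < m" "j < m" for i j
      using u(2)[OF that] by (auto simp: b_def split: if_splits)
    show "X = (\<Sum>i<m. (lam / 2 * hc_form D X (u i)) *\<^sub>R u i)" if "X \<in> hc_odd D" for X
      using u(3)[OF that] by (simp add: b_def)
  qed (rule u(1))
  thus thesis by (rule that)
qed

text \<open>Scaling an odd vector reaches only nonnegative multiples of its value under the form.
  The single value \<open>pi / \<bar>a - b\<bar>\<close> already separates the two
  characters.\<close>

lemma cis_eq_on_nonneg:
  assumes "\<And>s. s \<ge> 0 \<Longrightarrow> cis (a * s) = cis (b * s)"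
  shows "a = b"
proof (rule ccontr)
  assume "a \<noteq> b"
  define s where "s = pi / \<bar>a - b\<bar>"
  have s: "s \<ge> 0" "\<bar>(a - b) * s\<bar> = pi" using \<open>a \<noteq> b\<close> by (auto simp: s_def abs_mult)
  have "cis ((a - b) * s) = cis (a * s) / cis (b * s)" by (simp add: cis_divide left_diff_distrib)
  hence "cis ((a - b) * s) = 1" using assms[OF s(1)] by simp
  hence "cos ((a - b) * s) = 1" by (metis cis.sel(1) one_complex.sel(1))
  hence "cos pi = (1::real)" using s(2) by (metis cos_abs_real)
  thus False by simp
qed

theorem theorem5p8:
  fixes D :: "'v::euclidean_space hc_data"
    and chi :: "'v \<times> real \<Rightarrow> complex"
  assumes "heisenberg_clifford D"
    and "unitary_character D chi"
    and "\<exists>z\<in>hc_centre. chi z \<noteq> 1"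
  shows
    "(indefinite_on (hc_n1 D) (hc_B D) \<longrightarrow>
        \<not> (\<exists>R :: ('v, 'h::complex_hilbert) hc_rep.
              irreducible_unitary_rep D R \<and> has_central_character R chi)) \<and>
     (definite_on (hc_n1 D) (hc_B D) \<longrightarrow>
        (agrees D chi \<longrightarrow>
          (\<exists>R :: ('v, ell2) hc_rep. irreducible_unitary_rep D R \<and> has_central_character R chi) \<and>
          (\<forall>(R :: ('v, 'h) hc_rep) (R' :: ('v, 'k::complex_hilbert) hc_rep).
              irreducible_unitary_rep D R \<and> has_central_character R chi \<and>
              irreducible_unitary_rep D R' \<and> has_central_character R' chi \<longrightarrow>
              unitarily_equivalent D R R' \<or> unitarily_equivalent D R (parity_change R'))) \<and>
        (\<not> agrees D chi \<longrightarrow>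
          \<not> (\<exists>R :: ('v, 'h) hc_rep.
                irreducible_unitary_rep D R \<and> has_central_character R chi)))"
proof -
  have bil: "bilinear (hc_form D)" and sub: "subspace (hc_odd D)"
    using assms(1) unfolding heisenberg_clifford_def by blast+
  have centre: "z \<in> hc_centre \<longleftrightarrow> (\<exists>t. z = (0, t))" for z :: "'v \<times> real"
    by (auto simp: hc_centre_def hc_exp_def)
  obtain lam where chi: "\<And>t. chi (0, t) = cis (lam * t)"
  proof (rule unitary_character_real[of "\<lambda>t. chi (0, t)"])
    note u = assms(2)[unfolded unitary_character_def]
    show "continuous_on UNIV (\<lambda>t. chi (0, t))"
      by (rule continuous_on_compose2[of hc_centre chi]) (use u centre in \<open>auto intro!: continuous_intros\<close>)
    show "cmod (chi (0, t)) = 1" for t using u centre by blast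
    show "chi (0, s + t) = chi (0, s) * chi (0, t)" for s t
    proof -
      have "chi (hc_mult D (0, s) (0, t)) = chi (0, s) * chi (0, t)" using u centre by blast
      thus ?thesis by (simp add: hc_mult_def hc_bracket_def bilinear_lzero[OF bil])
    qed
  qed auto
  have lam: "lam \<noteq> 0"
  proof
    assume "lam = 0"
    thus False using assms(3) chi centre by auto
  qed
  have B: "hc_B D P P = hc_form D (fst P) (fst P)" for P by (simp add: hc_B_def hc_bracket_def)
  obtain n emb co where "weyl_frame D chi lam n emb co" by (rule weyl_frame_exists[OF assms(1) chi lam])
  then interpret W: weyl_frame D chi lam n emb co .
  \<comment> \<open>Both nonexistence claims rest on this inequality: values of both signs would
    force \<open>lam = 0\<close>, and in any case it gives agreement with the constant
    \<open>\<bar>lam\<bar>\<close>.\<close>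
  have nonneg: "lam * hc_B D P P \<ge> 0"
    if "irreducible_unitary_rep D R" "has_central_character R chi" "P \<in> hc_n1 D"
    for R :: "('v, 'h) hc_rep" and P
    unfolding B by (rule W.form_nonneg[of R]) (use that in \<open>auto simp: W.is_rep_def irreducible_unitary_rep_def hc_n1_def\<close>)
  show ?thesis
  proof (intro conjI impI notI)
    assume "indefinite_on (hc_n1 D) (hc_B D)"
    then obtain P Q where PQ: "P \<in> hc_n1 D" "hc_B D P P > 0" "Q \<in> hc_n1 D" "hc_B D Q Q < 0"
      unfolding indefinite_on_def by blast
    assume "\<exists>R :: ('v, 'h) hc_rep. irreducible_unitary_rep D R \<and> has_central_character R chi"
    then obtain R :: "('v, 'h) hc_rep" where "irreducible_unitary_rep D R" "has_central_character R chi" by blast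
    from nonneg[OF this PQ(1)] nonneg[OF this PQ(3)] have "lam = 0"
      using PQ by (simp add: zero_le_mult_iff)
    thus False using lam by contradiction
  next
    assume nag: "\<not> agrees D chi"
    assume "\<exists>R :: ('v, 'h) hc_rep. irreducible_unitary_rep D R \<and> has_central_character R chi"
    then obtain R :: "('v, 'h) hc_rep" where R: "irreducible_unitary_rep D R" "has_central_character R chi" by blast
    have "agrees D chi"
      unfolding agrees_def
    proof (intro exI[of _ "\<bar>lam\<bar>"] conjI ballI)
      show "\<bar>lam\<bar> > 0" using lam by simp
      fix P assume "P \<in> hc_n1 D"
      hence "\<bar>lam\<bar> * \<bar>hc_B D P P\<bar> = lam * hc_B D P P" using nonneg[OF R] by (simp add: abs_mult[symmetric])
      moreover have "chi (hc_exp (hc_bracket D P P)) = cis (lam * hc_B D P P)"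
        by (simp add: hc_exp_def hc_bracket_def chi B)
      ultimately show "chi (hc_exp (hc_bracket D P P)) = exp (complex_of_real (\<bar>lam\<bar> * \<bar>hc_B D P P\<bar>) * \<i>)"
        by (simp only: cis_conv_exp mult.commute)
    qed
    thus False using nag by contradiction
  next
    assume def: "definite_on (hc_n1 D) (hc_B D)" and ag: "agrees D chi"
    have pos: "lam * hc_form D X X > 0" if X: "X \<in> hc_odd D" "X \<noteq> 0" for X
    proof -
      let ?b = "hc_form D X X"
      have "(X, 0) \<in> hc_n1 D" "(X, 0) \<noteq> (0 :: 'v \<times> real)" using X by (auto simp: hc_n1_def zero_prod_def)
      hence b: "?b \<noteq> 0"
        using def unfolding definite_on_def positive_definite_on_def by (force simp: B)
      obtain c where c: "c > 0" "\<And>P. P \<in> hc_n1 D \<Longrightarrow>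
          chi (hc_exp (hc_bracket D P P)) = exp (complex_of_real (c * \<bar>hc_B D P P\<bar>) * \<i>)"
        using ag unfolding agrees_def by blast
      \<comment> \<open>Agreement at all multiples of \<open>X\<close> identifies the exponents
        themselves, not merely modulo \<open>2 * pi\<close>, and thus fixes the sign of
        \<open>lam\<close> relative to the form.\<close>
      have "lam * ?b = c * \<bar>?b\<bar>"
      proof (rule cis_eq_on_nonneg)
        fix s :: real assume s: "s \<ge> 0"
        let ?P = "(sqrt s *\<^sub>R X, 0)"
        have P: "?P \<in> hc_n1 D" using X sub by (simp add: hc_n1_def subspace_mul)
        have BP: "hc_B D ?P ?P = ?b * s"
          using s by (simp add: B bilinear_lmul[OF bil] bilinear_rmul[OF bil] mult.assoc[symmetric] mult.commute)
        have "cis (lam * (?b * s)) = exp (complex_of_real (c * \<bar>?b * s\<bar>) * \<i>)"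
          using c(2)[OF P] BP by (simp add: hc_exp_def hc_bracket_def chi hc_B_def)
        thus "cis (lam * ?b * s) = cis (c * \<bar>?b\<bar> * s)"
          using s by (simp add: cis_conv_exp abs_mult mult_ac)
      qed
      thus ?thesis using c(1) b by simp
    qed
    obtain n emb co m u where "hc_frame D chi lam n emb co m u"
      by (rule hc_frame_exists[OF assms(1) chi lam pos])
    then interpret F: hc_frame D chi lam n emb co m u .
    show "\<exists>R :: ('v, ell2) hc_rep. irreducible_unitary_rep D R \<and> has_central_character R chi"
      using F.model_irreducible F.model_is_rep unfolding F.is_rep_def by blast
    show "\<forall>(R :: ('v, 'h) hc_rep) (R' :: ('v, 'k::complex_hilbert) hc_rep).
        irreducible_unitary_rep D R \<and> has_central_character R chi \<and>
        irreducible_unitary_rep D R' \<and> has_central_character R' chi \<longrightarrow>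
        unitarily_equivalent D R R' \<or> unitarily_equivalent D R (parity_change R')"
      by (intro allI impI F.uniqueness) (auto simp: F.is_rep_def irreducible_unitary_rep_def)
  qed
qed

end
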